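(* Let $\mathcal{D}=(D,B,\mu)$ be a positive blueprint such that every configuration $(b_i,b_j,b_{ij})$ in the support of $D$ satisfies the triangle inequalities strictly: $-1+|b_i+b_j|<b_{ij}<1-|b_i-b_j|$. Then there exist constants $C>0$ and $\varepsilon_0>0$ such that for every $\varepsilon\in(0,\varepsilon_0)$ and every sufficiently large $n$, there exists a graph $G=(V,E,w_V,w_E)$ on vertex set $V=\{1,\ldots,n\}$ with nonnegative vertex weights $w_V$ and edge weights $w_E$ such that: (1) there exist unit vectors $\mathbf{v}_0,\ldots,\mathbf{v}_n$ forming a $C\varepsilon$-uncorrelated weighted MAX BISECTION vector solution for $G$ that satisfies the triangle inequalities on the edges, with $\sum_{\{i,j\}\in E}w_E(\{i,j\})\frac{1-\mathbf{v}_i\cdot\mathbf{v}_j}{2}\ge\mathsf{Completeness}(\mathcal{D})-C\varepsilon$; (2) for every $\delta\ge 0$ and every $A\subseteq V$ with $\bigl|\sum_{i\in A}w_V(i)-\sum_{i\in V\setminus A}w_V(i)\bigr|\le\delta\sum_{i\in V}w_V(i)$, we have $\sum_{\{i,j\}\in E,\, i\in A,\, j\in V\setminus A}w_E(\{i,j\})\le\mathsf{Soundness}(\mathcal{D})+C\delta+C\varepsilon$. The constant $C$ does not depend on $\varepsilon$ or $\delta$.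
   Context: $\Phi$ is the standard normal CDF. For $\rho\in[-1,1]$, $\Gamma_\rho(q_1,q_2)=\Pr[x\le\Phi^{-1}(q_1),\,y\le\Phi^{-1}(q_2)]$ for jointly Gaussian standard normals $x,y$ with correlation $\rho$. A configuration is $\theta=(b_i,b_j,b_{ij})\in[-1,1]^3$ with $-1+|b_i+b_j|\le b_{ij}\le1-|b_i-b_j|$. Its relative pairwise bias is $\rho(\theta)=\frac{b_{ij}-b_ib_j}{\sqrt{(1-b_i^2)(1-b_j^2)}}$ (or $0$ if the denominator is $0$); $\theta$ is positive if $\rho(\theta)\le0$. A blueprint $\mathcal{D}=(D,B,\mu)$: $D$ a finitely supported distribution on configurations, $B$ the set of biases (first two coordinates) appearing in its support, $\mu$ a probability measure on $B$ with $\sum_b\mu(b)b=0$; positive if all configurations in the support are positive. $\mathsf{Completeness}(\mathcal{D})=\mathbb{E}_{D}\frac{1-b_{ij}}{2}$. For $t:B\to[-1,1]$, $\mathsf{Soundness}(\mathcal{D},t)=\mathbb{E}_{\theta\sim D}[\frac{1-t(b_i)}{2}+\frac{1-t(b_j)}{2}-2\Gamma_{\rho(\theta)}(\frac{1-t(b_i)}{2},\frac{1-t(b_j)}{2})]$, and $\mathsf{Soundness}(\mathcal{D})$ is the maximum of this over $t$ with $\sum_b\mu(b)t(b)=0$. For a vertex-weighted graph on $V=[n]$, unit vectors $\mathbf{v}_0,\ldots,\mathbf{v}_n$ (with $|\mathbf{v}_0\cdot\mathbf{v}_i|\ne1$) form a $\gamma$-uncorrelated weighted MAX BISECTION vector solution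 if $\sum_{i=1}^n w_V(i)\,\mathbf{v}_0\cdot\mathbf{v}_i=0$ and $\frac{1}{(\sum_{i\in V}w_V(i))^2}\sum_{i,j\in V}w_V(i)w_V(j)|\mathbf{v}_i^\perp\cdot\mathbf{v}_j^\perp|\le\gamma$, where $\mathbf{v}_i^\perp=\frac{\mathbf{v}_i-(\mathbf{v}_0\cdot\mathbf{v}_i)\mathbf{v}_0}{\sqrt{1-(\mathbf{v}_0\cdot\mathbf{v}_i)^2}}$. They satisfy the triangle inequalities on the edges if for every edge $\{i,j\}$: $-1+|\mathbf{v}_0\cdot\mathbf{v}_i+\mathbf{v}_0\cdot\mathbf{v}_j|\le\mathbf{v}_i\cdot\mathbf{v}_j\le1-|\mathbf{v}_0\cdot\mathbf{v}_i-\mathbf{v}_0\cdot\mathbf{v}_j|$. *)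

theory Defs
  imports "HOL-Probability.Probability"
begin

definition std_normal :: "real measure" where
  "std_normal = density lborel std_normal_density"

definition Phi :: "real \<Rightarrow> real" where
  "Phi x = measure std_normal {..x}"

text \<open>Gamma_rho(q1,q2) = Pr[x \<le> Phi^-1(q1), y \<le> Phi^-1(q2)] for standard normals x,y with
  correlation rho.  We realise (x,y) as x = g1, y = rho g1 + sqrt(1-rho^2) g2 with g1,g2 independent
  standard normals, and write the event x \<le> Phi^-1(q) as Phi x \<le> q (Phi is a strictly increasing
  continuous bijection onto (0,1); this also covers q = 0, 1 where Phi^-1(q) = -inf, +inf).\<close>
definition Gamma :: "real \<Rightarrow> real \<Rightarrow> real \<Rightarrow> real" where
  "Gamma rho q1 q2 = measure (std_normal \<Otimes>\<^sub>M std_normal)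
     {(g1, g2). Phi g1 \<le> q1 \<and> Phi (rho * g1 + sqrt (1 - rho\<^sup>2) * g2) \<le> q2}"

type_synonym config = "real \<times> real \<times> real"

definition is_config :: "config \<Rightarrow> bool" where
  "is_config \<theta> = (case \<theta> of (bi, bj, bIJ) \<Rightarrow>
     (bi \<in> {-1..1} \<and> bj \<in> {-1..1} \<and> bIJ \<in> {-1..1} \<and>
      -1 + \<bar>bi + bj\<bar> \<le> bIJ \<and> bIJ \<le> 1 - \<bar>bi - bj\<bar>))"

definition rel_bias :: "config \<Rightarrow> real" where
  "rel_bias \<theta> = (case \<theta> of (bi, bj, bIJ) \<Rightarrow>
     (if (1 - bi\<^sup>2) * (1 - bj\<^sup>2) = 0 then 0
      else (bIJ - bi * bj) / sqrt ((1 - bi\<^sup>2) * (1 - bj\<^sup>2))))"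

definition positive_config :: "config \<Rightarrow> bool" where
  "positive_config \<theta> = (rel_bias \<theta> \<le> 0)"

definition biases :: "config pmf \<Rightarrow> real set" where
  "biases D = (\<lambda>\<theta>. fst \<theta>) ` set_pmf D \<union> (\<lambda>\<theta>. fst (snd \<theta>)) ` set_pmf D"

text \<open>A blueprint (D,B,mu) with B = biases D.\<close>
definition is_blueprint :: "config pmf \<Rightarrow> real pmf \<Rightarrow> bool" where
  "is_blueprint D \<mu> = (finite (set_pmf D) \<and> (\<forall>\<theta>\<in>set_pmf D. is_config \<theta>) \<and>
     set_pmf \<mu> \<subseteq> biases D \<and> (\<Sum>b\<in>biases D. pmf \<mu> b * b) = 0)"

definition positive_blueprint :: "config pmf \<Rightarrow> real pmf \<Rightarrow> bool" where
  "positive_blueprint D \<mu> = (is_blueprint D \<mu> \<and> (\<forall>\<theta>\<in>set_pmf D. positive_config \<theta>))"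

definition completeness :: "config pmf \<Rightarrow> real" where
  "completeness D = measure_pmf.expectation D (\<lambda>(bi, bj, bIJ). (1 - bIJ) / 2)"

definition soundness_t :: "config pmf \<Rightarrow> (real \<Rightarrow> real) \<Rightarrow> real" where
  "soundness_t D t = measure_pmf.expectation D (\<lambda>\<theta>. case \<theta> of (bi, bj, bIJ) \<Rightarrow>
     ((1 - t bi) / 2 + (1 - t bj) / 2 - 2 * Gamma (rel_bias \<theta>) ((1 - t bi) / 2) ((1 - t bj) / 2)))"

text \<open>Maximum over t : B \<rightarrow> [-1,1] with sum_b mu(b) t(b) = 0 (written as a supremum;
  values of t outside B are irrelevant).\<close>
definition soundness :: "config pmf \<Rightarrow> real pmf \<Rightarrow> real" where
  "soundness D \<mu> = Sup {soundness_t D t | t.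
     (\<forall>b\<in>biases D. t b \<in> {-1..1}) \<and> (\<Sum>b\<in>biases D. pmf \<mu> b * t b) = 0}"

text \<open>Vectors in R^m are represented as functions nat \<Rightarrow> real, using coordinates 0..m-1.\<close>
definition ip :: "nat \<Rightarrow> (nat \<Rightarrow> real) \<Rightarrow> (nat \<Rightarrow> real) \<Rightarrow> real" where
  "ip m u w = (\<Sum>k<m. u k * w k)"

definition perp :: "nat \<Rightarrow> (nat \<Rightarrow> real) \<Rightarrow> (nat \<Rightarrow> real) \<Rightarrow> (nat \<Rightarrow> real)" where
  "perp m v0 vi = (\<lambda>k. (vi k - ip m v0 vi * v0 k) / sqrt (1 - (ip m v0 vi)\<^sup>2))"

definition uncorr_bisection_solution ::
  "nat \<Rightarrow> nat \<Rightarrow> (nat \<Rightarrow> real) \<Rightarrow> real \<Rightarrow> (nat \<Rightarrow> nat \<Rightarrow> real) \<Rightarrow> bool" where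
  "uncorr_bisection_solution m n wV \<gamma> v =
     ((\<forall>i\<in>{0..n}. ip m (v i) (v i) = 1) \<and>
      (\<forall>i\<in>{1..n}. \<bar>ip m (v 0) (v i)\<bar> \<noteq> 1) \<and>
      (\<Sum>i=1..n. wV i * ip m (v 0) (v i)) = 0 \<and>
      (1 / (\<Sum>i=1..n. wV i)\<^sup>2) * (\<Sum>i=1..n. \<Sum>j=1..n.
          wV i * wV j * \<bar>ip m (perp m (v 0) (v i)) (perp m (v 0) (v j))\<bar>) \<le> \<gamma>)"

text \<open>Edges are represented as pairs (i,j) with i < j standing for {i,j}.\<close>
definition triangle_on_edges ::
  "nat \<Rightarrow> (nat \<times> nat) set \<Rightarrow> (nat \<Rightarrow> nat \<Rightarrow> real) \<Rightarrow> bool" where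
  "triangle_on_edges m E v = (\<forall>(i, j)\<in>E.
     -1 + \<bar>ip m (v 0) (v i) + ip m (v 0) (v j)\<bar> \<le> ip m (v i) (v j) \<and>
     ip m (v i) (v j) \<le> 1 - \<bar>ip m (v 0) (v i) - ip m (v 0) (v j)\<bar>)"

definition is_weighted_graph ::
  "nat \<Rightarrow> (nat \<times> nat) set \<Rightarrow> (nat \<Rightarrow> real) \<Rightarrow> (nat \<times> nat \<Rightarrow> real) \<Rightarrow> bool" where
  "is_weighted_graph n E wV wE =
     (E \<subseteq> {(i, j). 1 \<le> i \<and> i < j \<and> j \<le> n} \<and>
      (\<forall>i\<in>{1..n}. 0 \<le> wV i) \<and> (\<forall>e\<in>E. 0 \<le> wE e))"

definition cut_weight :: "(nat \<times> nat) set \<Rightarrow> (nat \<times> nat \<Rightarrow> real) \<Rightarrow> nat set \<Rightarrow> real" where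
  "cut_weight E wE A = (\<Sum>(i, j)\<in>{(i, j)\<in>E. (i \<in> A) \<noteq> (j \<in> A)}. wE (i, j))"

end

theory Submission
  imports Defs
begin

text \<open>
  The vertices are pairs \<open>(b, X)\<close> of a bias and a lattice point \<open>X \<in> \<int>\<^sup>d\<close>, weighted by \<open>\<mu>(b)\<close> times the law of \<open>X\<close>, and
  \<open>(b, X)\<close> carries the vector \<open>b v\<^sub>0 + sqrt (1 - b\<^sup>2) X / |X|\<close>. For a configuration \<open>\<theta>\<close> the edges join the end points
  of two \<open>d\<close>-dimensional lattice walks with \<open>\<rho>(\<theta>)\<close>-correlated signs, each finally smeared out by an independent
  uniform window; pairs whose normalized inner product is not close to \<open>\<rho>(\<theta>)\<close> are discarded. As \<open>d\<close> grows, the law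
  of large numbers makes the discarded mass and the average correlation small, which gives completeness.

  Soundness is Borell's inequality \<open>E f(X) g(Y) \<ge> Gamma\<^sub>\<rho>(E f, E g) - \<epsilon>\<close> for \<open>\<rho> \<le> 0\<close>, which is proved directly on the lattice.
  Along the walk, \<open>Gamma\<^sub>\<rho>\<close> of the two conditional expectations is a submartingale to second order, since
  the Hessian of \<open>Gamma\<^sub>\<rho>\<close> becomes positive semidefinite once its mixed entry is multiplied by \<open>\<rho>\<close>. The windows make all
  increments small, so the error of a step is a small multiple of the squared increments; these are
  orthogonal and hence sum to at most a constant, whatever the number of steps and the dimension. At the end
  of the walks \<open>Gamma\<^sub>\<rho>(x, y) \<le> x y\<close> by convexity. The inequality in dimension one tensorizes.
\<close>

section \<open>The Gaussian distribution function and orthant probabilities\<close>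

text \<open>The parameters are chosen in the order \<open>R\<close>, \<open>k\<close>,
  \<open>d\<close>, \<open>n\<close>, and this order shapes the proof. The independent windows
  dilute the correlation of the end points from \<open>r\<close> to
  \<open>k * r / (k + window_var R)\<close>, so the walk must be long compared with the window. This
  is consistent only because the \<open>R\<close> demanded by the soundness estimate depends on
  \<open>r\<close> and the error alone. The windows may be independent because separate convexity of
  \<open>Gamma r\<close> settles that last stage. Uniform control of the Hessian of
  \<open>Gamma r\<close> is available only away from the boundary of the unit square, so indicator
  functions are first squeezed into \<open>{\<eta>..1 - \<eta>}\<close>. Every configuration gives a
  lattice point the same marginal law. Hence one weighted vertex set serves all of them, and the
  soundness bound depends on a vertex set only through its density in each bias class. Strictness of
  the triangle inequalities is spent twice: it keeps \<open>rel_bias\<close> above -1, and its slack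
  absorbs the deviation of the inner products on the retained edges.\<close>

abbreviation phi :: "real \<Rightarrow> real" where "phi \<equiv> std_normal_density"

lemma sets_std_normal [simp, measurable_cong]: "sets std_normal = sets borel"
  by (simp add: std_normal_def)

lemma space_std_normal [simp]: "space std_normal = UNIV"
  by (simp add: std_normal_def)

interpretation SN: real_distribution std_normal
  unfolding std_normal_def by (rule real_dist_normal_dist)

lemma Phi_eq_cdf: "Phi = cdf std_normal"
  by (simp add: fun_eq_iff Phi_def cdf_def)

lemma continuous_on_phi [continuous_intros]: "continuous_on A f \<Longrightarrow> continuous_on A (\<lambda>x. phi (f x))"
  unfolding normal_density_def by (intro continuous_intros) auto

lemma Phi_diff: 
  assumes "a \<le> b"
  shows "Phi b - Phi a = integral {a..b} phi"
proof (cases "a = b")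
  case False
  then have "Phi b - Phi a = measure std_normal {a<..b}"
    using assms by (simp add: Phi_eq_cdf SN.cdf_diff_eq)
  also have "\<dots> = (\<integral>x. indicator {a<..b} x \<partial>std_normal)"
    by simp
  also have "\<dots> = (LINT x:{a<..b}|lborel. phi x)"
    unfolding std_normal_def
    by (subst integral_density) (auto simp: set_lebesgue_integral_def mult.commute)
  also have "\<dots> = integral {a<..b} phi"
    by (intro set_borel_integral_eq_integral(2)) (use integrable_mult_indicator[of "{a<..b}" lborel phi] in \<open>simp add: set_integrable_def\<close>)
  also have "\<dots> = integral {a..b} phi"
    by (rule integral_spike_set) (auto intro: negligible_subset[of "{a}"])
  finally show ?thesis .
qed auto

lemma Phi_DERIV: "DERIV Phi x :> phi x"
proof -
  have "((\<lambda>u. integral {x-1..u} phi) has_real_derivative phi x) (at x within {x-1..x+1})"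
    by (rule integral_has_real_derivative) (auto intro!: continuous_intros)
  then have "((\<lambda>u. integral {x-1..u} phi) has_real_derivative phi x) (at x)"
    by (subst (asm) at_within_interior) auto
  then have "((\<lambda>u. Phi (x - 1) + integral {x-1..u} phi) has_real_derivative phi x) (at x)"
    by (auto intro!: derivative_eq_intros)
  then show ?thesis
    by (rule has_field_derivative_transform_within[where d=1])
       (auto simp: dist_real_def Phi_diff[of "x-1", symmetric] abs_if split: if_splits)
qed

lemma isCont_Phi [simp]: "isCont Phi x"
  by (rule DERIV_isCont[OF Phi_DERIV])

lemma continuous_on_Phi [continuous_intros]: "continuous_on A f \<Longrightarrow> continuous_on A (\<lambda>x. Phi (f x))"
  by (rule continuous_on_compose2[of UNIV Phi]) (simp_all add: continuous_at_imp_continuous_on)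

lemma Phi_strict_mono: "strict_mono Phi"
proof (rule strict_monoI)
  fix x y :: real assume "x < y"
  then show "Phi x < Phi y"
    by (rule DERIV_pos_imp_increasing) (meson Phi_DERIV normal_density_pos zero_less_one)
qed

lemma Phi_less_iff [simp]: "Phi x < Phi y \<longleftrightarrow> x < y"
  by (rule strict_mono_less[OF Phi_strict_mono])

lemma Phi_le_iff [simp]: "Phi x \<le> Phi y \<longleftrightarrow> x \<le> y"
  by (rule strict_mono_less_eq[OF Phi_strict_mono])

lemma Phi_range: "0 < Phi x" "Phi x < 1"
proof -
  have "0 \<le> Phi (x - 1)" "Phi (x + 1) \<le> 1"
    by (auto simp: Phi_def)
  moreover have "Phi (x - 1) < Phi x" "Phi x < Phi (x + 1)"
    by auto
  ultimately show "0 < Phi x" "Phi x < 1"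
    by linarith+
qed

lemma Phi_surj:
  assumes "0 < q" "q < 1"
  shows "\<exists>x. Phi x = q"
proof -
  have "eventually (\<lambda>x. Phi x < q) at_bot" "eventually (\<lambda>x. q < Phi x) at_top"
    using order_tendstoD(2)[OF SN.cdf_lim_at_bot] order_tendstoD(1)[OF SN.cdf_lim_at_top_prob] assms
    by (auto simp: Phi_eq_cdf)
  then obtain a b where ab: "Phi a < q" "q < Phi b"
    by (auto simp: eventually_at_bot_linorder eventually_at_top_linorder)
  then have "a < b"
    using Phi_less_iff[of a b] by linarith
  have "\<exists>x\<ge>a. x \<le> b \<and> Phi x = q"
    by (rule IVT) (use ab \<open>a < b\<close> in \<open>simp_all\<close>)
  then show ?thesis
    by blast
qed

definition Phinv :: "real \<Rightarrow> real" where
  "Phinv = inv Phi"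

lemma Phi_Phinv [simp]: "0 < q \<Longrightarrow> q < 1 \<Longrightarrow> Phi (Phinv q) = q"
  unfolding Phinv_def using Phi_surj[of q] by (metis f_inv_into_f rangeI)

lemma Phinv_Phi [simp]: "Phinv (Phi x) = x"
  unfolding Phinv_def by (rule inv_f_f[OF strict_mono_imp_inj_on[OF Phi_strict_mono]])

lemma isCont_Phinv:
  assumes "0 < q" "q < 1"
  shows "isCont Phinv q"
proof -
  have "isCont Phinv (Phi (Phinv q))"
    by (rule isCont_inverse_function[where d=1]) simp_all
  then show ?thesis using assms by simp
qed

lemma DERIV_Phinv:
  assumes "0 < q" "q < 1"
  shows "DERIV Phinv q :> 1 / phi (Phinv q)"
proof -
  have "DERIV Phinv q :> inverse (phi (Phinv q))"
    by (rule DERIV_inverse_function[where f=Phi and a=0 and b=1])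
       (use assms in \<open>auto intro: Phi_DERIV isCont_Phinv simp: normal_density_pos less_imp_neq[symmetric]\<close>)
  then show ?thesis by (simp add: field_simps)
qed

lemma continuous_on_Phinv: 
  assumes "continuous_on A f" "\<And>x. x \<in> A \<Longrightarrow> 0 < f x \<and> f x < 1"
  shows "continuous_on A (\<lambda>x. Phinv (f x))"
  by (rule continuous_on_compose2[of "{0<..<1}" Phinv])
     (use assms in \<open>auto intro!: continuous_at_imp_continuous_on isCont_Phinv\<close>)

lemma Phi_borel [measurable]: "Phi \<in> borel_measurable borel"
  by (intro borel_measurable_continuous_onI continuous_on_Phi continuous_on_id)

text \<open>This is the probability integral transform: \<open>Phi\<close> carries the standard
  normal law to the uniform law on the unit interval. At \<open>q = 0\<close> and
  \<open>q = 1\<close> the event is empty or everything, since \<open>Phi\<close> never attains 0 or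
  1, so boundary values of \<open>Gamma\<close> involve no infinite quantiles.\<close>

lemma measure_Phi_le:
  assumes "0 \<le> q" "q \<le> 1"
  shows "measure std_normal {x. Phi x \<le> q} = q"
proof -
  consider "q = 0" | "q = 1" | "0 < q" "q < 1" using assms by linarith
  then show ?thesis
  proof cases
    case 1
    then have "{x. Phi x \<le> q} = {}" using Phi_range(1) by (auto simp: not_le)
    then show ?thesis using 1 by simp
  next
    case 2
    then have "{x. Phi x \<le> q} = UNIV" using Phi_range(2) less_imp_le by auto
    then show ?thesis using 2 SN.prob_space by simp
  next
    case 3
    then have "{x. Phi x \<le> q} = {..Phinv q}"
      using Phi_le_iff[of _ "Phinv q"] by auto
    then show ?thesis using 3 Phi_def[of "Phinv q"] by simp
  qed
qed

interpretation SN2: pair_prob_space std_normal std_normal ..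

lemma sets_std_normal_pair [simp, measurable_cong]:
  "sets (std_normal \<Otimes>\<^sub>M std_normal) = sets (borel \<Otimes>\<^sub>M borel)"
  by (intro sets_pair_measure_cong) auto

lemma space_std_normal_pair [simp]: "space (std_normal \<Otimes>\<^sub>M std_normal) = UNIV"
  by (simp add: space_pair_measure)

lemma measure_std_normal_Times:
  assumes [measurable]: "A \<in> sets borel" "B \<in> sets borel"
  shows "measure (std_normal \<Otimes>\<^sub>M std_normal) (A \<times> B) = measure std_normal A * measure std_normal B"
  by (simp add: measure_def SN.emeasure_pair_measure_Times enn2real_mult)

section \<open>Orthant probabilities as planar Gaussian measures\<close>

definition Gset :: "real \<Rightarrow> real \<Rightarrow> real \<Rightarrow> (real \<times> real) set" where
  "Gset r p q = {(s, t). Phi s \<le> p \<and> Phi (r * s + sqrt (1 - r\<^sup>2) * t) \<le> q}"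

lemma Gset_sets [measurable]: "Gset r p q \<in> sets (borel \<Otimes>\<^sub>M borel)"
proof -
  have "{x \<in> space (borel \<Otimes>\<^sub>M borel). Phi (fst x) \<le> p \<and> Phi (r * fst x + sqrt (1 - r\<^sup>2) * snd x) \<le> q}
    \<in> sets (borel \<Otimes>\<^sub>M borel)"
    by measurable
  then show ?thesis
    by (simp add: Gset_def case_prod_beta' space_pair_measure)
qed

lemma Gamma_Gset: "Gamma r p q = measure (std_normal \<Otimes>\<^sub>M std_normal) (Gset r p q)"
  by (simp add: Gamma_def Gset_def)

lemma Gamma_nonneg: "0 \<le> Gamma r p q"
  by (simp add: Gamma_def)

text \<open>Divided by \<open>sqrt (1 - r\<^sup>2)\<close>, both sides are the bivariate normal
  density at \<open>(s, t)\<close>, factored as marginal times conditional density in the two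
  possible orders. This yields the symmetry of \<open>Gamma\<close> and later the agreement of the
  mixed second derivatives.\<close>

lemma phi_rotate:
  assumes "r\<^sup>2 < 1"
  shows "phi s * phi ((t - r * s) / sqrt (1 - r\<^sup>2)) = phi t * phi ((s - r * t) / sqrt (1 - r\<^sup>2))"
proof -
  have "s\<^sup>2 + (t - r * s)\<^sup>2 / (1 - r\<^sup>2) = t\<^sup>2 + (s - r * t)\<^sup>2 / (1 - r\<^sup>2)"
    using assms by (simp add: field_simps power2_eq_square)
  then show ?thesis
    using assms by (simp add: normal_density_def exp_add[symmetric] power_divide field_simps)
qed

text \<open>Writing the event with independent normals hides the symmetry of the two thresholds.
  Substituting \<open>(t - r * s) / sqrt (1 - r\<^sup>2)\<close> for the second normal makes the
  domain a product and moves the correlation into the density.\<close>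

lemma Gamma_nn_integral:
  assumes "r\<^sup>2 < 1"
  shows "emeasure (std_normal \<Otimes>\<^sub>M std_normal) (Gset r p q) =
    (\<integral>\<^sup>+s. \<integral>\<^sup>+t. ennreal (phi s * phi ((t - r * s) / sqrt (1 - r\<^sup>2)) / sqrt (1 - r\<^sup>2)) *
      indicator {s. Phi s \<le> p} s * indicator {t. Phi t \<le> q} t \<partial>lborel \<partial>lborel)"
proof -
  define c where "c = sqrt (1 - r\<^sup>2)"
  have c: "c > 0" using assms by (simp add: c_def)
  have "emeasure (std_normal \<Otimes>\<^sub>M std_normal) (Gset r p q) =
     (\<integral>\<^sup>+s. \<integral>\<^sup>+t. indicator (Gset r p q) (s, t) \<partial>std_normal \<partial>std_normal)"
    by (rule SN.emeasure_pair_measure) auto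
  also have "\<dots> = (\<integral>\<^sup>+s. \<integral>\<^sup>+t. ennreal (phi s) * (ennreal (phi t) * indicator (Gset r p q) (s, t)) \<partial>lborel \<partial>lborel)"
    unfolding std_normal_def
    by (subst nn_integral_density; (subst nn_integral_density)?; (measurable; fail)?)
       (auto simp: nn_integral_cmult)
  also have "\<dots> = (\<integral>\<^sup>+s. \<integral>\<^sup>+t. ennreal (phi s * phi ((t - r * s) / c) / c) *
      indicator {s. Phi s \<le> p} s * indicator {t. Phi t \<le> q} t \<partial>lborel \<partial>lborel)"
  proof (rule nn_integral_cong)
    fix s
    have "(\<integral>\<^sup>+t. ennreal (phi s) * (ennreal (phi t) * indicator (Gset r p q) (s, t)) \<partial>lborel) =
      ennreal \<bar>1 / c\<bar> * (\<integral>\<^sup>+t. ennreal (phi s) * (ennreal (phi (- r * s / c + 1 / c * t)) * 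
        indicator (Gset r p q) (s, - r * s / c + 1 / c * t)) \<partial>lborel)"
      by (rule nn_integral_real_affine) (use c in auto)
    also have "\<dots> = (\<integral>\<^sup>+t. ennreal (1 / c) * (ennreal (phi s) * (ennreal (phi (- r * s / c + 1 / c * t)) * 
        indicator (Gset r p q) (s, - r * s / c + 1 / c * t))) \<partial>lborel)"
      using c by (subst nn_integral_cmult) auto
    also have "\<dots> = (\<integral>\<^sup>+t. ennreal (phi s * phi ((t - r * s) / c) / c) *
      indicator {s. Phi s \<le> p} s * indicator {t. Phi t \<le> q} t \<partial>lborel)"
    proof (rule nn_integral_cong)
      fix t
      have *: "- r * s / c + 1 / c * t = (t - r * s) / c" "r * s + c * ((t - r * s) / c) = t"
        using c by (auto simp: field_simps)
      have "ennreal (1 / c) * (ennreal (phi s) * ennreal (phi ((t - r * s) / c))) = ennreal (phi s * phi ((t - r * s) / c) / c)"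
        using c by (simp add: ennreal_mult[symmetric] mult_ac)
      moreover have "(indicator (Gset r p q) (s, (t - r * s) / c) :: ennreal) = indicator {s. Phi s \<le> p} s * indicator {t. Phi t \<le> q} t"
        using * by (auto simp: Gset_def c_def[symmetric] indicator_def)
      ultimately show "ennreal (1 / c) * (ennreal (phi s) * (ennreal (phi (- r * s / c + 1 / c * t)) * 
        indicator (Gset r p q) (s, - r * s / c + 1 / c * t))) = 
        ennreal (phi s * phi ((t - r * s) / c) / c) * indicator {s. Phi s \<le> p} s * indicator {t. Phi t \<le> q} t"
        unfolding *(1) by (simp only: mult.assoc[symmetric])
    qed
    finally show "(\<integral>\<^sup>+t. ennreal (phi s) * (ennreal (phi t) * indicator (Gset r p q) (s, t)) \<partial>lborel) = \<dots>" .
  qed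
  finally show ?thesis by (simp add: c_def)
qed

lemma Gamma_commute:
  assumes "r\<^sup>2 < 1"
  shows "Gamma r p q = Gamma r q p"
proof -
  let ?c = "sqrt (1 - r\<^sup>2)"
  have "emeasure (std_normal \<Otimes>\<^sub>M std_normal) (Gset r p q) = 
    (\<integral>\<^sup>+t. \<integral>\<^sup>+s. ennreal (phi s * phi ((t - r * s) / ?c) / ?c) *
      indicator {s. Phi s \<le> p} s * indicator {t. Phi t \<le> q} t \<partial>lborel \<partial>lborel)"
    unfolding Gamma_nn_integral[OF assms] by (rule lborel_pair.Fubini') measurable
  also have "\<dots> = emeasure (std_normal \<Otimes>\<^sub>M std_normal) (Gset r q p)"
    unfolding Gamma_nn_integral[OF assms]
  proof (intro nn_integral_cong)
    fix t s :: real
    show "ennreal (phi s * phi ((t - r * s) / ?c) / ?c) * indicator {s. Phi s \<le> p} s * indicator {t. Phi t \<le> q} t =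
      ennreal (phi t * phi ((s - r * t) / ?c) / ?c) * indicator {s. Phi s \<le> q} t * indicator {t. Phi t \<le> p} s"
      unfolding phi_rotate[OF assms, of s t] by (simp only: mult_ac)
  qed
  finally show ?thesis
    by (simp add: Gamma_Gset measure_def)
qed

lemma measure_Phi_Ioc:
  assumes "0 \<le> p" "p \<le> q" "q \<le> 1"
  shows "measure std_normal {s. p < Phi s \<and> Phi s \<le> q} = q - p"
proof -
  have "measure std_normal ({s. Phi s \<le> q} - {s. Phi s \<le> p}) = q - p"
    using assms by (subst SN.finite_measure_Diff) (auto simp: measure_Phi_le)
  also have "{s. Phi s \<le> q} - {s. Phi s \<le> p} = {s. p < Phi s \<and> Phi s \<le> q}"
    by auto
  finally show ?thesis .
qed

lemma Gamma_diff:
  assumes "x \<le> x'"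
  shows "Gamma r x' y - Gamma r x y = measure (std_normal \<Otimes>\<^sub>M std_normal) (Gset r x' y - Gset r x y)"
proof -
  have "Gset r x y \<subseteq> Gset r x' y"
    using assms by (auto simp: Gset_def)
  then show ?thesis
    unfolding Gamma_Gset by (intro SN2.finite_measure_Diff[symmetric]) auto
qed

lemma Gamma_mono1:
  assumes "x \<le> x'"
  shows "Gamma r x y \<le> Gamma r x' y"
  using Gamma_diff[OF assms, of r y] measure_nonneg[of "std_normal \<Otimes>\<^sub>M std_normal" "Gset r x' y - Gset r x y"]
  by linarith

text \<open>Raising the first threshold only adds points of the strip
  \<open>x < Phi s \<le> x'\<close>, which has mass \<open>x' - x\<close>.\<close>

lemma Gamma_lipschitz1_le:
  assumes "0 \<le> x" "x \<le> x'" "x' \<le> 1"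
  shows "Gamma r x' y - Gamma r x y \<le> x' - x"
proof -
  have "Gamma r x' y - Gamma r x y \<le> measure (std_normal \<Otimes>\<^sub>M std_normal) ({s. x < Phi s \<and> Phi s \<le> x'} \<times> UNIV)"
    unfolding Gamma_diff[OF assms(2)] by (rule SN2.finite_measure_mono) (auto simp: Gset_def)
  also have "\<dots> = x' - x"
    using assms SN.prob_space by (subst measure_std_normal_Times) (auto simp: measure_Phi_Ioc)
  finally show ?thesis .
qed

lemma Gamma_lipschitz1:
  assumes "x \<in> {0..1}" "x' \<in> {0..1}"
  shows "\<bar>Gamma r x' y - Gamma r x y\<bar> \<le> \<bar>x' - x\<bar>"
  using Gamma_lipschitz1_le[of x x' r y] Gamma_lipschitz1_le[of x' x r y] Gamma_mono1[of x x' r y]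
    Gamma_mono1[of x' x r y] assms by (cases "x \<le> x'") auto

lemma Gamma_lipschitz:
  assumes "r\<^sup>2 < 1" "x \<in> {0..1}" "x' \<in> {0..1}" "y \<in> {0..1}" "y' \<in> {0..1}"
  shows "\<bar>Gamma r x' y' - Gamma r x y\<bar> \<le> \<bar>x' - x\<bar> + \<bar>y' - y\<bar>"
  using Gamma_lipschitz1[OF assms(2,3), of r y'] Gamma_lipschitz1[OF assms(4,5), of r x]
    Gamma_commute[OF assms(1), of x y] Gamma_commute[OF assms(1), of x y'] by linarith

text \<open>The conditional probability that the second variable is at most \<open>Phinv y\<close>,
  given that the first equals \<open>Phinv x\<close>. It is the partial derivative of
  \<open>Gamma r\<close> in the first argument; by symmetry \<open>Gderiv r y x\<close> is the other
  one.\<close>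

definition Gderiv :: "real \<Rightarrow> real \<Rightarrow> real \<Rightarrow> real" where
  "Gderiv r x y = Phi ((Phinv y - r * Phinv x) / sqrt (1 - r\<^sup>2))"

lemma Gderiv_range: "0 < Gderiv r x y" "Gderiv r x y < 1"
  by (simp_all add: Gderiv_def Phi_range)

text \<open>For \<open>r \<le> 0\<close> the conditional probability of the second event is
  nondecreasing in the value of the first variable. On the strip between the two thresholds it is
  therefore at least or at most \<open>Gderiv r x y\<close>, depending on the side of
  \<open>x\<close> on which \<open>x'\<close> lies. Comparing the strip with a product set of
  exactly that conditional probability gives a supporting line, that is, convexity in the first
  argument.\<close>

lemma Gamma_subgradient:
  assumes r: "r \<le> 0" "r\<^sup>2 < 1" and x: "x \<in> {0<..<1}" and x': "x' \<in> {0..1}" and y: "y \<in> {0<..<1}"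
  shows "Gamma r x y + (x' - x) * Gderiv r x y \<le> Gamma r x' y"
proof -
  define c where "c = sqrt (1 - r\<^sup>2)"
  have c: "c > 0" using r by (simp add: c_def)
  have q: "Phi t \<le> Gderiv r x y \<longleftrightarrow> r * Phinv x + c * t \<le> Phinv y" for t
    using c by (simp add: Gderiv_def c_def[symmetric] field_simps)
  have q': "Phi (r * s + c * t) \<le> y \<longleftrightarrow> r * s + c * t \<le> Phinv y" for s t
    using y by (metis Phi_le_iff Phi_Phinv greaterThanLessThan_iff)
  have s: "Phi s \<le> x \<longleftrightarrow> s \<le> Phinv x" for s
    using x by (metis Phi_le_iff Phi_Phinv greaterThanLessThan_iff)
  have mq: "measure std_normal {t. Phi t \<le> Gderiv r x y} = Gderiv r x y"
    using Gderiv_range[of r x y] by (intro measure_Phi_le) auto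
  show ?thesis
  proof (cases "x \<le> x'")
    case True
    have "(x' - x) * Gderiv r x y = measure (std_normal \<Otimes>\<^sub>M std_normal) 
      ({s. x < Phi s \<and> Phi s \<le> x'} \<times> {t. Phi t \<le> Gderiv r x y})"
      using True x x' by (subst measure_std_normal_Times) (auto simp: measure_Phi_Ioc mq)
    also have "\<dots> \<le> measure (std_normal \<Otimes>\<^sub>M std_normal) (Gset r x' y - Gset r x y)"
    proof (rule SN2.finite_measure_mono, safe)
      fix a b assume a: "x < Phi a" "Phi a \<le> x'" and b: "Phi b \<le> Gderiv r x y"
      have "r * a \<le> r * Phinv x"
        using a s[of a] r by (intro mult_left_mono_neg) auto
      then show "(a, b) \<in> Gset r x' y"
        using a b unfolding Gset_def q c_def[symmetric] by (auto simp: q')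
      assume "(a, b) \<in> Gset r x y"
      then show False using a by (auto simp: Gset_def)
    qed auto
    finally show ?thesis
      using Gamma_diff[OF True, of r y] by simp
  next
    case False
    then have F: "x' \<le> x" by simp
    have "measure (std_normal \<Otimes>\<^sub>M std_normal) (Gset r x y - Gset r x' y) \<le> 
      measure (std_normal \<Otimes>\<^sub>M std_normal) ({s. x' < Phi s \<and> Phi s \<le> x} \<times> {t. Phi t \<le> Gderiv r x y})"
    proof (rule SN2.finite_measure_mono, safe)
      fix a b assume a: "(a, b) \<in> Gset r x y" "(a, b) \<notin> Gset r x' y"
      then have a': "Phi a \<le> x" "r * a + c * b \<le> Phinv y"
        by (auto simp: Gset_def c_def[symmetric] q')
      have "r * Phinv x \<le> r * a"
        using a' s[of a] r by (intro mult_left_mono_neg) auto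
      then show "Phi b \<le> Gderiv r x y" unfolding q using a' by simp
      show "x' < Phi a" "Phi a \<le> x" using a by (auto simp: Gset_def)
    qed auto
    also have "\<dots> = (x - x') * Gderiv r x y"
      using F x x' by (subst measure_std_normal_Times) (auto simp: measure_Phi_Ioc mq)
    finally show ?thesis
      using Gamma_diff[OF F, of r y] by (simp add: algebra_simps)
  qed
qed

lemma Gamma_zero_left: "Gamma r 0 y = 0"
proof -
  have "Gset r 0 y = {}" using Phi_range(1) by (auto simp: Gset_def not_le)
  then show ?thesis by (simp add: Gamma_Gset)
qed

lemma Gamma_one_left:
  assumes "r\<^sup>2 < 1" "y \<in> {0..1}"
  shows "Gamma r 1 y = y"
proof -
  have "Gset r y 1 = {s. Phi s \<le> y} \<times> UNIV"
    using Phi_range(2) less_imp_le by (fastforce simp: Gset_def)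
  then have "Gamma r y 1 = y"
    using assms SN.prob_space by (simp add: Gamma_Gset measure_std_normal_Times measure_Phi_le)
  then show ?thesis
    using Gamma_commute[OF assms(1)] by metis
qed

lemma Gamma_le_mult:
  assumes r: "r \<le> 0" "r\<^sup>2 < 1" and x: "x \<in> {0<..<1}" and y: "y \<in> {0<..<1}"
  shows "Gamma r x y \<le> x * y"
proof -
  \<comment> \<open>The supporting line at \<open>x\<close> is read at the end points 0 and 1, where
    \<open>Gamma\<close> is known; weighting the two bounds by \<open>1 - x\<close> and
    \<open>x\<close> cancels the slope.\<close>
  have "Gamma r x y \<le> x * Gderiv r x y" "Gamma r x y \<le> y - (1 - x) * Gderiv r x y"
    using Gamma_subgradient[OF r x, of 0 y] Gamma_subgradient[OF r x, of 1 y] x y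
      Gamma_zero_left[of r y] Gamma_one_left[OF r(2), of y] by auto
  then have "(1 - x) * Gamma r x y + x * Gamma r x y \<le> (1 - x) * (x * Gderiv r x y) + x * (y - (1 - x) * Gderiv r x y)"
    using x by (intro add_mono mult_left_mono) auto
  then show ?thesis by (simp add: algebra_simps)
qed

lemma DERIV_Gderiv_line:
  assumes r: "r\<^sup>2 < 1" and "x + u * a \<in> {0<..<1}" "y + u * b \<in> {0<..<1}"
  shows "DERIV (\<lambda>v. Gderiv r (x + v * a) (y + v * b)) u :>
    phi ((Phinv (y + u * b) - r * Phinv (x + u * a)) / sqrt (1 - r\<^sup>2)) *
      ((b / phi (Phinv (y + u * b)) - r * (a / phi (Phinv (x + u * a)))) / sqrt (1 - r\<^sup>2))"
proof -
  have "DERIV (\<lambda>v. Phinv (x + v * a)) u :> 1 / phi (Phinv (x + u * a)) * a"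
    by (rule DERIV_chain2[where f=Phinv]) (use assms in \<open>auto intro!: DERIV_Phinv derivative_eq_intros\<close>)
  moreover have "DERIV (\<lambda>v. Phinv (y + v * b)) u :> 1 / phi (Phinv (y + u * b)) * b"
    by (rule DERIV_chain2[where f=Phinv]) (use assms in \<open>auto intro!: DERIV_Phinv derivative_eq_intros\<close>)
  ultimately have "DERIV (\<lambda>v. (Phinv (y + v * b) - r * Phinv (x + v * a)) / sqrt (1 - r\<^sup>2)) u :>
    (1 / phi (Phinv (y + u * b)) * b - r * (1 / phi (Phinv (x + u * a)) * a)) / sqrt (1 - r\<^sup>2)"
    by (intro DERIV_cdivide DERIV_diff DERIV_cmult)
  from DERIV_chain2[OF Phi_DERIV this] show ?thesis
    by (simp add: Gderiv_def)
qed

text \<open>No integral is differentiated: the supporting lines at both ends of an increment trap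
  the difference quotient between two values of \<open>Gderiv\<close>, and continuity of
  \<open>Gderiv\<close> closes the gap.\<close>

lemma DERIV_Gamma_line:
  assumes r: "r \<le> 0" "r\<^sup>2 < 1" and xu: "x + u * a \<in> {0<..<1}" and yu: "y + u * b \<in> {0<..<1}"
  shows "DERIV (\<lambda>v. Gamma r (x + v * a) (y + v * b)) u :>
    a * Gderiv r (x + u * a) (y + u * b) + b * Gderiv r (y + u * b) (x + u * a)"
proof -
  define X where "X v = x + v * a" for v
  define Y where "Y v = y + v * b" for v
  define h where "h v = Gamma r (X v) (Y v)" for v
  define D where "D = a * Gderiv r (X u) (Y u) + b * Gderiv r (Y u) (X u)"
  \<comment> \<open>The increment is split at \<open>(X u, Y v)\<close>: the ordinate moves at
    abscissa \<open>X u\<close>, then the abscissa moves at height \<open>Y v\<close>. The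
    differences in \<open>e\<close> are what the supporting lines of these two moves leave
    open.\<close>
  define e where "e v = \<bar>a\<bar> * (\<bar>Gderiv r (X u) (Y v) - Gderiv r (X u) (Y u)\<bar> + \<bar>Gderiv r (X v) (Y v) - Gderiv r (X u) (Y u)\<bar>)
     + \<bar>b\<bar> * \<bar>Gderiv r (Y v) (X u) - Gderiv r (Y u) (X u)\<bar>" for v
  have c1: "isCont (\<lambda>v. Gderiv r (X v) (Y v)) u" 
    using DERIV_Gderiv_line[OF r(2) xu yu, THEN DERIV_isCont] by (simp add: X_def Y_def)
  have c2: "isCont (\<lambda>v. Gderiv r (X u) (Y v)) u" 
    using DERIV_Gderiv_line[where a = 0 and x="X u", OF r(2), of u y b, THEN DERIV_isCont] xu yu by (simp add: X_def Y_def)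
  have c3: "isCont (\<lambda>v. Gderiv r (Y v) (X u)) u" 
    using DERIV_Gderiv_line[where b = 0 and y="X u", OF r(2), of y u b, THEN DERIV_isCont] xu yu by (simp add: X_def Y_def)
  have "isCont e u"
    unfolding e_def by (intro continuous_intros c1 c2 c3)
  then have e0: "(e \<longlongrightarrow> 0) (at u)"
    by (simp add: isCont_def e_def)
  have lim: "(X \<longlongrightarrow> X u) (at u)" "(Y \<longlongrightarrow> Y u) (at u)"
    unfolding X_def Y_def by (intro tendsto_intros)+
  have "eventually (\<lambda>v. X v \<in> {0<..<1}) (at u)"
    by (rule topological_tendstoD[OF lim(1)]) (use xu in \<open>auto simp: X_def\<close>)
  moreover have "eventually (\<lambda>v. Y v \<in> {0<..<1}) (at u)"
    by (rule topological_tendstoD[OF lim(2)]) (use yu in \<open>auto simp: Y_def\<close>)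
  ultimately have "eventually (\<lambda>v. norm ((h v - h u) / (v - u) - D) \<le> e v) (at u)"
    using eventually_neq_at_within[of u u UNIV]
  proof eventually_elim
    case (elim v)
    \<comment> \<open>\<open>J\<close> is an increment trapped between two slopes times the
      displacement \<open>d\<close>, which may have either sign.\<close>
    have sq: "\<bar>J - d * m\<bar> \<le> \<bar>d\<bar> * (\<bar>m1 - m\<bar> + \<bar>m2 - m\<bar>)" if "d * m1 \<le> J" "J \<le> d * m2" for J d m m1 m2 :: real
    proof -
      have "d * (m1 - m) \<le> J - d * m" "J - d * m \<le> d * (m2 - m)" using that by (simp_all add: algebra_simps)
      moreover have "\<bar>d * (m1 - m)\<bar> = \<bar>d\<bar> * \<bar>m1 - m\<bar>" "\<bar>d * (m2 - m)\<bar> = \<bar>d\<bar> * \<bar>m2 - m\<bar>" by (simp_all add: abs_mult)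
      ultimately show ?thesis unfolding distrib_left by linarith
    qed
    have xu': "X u \<in> {0<..<1}" and yu': "Y u \<in> {0<..<1}" using xu yu by (auto simp: X_def Y_def)
    have "\<bar>(Gamma r (X v) (Y v) - Gamma r (X u) (Y v)) - (X v - X u) * Gderiv r (X u) (Y u)\<bar> \<le>
      \<bar>X v - X u\<bar> * (\<bar>Gderiv r (X u) (Y v) - Gderiv r (X u) (Y u)\<bar> + \<bar>Gderiv r (X v) (Y v) - Gderiv r (X u) (Y u)\<bar>)"
      using Gamma_subgradient[OF r xu', of "X v" "Y v"] Gamma_subgradient[OF r elim(1), of "X u" "Y v"] elim(1,2) xu' yu'
      by (intro sq) (auto simp: algebra_simps)
    moreover have "\<bar>(Gamma r (X u) (Y v) - Gamma r (X u) (Y u)) - (Y v - Y u) * Gderiv r (Y u) (X u)\<bar> \<le>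
      \<bar>Y v - Y u\<bar> * (\<bar>Gderiv r (Y u) (X u) - Gderiv r (Y u) (X u)\<bar> + \<bar>Gderiv r (Y v) (X u) - Gderiv r (Y u) (X u)\<bar>)"
      unfolding Gamma_commute[OF r(2), of "X u"]
      using Gamma_subgradient[OF r yu', of "Y v" "X u"] Gamma_subgradient[OF r elim(2), of "Y u" "X u"] elim(1,2) xu' yu'
      by (intro sq) (auto simp: algebra_simps)
    moreover have XY: "X v - X u = (v - u) * a" "Y v - Y u = (v - u) * b"
      by (simp_all add: X_def Y_def algebra_simps)
    moreover have "h v - h u - (v - u) * D = 
      ((Gamma r (X v) (Y v) - Gamma r (X u) (Y v)) - (X v - X u) * Gderiv r (X u) (Y u)) +
      ((Gamma r (X u) (Y v) - Gamma r (X u) (Y u)) - (Y v - Y u) * Gderiv r (Y u) (X u))"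
      unfolding XY h_def D_def by (simp add: algebra_simps)
    moreover have "\<bar>v - u\<bar> * e v = \<bar>X v - X u\<bar> * (\<bar>Gderiv r (X u) (Y v) - Gderiv r (X u) (Y u)\<bar> + \<bar>Gderiv r (X v) (Y v) - Gderiv r (X u) (Y u)\<bar>)
      + \<bar>Y v - Y u\<bar> * (\<bar>Gderiv r (Y u) (X u) - Gderiv r (Y u) (X u)\<bar> + \<bar>Gderiv r (Y v) (X u) - Gderiv r (Y u) (X u)\<bar>)"
      unfolding XY abs_mult e_def by (simp add: algebra_simps)
    moreover have "\<bar>T\<bar> \<le> E" if "\<bar>T1\<bar> \<le> B1" "\<bar>T2\<bar> \<le> B2" "T = T1 + T2" "E = B1 + B2" for T T1 T2 B1 B2 E :: real
      using that by linarith
    ultimately have "\<bar>h v - h u - (v - u) * D\<bar> \<le> \<bar>v - u\<bar> * e v"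
      by metis
    moreover have "(h v - h u) / (v - u) - D = (h v - h u - (v - u) * D) / (v - u)"
      using elim by (simp add: field_simps)
    ultimately show ?case
      using elim by (simp add: abs_divide divide_le_eq mult.commute)
  qed
  then have "((\<lambda>v. (h v - h u) / (v - u) - D) \<longlongrightarrow> 0) (at u)"
    by (rule Lim_null_comparison) (rule e0)
  then have "((\<lambda>v. (h v - h u) / (v - u)) \<longlongrightarrow> D) (at u)"
    by (rule LIM_zero_cancel)
  then show ?thesis
    unfolding has_field_derivative_iff by (simp add: h_def D_def X_def Y_def)
qed

section \<open>Second-order behaviour of Gamma\<close>

text \<open>The triple lists the xx, xy and yy second derivatives of \<open>Gamma r\<close>;
  \<open>k\<close> is the bivariate normal density at the two quantiles, and \<open>1 / a\<close>,
  \<open>1 / b\<close> are the derivatives of the quantile function.\<close>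

definition Ghess :: "real \<Rightarrow> real \<times> real \<Rightarrow> real \<times> real \<times> real" where
  "Ghess r = (\<lambda>(x, y). let a = phi (Phinv x); b = phi (Phinv y);
     k = a * phi ((Phinv y - r * Phinv x) / sqrt (1 - r\<^sup>2)) / sqrt (1 - r\<^sup>2)
   in (- r * k / a\<^sup>2, k / (a * b), - r * k / b\<^sup>2))"

lemma continuous_on_Ghess:
  assumes "r\<^sup>2 < 1"
  shows "continuous_on ({0<..<1} \<times> {0<..<1}) (Ghess r)"
proof -
  have "phi x \<noteq> 0" for x using normal_density_pos[of 1 0 x] by simp
  then show ?thesis
  unfolding Ghess_def Let_def case_prod_beta' using assms
    by (intro continuous_intros continuous_on_Phinv) auto
qed

definition qform :: "real \<times> real \<times> real \<Rightarrow> real \<Rightarrow> real \<Rightarrow> real" where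
  "qform = (\<lambda>(l, m, n) a b. l * a\<^sup>2 + 2 * m * (a * b) + n * b\<^sup>2)"

lemma qform_dist:
  "\<bar>qform h a b - qform h' a b\<bar> \<le> 2 * dist h h' * (a\<^sup>2 + b\<^sup>2)"
proof -
  obtain l m n where h: "h = (l, m, n)" by (cases h)
  obtain l' m' n' where h': "h' = (l', m', n')" by (cases h')
  have "dist l l' \<le> dist h h'" "dist (m, n) (m', n') \<le> dist h h'"
    using dist_fst_le[of h h'] dist_snd_le[of h h'] by (simp_all add: h h')
  moreover have "dist m m' \<le> dist (m, n) (m', n')" "dist n n' \<le> dist (m, n) (m', n')"
    using dist_fst_le[of "(m, n)" "(m', n')"] dist_snd_le[of "(m, n)" "(m', n')"] by simp_all
  ultimately have d: "\<bar>l - l'\<bar> \<le> dist h h'" "\<bar>m - m'\<bar> \<le> dist h h'" "\<bar>n - n'\<bar> \<le> dist h h'"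
    by (simp_all add: dist_real_def)
  have ab: "2 * \<bar>a * b\<bar> \<le> a\<^sup>2 + b\<^sup>2"
    using sum_squares_bound[of "\<bar>a\<bar>" "\<bar>b\<bar>"] by (simp add: abs_mult)
  have "qform h a b - qform h' a b = (l - l') * a\<^sup>2 + (m - m') * (2 * (a * b)) + (n - n') * b\<^sup>2"
    by (simp add: qform_def h h' algebra_simps)
  also have "\<bar>\<dots>\<bar> \<le> \<bar>(l - l') * a\<^sup>2\<bar> + \<bar>(m - m') * (2 * (a * b))\<bar> + \<bar>(n - n') * b\<^sup>2\<bar>"
    by linarith
  also have "\<dots> = \<bar>l - l'\<bar> * a\<^sup>2 + \<bar>m - m'\<bar> * (2 * \<bar>a * b\<bar>) + \<bar>n - n'\<bar> * b\<^sup>2"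
    by (simp add: abs_mult)
  also have "\<dots> \<le> dist h h' * a\<^sup>2 + dist h h' * (a\<^sup>2 + b\<^sup>2) + dist h h' * b\<^sup>2"
    using d ab by (intro add_mono mult_mono) auto
  finally show ?thesis by (simp add: algebra_simps)
qed

text \<open>Once the mixed entry carries the factor \<open>r\<close>, the form is
  \<open>- r * k\<close> times the square of \<open>a / A - b / B\<close>.\<close>

lemma Ghess_psd:
  assumes "r \<le> 0" "r\<^sup>2 < 1"
  shows "0 \<le> (case Ghess r p of (l, m, n) \<Rightarrow> l * a\<^sup>2 + 2 * (r * m) * (a * b) + n * b\<^sup>2)"
proof -
  obtain x y where p: "p = (x, y)" by (cases p)
  define A where "A = phi (Phinv x)"
  define B where "B = phi (Phinv y)"
  define k where "k = A * phi ((Phinv y - r * Phinv x) / sqrt (1 - r\<^sup>2)) / sqrt (1 - r\<^sup>2)"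
  have pos: "A > 0" "B > 0" by (simp_all add: A_def B_def normal_density_pos)
  have k: "k \<ge> 0" unfolding k_def using pos assms by (intro divide_nonneg_pos mult_nonneg_nonneg) auto
  have "(case Ghess r p of (l, m, n) \<Rightarrow> l * a\<^sup>2 + 2 * (r * m) * (a * b) + n * b\<^sup>2) = - r * (k * (a / A - b / B)\<^sup>2)"
    unfolding p Ghess_def Let_def prod.case A_def[symmetric] B_def[symmetric] k_def[symmetric]
    using pos by (simp add: power2_diff power_divide algebra_simps)
  also have "\<dots> \<ge> 0" using k assms by (simp add: mult_nonpos_nonneg)
  finally show ?thesis .
qed

lemma Gamma_Taylor:
  assumes r: "r \<le> 0" "r\<^sup>2 < 1" and x: "x \<in> {0<..<1}" "x + a \<in> {0<..<1}" and y: "y \<in> {0<..<1}" "y + b \<in> {0<..<1}"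
  shows "\<exists>t. 0 < t \<and> t < 1 \<and> Gamma r (x + a) (y + b) =
    Gamma r x y + (a * Gderiv r x y + b * Gderiv r y x) + qform (Ghess r (x + t * a, y + t * b)) a b / 2"
proof -
  \<comment> \<open>The function and its first two derivatives along the segment, in the indexed
    form that \<open>Maclaurin\<close> expects.\<close>
  define d where "d m = (\<lambda>t. if m = 0 then Gamma r (x + t * a) (y + t * b) else
    if m = 1 then a * Gderiv r (x + t * a) (y + t * b) + b * Gderiv r (y + t * b) (x + t * a)
    else qform (Ghess r (x + t * a, y + t * b)) a b)" for m :: nat
  have "\<forall>m t. m < 2 \<and> 0 \<le> t \<and> t \<le> 1 \<longrightarrow> DERIV (d m) t :> d (Suc m) t"
  proof safe
    fix m :: nat and t :: real assume m: "m < 2" and t: "0 \<le> t" "t \<le> 1"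
    have seg: "z + t * c \<in> {0<..<1}" if "z \<in> {0<..<1}" "z + c \<in> {0<..<1}" for z c :: real
    proof -
      have "(1 - t) *\<^sub>R z + t *\<^sub>R (z + c) \<in> {0<..<1}"
        using that t convex_real_interval(8)[of 0 1] unfolding convex_alt by blast
      then show ?thesis by (simp add: algebra_simps)
    qed
    have X: "x + t * a \<in> {0<..<1}" and Y: "y + t * b \<in> {0<..<1}"
      using seg x y by auto
    consider "m = 0" | "m = 1" using m by linarith
    then show "DERIV (d m) t :> d (Suc m) t"
    proof cases
      case 1
      then show ?thesis using DERIV_Gamma_line[OF r X Y] by (simp add: d_def)
    next
      case 2
      define A where "A = phi (Phinv (x + t * a))"
      define B where "B = phi (Phinv (y + t * b))"
      define c where "c = sqrt (1 - r\<^sup>2)"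
      define P where "P = phi ((Phinv (y + t * b) - r * Phinv (x + t * a)) / c)"
      define Q where "Q = phi ((Phinv (x + t * a) - r * Phinv (y + t * b)) / c)"
      have pos: "A > 0" "B > 0" "c > 0" using r by (simp_all add: A_def B_def c_def normal_density_pos)
      \<comment> \<open>Lets both conditional densities \<open>P\<close> and \<open>Q\<close> be
        expressed through the single joint density in \<open>Ghess\<close>, so the two mixed
        contributions agree.\<close>
      have rot: "A * P = B * Q"
        unfolding A_def B_def P_def Q_def c_def by (rule phi_rotate[OF r(2)])
      have "DERIV (\<lambda>v. a * Gderiv r (x + v * a) (y + v * b) + b * Gderiv r (y + v * b) (x + v * a)) t :>
          a * (P * ((b / B - r * (a / A)) / c)) + b * (Q * ((a / A - r * (b / B)) / c))"
        unfolding A_def B_def P_def Q_def c_def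
        by (intro DERIV_add DERIV_cmult DERIV_Gderiv_line r X Y)
      also have "P = A * P / A" using pos by simp
      also have "Q = A * P / B" using pos rot by simp
      also have "a * (A * P / A * ((b / B - r * (a / A)) / c)) + b * (A * P / B * ((a / A - r * (b / B)) / c)) =
        qform (Ghess r (x + t * a, y + t * b)) a b"
        unfolding Ghess_def Let_def prod.case qform_def A_def[symmetric] B_def[symmetric] c_def[symmetric] P_def[symmetric]
        using pos by (simp add: field_simps power2_eq_square)
      finally show ?thesis using 2 by (simp add: d_def)
    qed
  qed
  from Maclaurin[of 1 2 d "d 0", OF _ _ _ this] obtain t where t: "0 < t" "t < 1"
    "d 0 1 = (\<Sum>m<2. d m 0 / fact m * 1 ^ m) + d 2 t / fact 2 * 1 ^ 2"
    by auto
  then show ?thesis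
    by (intro exI[of _ t]) (simp add: d_def numeral_2_eq_2)
qed

text \<open>Averaging the second-order terms over \<open>r\<close>-correlated signs turns the Hessian into a positive semidefinite form,
  so only the modulus of continuity \<open>w\<close> of the Hessian is lost.\<close>

lemma Gamma_four_point:
  assumes r: "-1 < r" "r \<le> 0" and eta: "0 < \<eta>" and w: "0 < w"
  shows "\<exists>\<kappa>>0. \<forall>x a y b. \<bar>a\<bar> \<le> \<kappa> \<longrightarrow> \<bar>b\<bar> \<le> \<kappa> \<longrightarrow> 
    x - a \<in> {\<eta>..1-\<eta>} \<longrightarrow> x + a \<in> {\<eta>..1-\<eta>} \<longrightarrow> y - b \<in> {\<eta>..1-\<eta>} \<longrightarrow> y + b \<in> {\<eta>..1-\<eta>} \<longrightarrow>
    Gamma r x y - w * (a\<^sup>2 + b\<^sup>2) \<le>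
      (1 + r) / 4 * (Gamma r (x + a) (y + b) + Gamma r (x - a) (y - b)) + 
      (1 - r) / 4 * (Gamma r (x + a) (y - b) + Gamma r (x - a) (y + b))"
proof -
  have r': "r\<^sup>2 < 1" using r by (simp add: power2_less_1_iff)
  define S where "S = {\<eta>..1-\<eta>} \<times> {\<eta>..1-\<eta>}"
  have "continuous_on S (Ghess r)"
    by (rule continuous_on_subset[OF continuous_on_Ghess[OF r']]) (use eta in \<open>auto simp: S_def\<close>)
  then have "uniformly_continuous_on S (Ghess r)"
    by (rule compact_uniformly_continuous) (auto simp: S_def intro: compact_Times)
  then obtain d where d: "d > 0" "\<And>p q. p \<in> S \<Longrightarrow> q \<in> S \<Longrightarrow> dist q p < d \<Longrightarrow> dist (Ghess r q) (Ghess r p) < w"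
    unfolding uniformly_continuous_on_def using w by metis
  \<comment> \<open>The error is \<open>w * (a\<^sup>2 + b\<^sup>2)\<close> because the factor 2 of
    \<open>qform_dist\<close> cancels the 1/2 of the Taylor remainder. Increments of at most
    \<open>d / 3\<close> keep the intermediate point within distance \<open>d\<close>.\<close>
  have main: "Gamma r x y + (a * Gderiv r x y + b * Gderiv r y x) + qform (Ghess r (x, y)) a b / 2 - w * (a\<^sup>2 + b\<^sup>2) 
      \<le> Gamma r (x + a) (y + b)"
    if ab: "\<bar>a\<bar> \<le> d / 3" "\<bar>b\<bar> \<le> d / 3" and S: "(x, y) \<in> S" "(x + a, y + b) \<in> S" for x y a b
  proof -
    have cv: "convex S" unfolding S_def by (intro convex_Times) auto
    have pt: "x \<in> {0<..<1}" "x + a \<in> {0<..<1}" "y \<in> {0<..<1}" "y + b \<in> {0<..<1}"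
      using S eta by (auto simp: S_def)
    obtain t where t: "0 < t" "t < 1" "Gamma r (x + a) (y + b) =
      Gamma r x y + (a * Gderiv r x y + b * Gderiv r y x) + qform (Ghess r (x + t * a, y + t * b)) a b / 2"
      using Gamma_Taylor[OF r(2) r' pt] by blast
    have "(1 - t) *\<^sub>R (x, y) + t *\<^sub>R (x + a, y + b) \<in> S"
      using cv S t unfolding convex_alt by (meson less_imp_le)
    then have S': "(x + t * a, y + t * b) \<in> S" by (simp add: algebra_simps)
    have "dist (x + t * a, y + t * b) (x, y) \<le> \<bar>t * a\<bar> + \<bar>t * b\<bar>"
      using sqrt_sum_squares_le_sum_abs[of "t * a" "t * b"] by (simp add: dist_Pair_Pair dist_real_def)
    also have "\<dots> \<le> \<bar>a\<bar> + \<bar>b\<bar>"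
      using t by (intro add_mono) (auto simp: abs_mult intro!: mult_left_le_one_le)
    also have "\<dots> < d" using ab d(1) by linarith
    finally have "dist (Ghess r (x + t * a, y + t * b)) (Ghess r (x, y)) < w"
      using d(2) S(1) S' by blast
    then have "2 * dist (Ghess r (x + t * a, y + t * b)) (Ghess r (x, y)) * (a\<^sup>2 + b\<^sup>2) \<le> 2 * w * (a\<^sup>2 + b\<^sup>2)"
      by (intro mult_right_mono) auto
    then show ?thesis
      using t(3) qform_dist[of "Ghess r (x + t * a, y + t * b)" a b "Ghess r (x, y)"] by linarith
  qed
  show ?thesis
  proof (intro exI[of _ "d / 3"] conjI allI impI)
    show "0 < d / 3" using d(1) by simp
    fix x a y b :: real
    assume ab: "\<bar>a\<bar> \<le> d / 3" "\<bar>b\<bar> \<le> d / 3" and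
      pt: "x - a \<in> {\<eta>..1-\<eta>}" "x + a \<in> {\<eta>..1-\<eta>}" "y - b \<in> {\<eta>..1-\<eta>}" "y + b \<in> {\<eta>..1-\<eta>}"
    have S: "(x, y) \<in> S" "(x + a, y + b) \<in> S" "(x + (-a), y + (-b)) \<in> S" "(x + a, y + (-b)) \<in> S" "(x + (-a), y + b) \<in> S"
      using pt by (auto simp: S_def)
    define u where "u = a * Gderiv r x y"
    define v where "v = b * Gderiv r y x"
    define e where "e = w * (a\<^sup>2 + b\<^sup>2)"
    obtain l m n where h: "Ghess r (x, y) = (l, m, n)" by (cases "Ghess r (x, y)")
    define q where "q = l * a\<^sup>2 + n * b\<^sup>2"
    define s where "s = 2 * m * (a * b)"
    define J where "J = Gamma r x y"
    have qf: "qform (Ghess r (x, y)) a b = q + s" "qform (Ghess r (x, y)) (-a) (-b) = q + s" 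
      "qform (Ghess r (x, y)) a (-b) = q - s" "qform (Ghess r (x, y)) (-a) b = q - s" 
      by (simp_all add: qform_def h q_def s_def)
    have 1: "J + (u + v) + (q + s) / 2 - e \<le> Gamma r (x + a) (y + b)"
      using main[OF _ _ S(1,2)] ab by (simp add: qf u_def v_def e_def J_def)
    have 2: "J - (u + v) + (q + s) / 2 - e \<le> Gamma r (x - a) (y - b)"
      using main[OF _ _ S(1,3)] ab by (simp add: qf u_def v_def e_def J_def)
    have 3: "J + (u - v) + (q - s) / 2 - e \<le> Gamma r (x + a) (y - b)"
      using main[OF _ _ S(1,4)] ab by (simp add: qf u_def v_def e_def J_def)
    have 4: "J - (u - v) + (q - s) / 2 - e \<le> Gamma r (x - a) (y + b)"
      using main[OF _ _ S(1,5)] ab by (simp add: qf u_def v_def e_def J_def)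
    have 5: "2 * J + q + s - 2 * e \<le> Gamma r (x + a) (y + b) + Gamma r (x - a) (y - b)"
      using add_mono[OF 1 2] by simp
    have 6: "2 * J + q - s - 2 * e \<le> Gamma r (x + a) (y - b) + Gamma r (x - a) (y + b)"
      using add_mono[OF 3 4] by simp
    \<comment> \<open>The four weights sum to 1, annihilate \<open>u\<close> and \<open>v\<close>,
      and give the product of the two signs mean \<open>r\<close>. The averaged quadratic part is
      therefore \<open>q + r * s\<close>, precisely the form of \<open>Ghess_psd\<close>.\<close>
    have "0 \<le> q + r * s"
      using Ghess_psd[OF r(2) r', where p="(x, y)" and a=a and b=b] by (simp add: h q_def s_def algebra_simps)
    then have "J - e \<le> J - e + (q + r * s) / 2"
      by simp
    also have "\<dots> = (1 + r) / 4 * (2 * J + q + s - 2 * e) + (1 - r) / 4 * (2 * J + q - s - 2 * e)"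
      by (simp add: field_simps)
    also have "\<dots> \<le> (1 + r) / 4 * (Gamma r (x + a) (y + b) + Gamma r (x - a) (y - b)) + 
      (1 - r) / 4 * (Gamma r (x + a) (y - b) + Gamma r (x - a) (y + b))"
      using r by (intro add_mono mult_left_mono 5 6) auto
    finally show "Gamma r x y - w * (a\<^sup>2 + b\<^sup>2) \<le>
      (1 + r) / 4 * (Gamma r (x + a) (y + b) + Gamma r (x - a) (y - b)) + 
      (1 - r) / 4 * (Gamma r (x + a) (y - b) + Gamma r (x - a) (y + b))"
      by (simp only: J_def e_def)
  qed
qed

section \<open>A tensorizing two-function inequality\<close>

abbreviation expect :: "'a pmf \<Rightarrow> ('a \<Rightarrow> real) \<Rightarrow> real" where
  "expect p h \<equiv> measure_pmf.expectation p h"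

lemma expect_sum:
  assumes "finite (set_pmf p)"
  shows "expect p h = (\<Sum>x\<in>set_pmf p. pmf p x * h x)"
  using assms by (subst integral_measure_pmf_real[of "set_pmf p"]) (auto simp: mult.commute)

lemma expect_bind:
  assumes "finite (set_pmf p)" "\<And>x. x \<in> set_pmf p \<Longrightarrow> finite (set_pmf (f x))"
  shows "expect (bind_pmf p f) h = expect p (\<lambda>x. expect (f x) h)"
  using assms by (subst pmf_expectation_bind[of "set_pmf p"]) (auto simp: expect_sum)

lemma expect_pair:
  assumes "finite (set_pmf p)" "finite (set_pmf q)"
  shows "expect (pair_pmf p q) h = expect p (\<lambda>x. expect q (\<lambda>y. h (x, y)))"
  using assms by (simp add: pair_pmf_def expect_bind)

lemma expect_const: "expect p (\<lambda>_. c) = c"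
  by simp

lemma expect_add:
  assumes "finite (set_pmf p)"
  shows "expect p (\<lambda>x. f x + g x) = expect p f + expect p g"
  using assms by (simp add: integrable_measure_pmf_finite)

lemma expect_diff:
  assumes "finite (set_pmf p)"
  shows "expect p (\<lambda>x. f x - g x) = expect p f - expect p g"
  using assms by (simp add: integrable_measure_pmf_finite)

lemma expect_mono:
  assumes "finite (set_pmf p)" "\<And>x. x \<in> set_pmf p \<Longrightarrow> f x \<le> g x"
  shows "expect p f \<le> expect p g"
  using assms by (intro integral_mono_AE) (auto simp: integrable_measure_pmf_finite AE_measure_pmf_iff)

lemma expect_Icc:
  assumes "finite (set_pmf p)" "\<And>x. x \<in> set_pmf p \<Longrightarrow> f x \<in> {a..b}"
  shows "expect p f \<in> {a..b}"
  using expect_mono[of p "\<lambda>_. a" f] expect_mono[of p f "\<lambda>_. b"] assms by simp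

lemma pmf_eq_expectI:
  assumes "\<And>h. expect p h = expect q h"
  shows "p = q"
proof (rule pmf_eqI)
  fix x
  show "pmf p x = pmf q x"
    using assms[of "indicator {x}"] by (simp add: measure_pmf_single)
qed

text \<open>A Jensen inequality for correlated components, where \<open>f\<close> and
  \<open>g\<close> see one component each. Their range is confined to \<open>{a..b}\<close> because
  the second-order control of \<open>Gamma\<close> holds only on such an interval inside the open
  unit interval.\<close>

definition jensen_pair :: "real \<Rightarrow> real \<Rightarrow> (real \<Rightarrow> real \<Rightarrow> real) \<Rightarrow> ('a \<times> 'b) pmf \<Rightarrow> bool" where
  "jensen_pair a b K p \<longleftrightarrow> (\<forall>f g. (\<forall>x. f x \<in> {a..b}) \<longrightarrow> (\<forall>y. g y \<in> {a..b}) \<longrightarrow>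
     K (expect p (\<lambda>x. f (fst x))) (expect p (\<lambda>x. g (snd x))) \<le> expect p (\<lambda>x. K (f (fst x)) (g (snd x))))"

lemma jensen_pairD:
  assumes "jensen_pair a b K p" "\<And>x. f x \<in> {a..b}" "\<And>y. g y \<in> {a..b}"
  shows "K (expect p (\<lambda>x. f (fst x))) (expect p (\<lambda>x. g (snd x))) \<le> expect p (\<lambda>x. K (f (fst x)) (g (snd x)))"
  using assms unfolding jensen_pair_def by blast

lemma jensen_pair_return: "jensen_pair a b K (return_pmf x)"
  by (simp add: jensen_pair_def)

lemma jensen_pair_map_prod:
  fixes u :: "'a \<Rightarrow> 'c" and v :: "'b \<Rightarrow> 'd"
  assumes "jensen_pair a b K p"
  shows "jensen_pair a b K (map_pmf (map_prod u v) p)"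
  unfolding jensen_pair_def
proof (intro allI impI)
  fix f :: "'c \<Rightarrow> real" and g :: "'d \<Rightarrow> real"
  assume "\<forall>x. f x \<in> {a..b}" "\<forall>y. g y \<in> {a..b}"
  then show "K (expect (map_pmf (map_prod u v) p) (\<lambda>x. f (fst x))) (expect (map_pmf (map_prod u v) p) (\<lambda>x. g (snd x))) \<le>
    expect (map_pmf (map_prod u v) p) (\<lambda>x. K (f (fst x)) (g (snd x)))"
    using jensen_pairD[OF assms, of "\<lambda>x. f (u x)" "\<lambda>x. g (v x)"] by simp
qed

definition transpose_pair :: "('a \<times> 'b) \<times> ('c \<times> 'd) \<Rightarrow> ('a \<times> 'c) \<times> ('b \<times> 'd)" where
  "transpose_pair = (\<lambda>((a, b), (c, d)). ((a, c), (b, d)))"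

text \<open>Averaging over the second factor turns \<open>f\<close> and \<open>g\<close> into
  functions \<open>F\<close> and \<open>G\<close> of the first factor with the same range. The
  inequality for \<open>p\<close> applies to these, and the one for \<open>q\<close> applies inside
  for each outcome of \<open>p\<close>. Nothing is lost, which is why the dimension never enters the
  error.\<close>

lemma jensen_pair_prod:
  assumes p: "jensen_pair a b K p" "finite (set_pmf p)" and q: "jensen_pair a b K q" "finite (set_pmf q)"
  shows "jensen_pair a b K (map_pmf transpose_pair (pair_pmf p q))"
  unfolding jensen_pair_def
proof (intro allI impI)
  fix f :: "'a \<times> 'c \<Rightarrow> real" and g :: "'b \<times> 'd \<Rightarrow> real"
  assume fg: "\<forall>x. f x \<in> {a..b}" "\<forall>y. g y \<in> {a..b}"
  define F where "F x = expect q (\<lambda>y. f (x, fst y))" for x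
  define G where "G x = expect q (\<lambda>y. g (x, snd y))" for x
  have FG: "F x \<in> {a..b}" "G x' \<in> {a..b}" for x x'
    unfolding F_def G_def using fg q by (auto intro!: expect_Icc simp del: atLeastAtMost_iff)
  have E: "expect (map_pmf transpose_pair (pair_pmf p q)) h = expect p (\<lambda>x. expect q (\<lambda>y. h ((fst x, fst y), (snd x, snd y))))" for h
    using p q by (simp add: expect_pair transpose_pair_def case_prod_beta')
  have "K (expect p (\<lambda>x. F (fst x))) (expect p (\<lambda>x. G (snd x))) \<le> expect p (\<lambda>x. K (F (fst x)) (G (snd x)))"
    by (rule jensen_pairD[OF p(1)]) (rule FG)+
  also have "\<dots> \<le> expect p (\<lambda>x. expect q (\<lambda>y. K (f (fst x, fst y)) (g (snd x, snd y))))"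
    unfolding F_def G_def using jensen_pairD[OF q(1), of "\<lambda>y. f (_, y)" "\<lambda>y. g (_, y)"] fg
    by (intro expect_mono p) auto
  finally show "K (expect (map_pmf transpose_pair (pair_pmf p q)) (\<lambda>x. f (fst x))) (expect (map_pmf transpose_pair (pair_pmf p q)) (\<lambda>x. g (snd x)))
    \<le> expect (map_pmf transpose_pair (pair_pmf p q)) (\<lambda>x. K (f (fst x)) (g (snd x)))"
    by (simp only: E F_def G_def fst_conv snd_conv)
qed

definition power_pair :: "nat \<Rightarrow> (int \<times> int) pmf \<Rightarrow> ((nat \<Rightarrow> int) \<times> (nat \<Rightarrow> int)) pmf" where
  "power_pair d p = map_pmf (\<lambda>\<omega>. (fst \<circ> \<omega>, snd \<circ> \<omega>)) (Pi_pmf {..<d} (0, 0) (\<lambda>_. p))"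

lemma finite_set_Pi_pmf:
  assumes "finite A" "\<And>x. x \<in> A \<Longrightarrow> finite (set_pmf (p x))"
  shows "finite (set_pmf (Pi_pmf A dflt p))"
  using assms by (auto simp: set_Pi_pmf intro: finite_PiE_dflt)

lemma finite_power_pair: "finite (set_pmf p) \<Longrightarrow> finite (set_pmf (power_pair d p))"
  by (simp add: power_pair_def finite_set_Pi_pmf)

lemma jensen_pair_power_pair:
  assumes p: "jensen_pair a b K p" "finite (set_pmf p)"
  shows "jensen_pair a b K (power_pair d p)"
  unfolding power_pair_def
proof (induction d)
  case 0
  then show ?case by (simp add: jensen_pair_return)
next
  case (Suc d)
  let ?P = "Pi_pmf {..<d} (0, 0) (\<lambda>_. p)"
  let ?u = "\<lambda>(y, f). f(d := y)"
  \<comment> \<open>The new coordinate is the factor \<open>p\<close>; inserting it acts on the two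
    vectors separately, so \<open>jensen_pair_map_prod\<close> covers it.\<close>
  have *: "map_pmf (\<lambda>\<omega>. (fst \<circ> \<omega>, snd \<circ> \<omega>)) (Pi_pmf {..<Suc d} (0, 0) (\<lambda>_. p)) =
    map_pmf (map_prod ?u ?u) (map_pmf transpose_pair (pair_pmf p (map_pmf (\<lambda>\<omega>. (fst \<circ> \<omega>, snd \<circ> \<omega>)) ?P)))"
    unfolding lessThan_Suc
    by (subst Pi_pmf_insert)
       (auto simp: map_pmf_comp pair_map_pmf2 transpose_pair_def case_prod_beta' fun_eq_iff intro!: map_pmf_cong)
  show ?case
    unfolding * by (intro jensen_pair_map_prod jensen_pair_prod Suc p) (use p in \<open>simp add: finite_set_Pi_pmf\<close>)
qed

text \<open>Convexity enters as the existence of supporting lines, the form in which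
  \<open>Gamma_subgradient\<close> supplies it; the line at the mean is averaged.\<close>

lemma expect_jensen:
  fixes h :: "'a \<Rightarrow> real" and k :: "real \<Rightarrow> real"
  assumes s: "finite (set_pmf s)" "\<And>x. h x \<in> {a..b}"
    and k: "\<And>x. x \<in> {a..b} \<Longrightarrow> \<exists>m. \<forall>x'\<in>{a..b}. k x + (x' - x) * m \<le> k x'"
  shows "k (expect s h) \<le> expect s (\<lambda>x. k (h x))"
proof -
  have "expect s h \<in> {a..b}" using s by (intro expect_Icc) auto
  then obtain m where m: "\<And>x'. x' \<in> {a..b} \<Longrightarrow> k (expect s h) + (x' - expect s h) * m \<le> k x'" using k by blast
  have "k (expect s h) = expect s (\<lambda>x. k (expect s h) + (h x - expect s h) * m)"
    using s(1) by (simp add: expect_add expect_diff)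
  also have "\<dots> \<le> expect s (\<lambda>x. k (h x))"
    using s by (intro expect_mono m)
  finally show ?thesis .
qed

text \<open>Independence allows Jensen in one argument after the other. This matters because
  \<open>Gamma r\<close> is convex in each argument but not jointly: its Hessian determinant has the
  sign of \<open>r\<^sup>2 - 1\<close>.\<close>

lemma jensen_pair_indep:
  assumes p: "finite (set_pmf p)" "finite (set_pmf q)"
    and K1: "\<And>x y. x \<in> {a..b} \<Longrightarrow> y \<in> {a..b} \<Longrightarrow> \<exists>m. \<forall>x'\<in>{a..b}. K x y + (x' - x) * m \<le> K x' y"
    and K2: "\<And>x y. x \<in> {a..b} \<Longrightarrow> y \<in> {a..b} \<Longrightarrow> \<exists>m. \<forall>y'\<in>{a..b}. K x y + (y' - y) * m \<le> K x y'"
  shows "jensen_pair a b K (pair_pmf p q)"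
  unfolding jensen_pair_def
proof (intro allI impI)
  fix f :: "'a \<Rightarrow> real" and g :: "'b \<Rightarrow> real"
  assume fg: "\<forall>x. f x \<in> {a..b}" "\<forall>y. g y \<in> {a..b}"
  have F: "expect p f \<in> {a..b}" using p fg by (intro expect_Icc) auto
  have "K (expect p f) (expect q g) \<le> expect q (\<lambda>y. K (expect p f) (g y))"
    by (rule expect_jensen[where k="K (expect p f)" and a=a and b=b]) (use p fg K2[OF F] in auto)
  also have "\<dots> \<le> expect q (\<lambda>y. expect p (\<lambda>x. K (f x) (g y)))"
    by (intro expect_mono p expect_jensen[where k="\<lambda>x. K x (g _)" and a=a and b=b]) (use p fg K1 in auto)
  also have "\<dots> = expect p (\<lambda>x. expect q (\<lambda>y. K (f x) (g y)))"
    using p by (simp add: expect_sum sum_distrib_left mult_ac sum.swap[of _ "set_pmf p"])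
  finally show "K (expect (pair_pmf p q) (\<lambda>x. f (fst x))) (expect (pair_pmf p q) (\<lambda>x. g (snd x))) \<le>
    expect (pair_pmf p q) (\<lambda>x. K (f (fst x)) (g (snd x)))"
    using p by (simp add: expect_pair)
qed

section \<open>Correlated random walks on the integers\<close>

definition sign_pmf :: "int pmf" where
  "sign_pmf = pmf_of_set {1, -1}"

text \<open>Agreement with probability \<open>(1 + r) / 2\<close> gives the product of the two signs
  mean \<open>r\<close>.\<close>

definition sign_pair :: "real \<Rightarrow> (int \<times> int) pmf" where
  "sign_pair r = bind_pmf sign_pmf (\<lambda>s. map_pmf (\<lambda>c. (s, if c then s else - s)) (bernoulli_pmf ((1 + r) / 2)))"

primrec bits :: "real \<Rightarrow> nat \<Rightarrow> (int \<times> int) pmf" where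
  "bits r 0 = return_pmf (0, 0)"
| "bits r (Suc k) = bind_pmf (bits r k) (\<lambda>p. map_pmf (\<lambda>s. (fst p + fst s, snd p + snd s)) (sign_pair r))"

primrec walk :: "nat \<Rightarrow> int pmf" where
  "walk 0 = return_pmf 0"
| "walk (Suc k) = bind_pmf (walk k) (\<lambda>z. map_pmf (\<lambda>s. z + s) sign_pmf)"

text \<open>Spacing 2 is the distance between the two outcomes of a walk step, so shifting the
  window by 2 exchanges a single one of its \<open>R\<close> points. Centring at 0 keeps the mean
  zero.\<close>

definition window :: "nat \<Rightarrow> int pmf" where
  "window R = map_pmf (\<lambda>j. 2 * int j + 1 - int R) (pmf_of_set {..<R})"

definition coord :: "real \<Rightarrow> nat \<Rightarrow> nat \<Rightarrow> (int \<times> int) pmf" where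
  "coord r k R = bind_pmf (bits r k) (\<lambda>p. map_pmf (\<lambda>u. (fst p + fst u, snd p + snd u)) (pair_pmf (window R) (window R)))"

definition site :: "nat \<Rightarrow> nat \<Rightarrow> int pmf" where
  "site k R = bind_pmf (walk k) (\<lambda>z. map_pmf (\<lambda>u. z + u) (window R))"

section \<open>Marginal laws of the correlated walks\<close>

lemma expect_sign_pmf: "expect sign_pmf h = (h 1 + h (- 1)) / 2"
  by (simp add: sign_pmf_def integral_pmf_of_set)

lemma finite_sign_pmf [simp]: "finite (set_pmf sign_pmf)"
  by (simp add: sign_pmf_def)

lemma finite_sign_pair [simp]: "finite (set_pmf (sign_pair r))"
  by (simp add: sign_pair_def)

lemma expect_sign_pair:
  assumes "-1 < r" "r \<le> 0"
  shows "expect (sign_pair r) h = (1 + r) / 4 * (h (1, 1) + h (-1, -1)) + (1 - r) / 4 * (h (1, -1) + h (-1, 1))"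
  using assms by (simp add: sign_pair_def expect_bind expect_sign_pmf integral_bernoulli_pmf) (simp add: field_simps)

lemma map_fst_sign_pair: "map_pmf fst (sign_pair r) = sign_pmf"
  by (simp add: sign_pair_def map_bind_pmf map_pmf_comp bind_return_pmf')

lemma map_snd_sign_pair:
  assumes "-1 < r" "r \<le> 0"
  shows "map_pmf snd (sign_pair r) = sign_pmf"
  by (rule pmf_eq_expectI) (simp add: expect_sign_pair[OF assms] expect_sign_pmf field_simps)

lemma finite_bits [simp]: "finite (set_pmf (bits r k))"
  by (induction k) auto

lemma finite_walk [simp]: "finite (set_pmf (walk k))"
  by (induction k) auto

lemma finite_window [simp]: "0 < R \<Longrightarrow> finite (set_pmf (window R))"
  by (auto simp: window_def lessThan_empty_iff)

lemma finite_coord [simp]: "0 < R \<Longrightarrow> finite (set_pmf (coord r k R))"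
  by (simp add: coord_def)

lemma finite_site [simp]: "0 < R \<Longrightarrow> finite (set_pmf (site k R))"
  by (simp add: site_def)

lemma map_fst_bits: "map_pmf fst (bits r k) = walk k"
proof (induction k)
  case (Suc k)
  show ?case
    unfolding bits.simps walk.simps Suc[symmetric] map_fst_sign_pair[of r, symmetric]
    by (simp add: map_bind_pmf map_pmf_comp bind_map_pmf)
qed simp

lemma map_snd_bits:
  assumes "-1 < r" "r \<le> 0"
  shows "map_pmf snd (bits r k) = walk k"
proof (induction k)
  case (Suc k)
  show ?case
    unfolding bits.simps walk.simps Suc[symmetric] map_snd_sign_pair[OF assms, symmetric]
    by (simp add: map_bind_pmf map_pmf_comp bind_map_pmf)
qed simp

lemma map_fst_coord: "map_pmf fst (coord r k R) = site k R"
proof -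
  have "site k R = bind_pmf (map_pmf fst (bits r k)) (\<lambda>z. map_pmf (\<lambda>u. z + u) (map_pmf fst (pair_pmf (window R) (window R))))"
    by (simp add: site_def map_fst_bits map_fst_pair_pmf)
  then show ?thesis
    by (simp add: coord_def map_bind_pmf map_pmf_comp bind_map_pmf)
qed

lemma map_snd_coord:
  assumes "-1 < r" "r \<le> 0"
  shows "map_pmf snd (coord r k R) = site k R"
proof -
  have "site k R = bind_pmf (map_pmf snd (bits r k)) (\<lambda>z. map_pmf (\<lambda>u. z + u) (map_pmf snd (pair_pmf (window R) (window R))))"
    by (simp add: site_def map_snd_bits[OF assms] map_snd_pair_pmf)
  then show ?thesis
    by (simp add: coord_def map_bind_pmf map_pmf_comp bind_map_pmf)
qed

section \<open>Smoothed increments and the inequality along the walk\<close>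

lemma expect_window:
  assumes "0 < R"
  shows "expect (window R) h = (\<Sum>j<R. h (2 * int j + 1 - int R)) / real R"
  using assms by (simp add: window_def integral_pmf_of_set lessThan_empty_iff)

text \<open>The two window averages run over the same lattice class and telescope to the two extreme
  points.\<close>

lemma window_average_increment:
  assumes R: "0 < R" and f: "\<And>x. f x \<in> {a..b}"
  shows "\<bar>expect (window R) (\<lambda>u. f (z + 1 + u)) - expect (window R) (\<lambda>u. f (z - 1 + u))\<bar> \<le> (b - a) / real R"
proof -
  have "expect (window R) (\<lambda>u. f (z + 1 + u)) - expect (window R) (\<lambda>u. f (z - 1 + u)) =
    (\<Sum>j<R. f (z - int R + 2 * int (Suc j)) - f (z - int R + 2 * int j)) / real R"
    using R by (simp add: expect_window diff_divide_distrib sum_subtractf algebra_simps)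
  also have "(\<Sum>j<R. f (z - int R + 2 * int (Suc j)) - f (z - int R + 2 * int j)) = f (z + int R) - f (z - int R)"
    by (subst sum_lessThan_telescope) (simp add: algebra_simps)
  finally show ?thesis
    using R f[of "z + int R"] f[of "z - int R"] by (auto simp: abs_divide intro!: divide_right_mono)
qed

text \<open>Increment bounds survive averaging over a step, so the bound produced by the window
  holds for all conditional expectations along the walk.\<close>

lemma average_increment:
  fixes f :: "int \<Rightarrow> real"
  assumes "\<And>z. \<bar>f (z + 1) - f (z - 1)\<bar> \<le> c"
  shows "\<bar>expect sign_pmf (\<lambda>s. f (z + 1 + s)) - expect sign_pmf (\<lambda>s. f (z - 1 + s))\<bar> \<le> c"
proof -
  have "\<bar>(f (z + 1 + 1) - f (z + 1 - 1)) + (f (z - 1 + 1) - f (z - 1 - 1))\<bar> \<le> c + c"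
    using assms[of "z + 1"] assms[of "z - 1"] by (intro order_trans[OF abs_triangle_ineq] add_mono)
  also have "(f (z + 1 + 1) - f (z + 1 - 1)) + (f (z - 1 + 1) - f (z - 1 - 1)) =
    2 * (expect sign_pmf (\<lambda>s. f (z + 1 + s)) - expect sign_pmf (\<lambda>s. f (z - 1 + s)))"
    by (simp add: expect_sign_pmf field_simps)
  finally show ?thesis
    by (simp add: abs_mult)
qed

text \<open>The conclusion of \<open>Gamma_four_point\<close> for an arbitrary \<open>J\<close>;
  \<open>x\<close>, \<open>y\<close> are midpoints and \<open>a\<close>, \<open>b\<close>
  half-differences of the values reached by one step.\<close>

definition four_point :: "real \<Rightarrow> real \<Rightarrow> real \<Rightarrow> real \<Rightarrow> real \<Rightarrow> (real \<Rightarrow> real \<Rightarrow> real) \<Rightarrow> bool" where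
  "four_point r \<kappa> w l u J \<longleftrightarrow> (\<forall>x a y b. \<bar>a\<bar> \<le> \<kappa> \<longrightarrow> \<bar>b\<bar> \<le> \<kappa> \<longrightarrow> 
    x - a \<in> {l..u} \<longrightarrow> x + a \<in> {l..u} \<longrightarrow> y - b \<in> {l..u} \<longrightarrow> y + b \<in> {l..u} \<longrightarrow>
    J x y - w * (a\<^sup>2 + b\<^sup>2) \<le> (1 + r) / 4 * (J (x + a) (y + b) + J (x - a) (y - b)) + 
      (1 - r) / 4 * (J (x + a) (y - b) + J (x - a) (y + b)))"

text \<open>Adding \<open>w (x\<^sup>2 + y\<^sup>2)\<close> absorbs the error \<open>w (a\<^sup>2 + b\<^sup>2)\<close> of each step, because this function grows by
  exactly that amount under averaging; hence the total error does not depend on the number of steps.\<close>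

definition corrected :: "real \<Rightarrow> (real \<Rightarrow> real \<Rightarrow> real) \<Rightarrow> real \<Rightarrow> real \<Rightarrow> real" where
  "corrected w J x y = J x y + w * (x\<^sup>2 + y\<^sup>2)"

lemma corrected_sign_pair:
  fixes f g :: "int \<Rightarrow> real"
  assumes r: "-1 < r" "r \<le> 0" and J: "four_point r \<kappa> w l u J"
    and f: "\<And>z. f z \<in> {l..u}" "\<And>z. \<bar>f (z + 1) - f (z - 1)\<bar> \<le> 2 * \<kappa>"
    and g: "\<And>z. g z \<in> {l..u}" "\<And>z. \<bar>g (z + 1) - g (z - 1)\<bar> \<le> 2 * \<kappa>"
  shows "corrected w J (expect sign_pmf (\<lambda>s. f (z + s))) (expect sign_pmf (\<lambda>s. g (z' + s))) \<le>
    expect (sign_pair r) (\<lambda>s. corrected w J (f (z + fst s)) (g (z' + snd s)))"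
proof -
  define x where "x = (f (z + 1) + f (z - 1)) / 2"
  define a where "a = (f (z + 1) - f (z - 1)) / 2"
  define y where "y = (g (z' + 1) + g (z' - 1)) / 2"
  define b where "b = (g (z' + 1) - g (z' - 1)) / 2"
  have fx: "f (z + 1) = x + a" "f (z - 1) = x - a" "g (z' + 1) = y + b" "g (z' - 1) = y - b"
    by (simp_all add: x_def a_def y_def b_def field_simps)
  have ab: "\<bar>a\<bar> \<le> \<kappa>" "\<bar>b\<bar> \<le> \<kappa>"
    using f(2)[of z] g(2)[of z'] by (simp_all add: a_def b_def)
  have "J x y - w * (a\<^sup>2 + b\<^sup>2) \<le> (1 + r) / 4 * (J (x + a) (y + b) + J (x - a) (y - b)) + 
      (1 - r) / 4 * (J (x + a) (y - b) + J (x - a) (y + b))"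
    using J ab f(1)[of "z + 1"] f(1)[of "z - 1"] g(1)[of "z' + 1"] g(1)[of "z' - 1"]
    unfolding four_point_def fx by blast
  moreover have "expect (sign_pair r) (\<lambda>s. corrected w J (f (z + fst s)) (g (z' + snd s))) =
      (1 + r) / 4 * (J (x + a) (y + b) + J (x - a) (y - b)) + 
      (1 - r) / 4 * (J (x + a) (y - b) + J (x - a) (y + b)) + w * (x\<^sup>2 + y\<^sup>2 + a\<^sup>2 + b\<^sup>2)"
    using fx by (simp add: expect_sign_pair[OF r] corrected_def) (simp add: field_simps power2_eq_square)
  moreover have "corrected w J (expect sign_pmf (\<lambda>s. f (z + s))) (expect sign_pmf (\<lambda>s. g (z' + s))) = J x y + w * (x\<^sup>2 + y\<^sup>2)"
    by (simp add: expect_sign_pmf corrected_def x_def y_def)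
  ultimately show ?thesis by (simp add: distrib_left)
qed

text \<open>The induction peels off the last step: the one-step averages \<open>F\<close> and
  \<open>G\<close> inherit the range and increment bounds, so the induction hypothesis applies to
  them, and the one-step inequality is then used inside the expectation.\<close>

lemma corrected_bits:
  fixes f g :: "int \<Rightarrow> real"
  assumes r: "-1 < r" "r \<le> 0" and J: "four_point r \<kappa> w l u J"
    and f: "\<And>z. f z \<in> {l..u}" "\<And>z. \<bar>f (z + 1) - f (z - 1)\<bar> \<le> 2 * \<kappa>"
    and g: "\<And>z. g z \<in> {l..u}" "\<And>z. \<bar>g (z + 1) - g (z - 1)\<bar> \<le> 2 * \<kappa>"
  shows "corrected w J (expect (bits r k) (\<lambda>p. f (fst p))) (expect (bits r k) (\<lambda>p. g (snd p))) \<le>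
    expect (bits r k) (\<lambda>p. corrected w J (f (fst p)) (g (snd p)))"
  using f g
proof (induction k arbitrary: f g)
  case 0
  then show ?case by simp
next
  case (Suc k)
  define F where "F z = expect sign_pmf (\<lambda>s. f (z + s))" for z
  define G where "G z = expect sign_pmf (\<lambda>s. g (z + s))" for z
  have FG: "expect (sign_pair r) (\<lambda>s. f (z + fst s)) = F z" "expect (sign_pair r) (\<lambda>s. g (z + snd s)) = G z" for z
    unfolding F_def G_def by (subst map_fst_sign_pair[of r, symmetric], simp, subst map_snd_sign_pair[OF r, symmetric], simp)
  have "corrected w J (expect (bits r (Suc k)) (\<lambda>p. f (fst p))) (expect (bits r (Suc k)) (\<lambda>p. g (snd p))) =
    corrected w J (expect (bits r k) (\<lambda>p. F (fst p))) (expect (bits r k) (\<lambda>p. G (snd p)))"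
    by (simp add: expect_bind FG)
  also have "\<dots> \<le> expect (bits r k) (\<lambda>p. corrected w J (F (fst p)) (G (snd p)))"
    using Suc.prems average_increment[of f] average_increment[of g] unfolding F_def G_def
    by (intro Suc.IH) (auto intro!: expect_Icc simp del: atLeastAtMost_iff)
  also have "\<dots> \<le> expect (bits r k) (\<lambda>p. expect (sign_pair r) (\<lambda>s. corrected w J (f (fst p + fst s)) (g (snd p + snd s))))"
    unfolding F_def G_def by (intro expect_mono corrected_sign_pair[OF r J] Suc.prems) auto
  also have "\<dots> = expect (bits r (Suc k)) (\<lambda>p. corrected w J (f (fst p)) (g (snd p)))"
    by (simp add: expect_bind)
  finally show ?case .
qed

text \<open>Only after averaging over the windows do arbitrary functions have the small increments
  that \<open>four_point\<close> demands. The factor 2 in \<open>2 * \<kappa> * R\<close> appears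
  because \<open>\<kappa>\<close> bounds half-differences.\<close>

lemma jensen_pair_coord:
  assumes r: "-1 < r" "r \<le> 0" and J: "four_point r \<kappa> w l u J"
    and K: "jensen_pair l u (corrected w J) (pair_pmf (window R) (window R))"
    and R: "0 < R" "u - l \<le> 2 * \<kappa> * R"
  shows "jensen_pair l u (corrected w J) (coord r k R)"
  unfolding jensen_pair_def
proof (intro allI impI)
  fix f g :: "int \<Rightarrow> real"
  assume fg: "\<forall>x. f x \<in> {l..u}" "\<forall>y. g y \<in> {l..u}"
  let ?W = "pair_pmf (window R) (window R)"
  define F where "F z = expect (window R) (\<lambda>s. f (z + s))" for z
  define G where "G z = expect (window R) (\<lambda>s. g (z + s))" for z
  have FG: "expect ?W (\<lambda>s. f (z + fst s)) = F z" "expect ?W (\<lambda>s. g (z + snd s)) = G z" for z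
    using R by (simp_all add: F_def G_def expect_pair)
  have "(u - l) / real R \<le> 2 * \<kappa>"
    using R by (simp add: field_simps)
  then have inc: "\<bar>F (z + 1) - F (z - 1)\<bar> \<le> 2 * \<kappa>" "\<bar>G (z + 1) - G (z - 1)\<bar> \<le> 2 * \<kappa>" for z
    unfolding F_def G_def using window_average_increment[OF R(1), of f l u z] window_average_increment[OF R(1), of g l u z] fg
    by fastforce+
  have Icc: "F z \<in> {l..u}" "G z \<in> {l..u}" for z
    unfolding F_def G_def using fg R by (auto intro!: expect_Icc simp del: atLeastAtMost_iff)
  have "corrected w J (expect (coord r k R) (\<lambda>p. f (fst p))) (expect (coord r k R) (\<lambda>p. g (snd p))) =
    corrected w J (expect (bits r k) (\<lambda>p. F (fst p))) (expect (bits r k) (\<lambda>p. G (snd p)))"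
    using R FG by (simp add: coord_def expect_bind)
  also have "\<dots> \<le> expect (bits r k) (\<lambda>p. corrected w J (F (fst p)) (G (snd p)))"
    by (intro corrected_bits[OF r J] inc Icc)
  also have "\<dots> \<le> expect (bits r k) (\<lambda>p. expect ?W (\<lambda>s. corrected w J (f (fst p + fst s)) (g (snd p + snd s))))"
    unfolding FG[symmetric] using fg
    by (intro expect_mono jensen_pairD[OF K, where f="\<lambda>s. f (_ + s)" and g="\<lambda>s. g (_ + s)"]) auto
  also have "\<dots> = expect (coord r k R) (\<lambda>p. corrected w J (f (fst p)) (g (snd p)))"
    using R by (simp add: coord_def expect_bind)
  finally show "corrected w J (expect (coord r k R) (\<lambda>p. f (fst p))) (expect (coord r k R) (\<lambda>p. g (snd p))) \<le>
    expect (coord r k R) (\<lambda>p. corrected w J (f (fst p)) (g (snd p)))" .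
qed

theorem discrete_Borell:
  assumes r: "-1 < r" "r \<le> 0" and e: "0 < \<epsilon>"
  shows "\<exists>R0. \<forall>R\<ge>R0. \<forall>k d f g. (\<forall>x. f x \<in> {0..1}) \<longrightarrow> (\<forall>y. g y \<in> {0..1}) \<longrightarrow>
    Gamma r (expect (power_pair d (coord r k R)) (\<lambda>p. f (fst p))) (expect (power_pair d (coord r k R)) (\<lambda>p. g (snd p))) - \<epsilon>
      \<le> expect (power_pair d (coord r k R)) (\<lambda>p. f (fst p) * g (snd p))"
proof -
  have r2: "r\<^sup>2 < 1" using r by (simp add: power2_less_1_iff)
  \<comment> \<open>The budget is \<open>4 * \<eta> + 2 * w \<le> \<epsilon>\<close>:
    \<open>2 * \<eta>\<close> for moving the two means, \<open>2 * \<eta>\<close> for moving the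
    product, \<open>2 * w\<close> for the quadratic correction. The cap \<open>1 / 4\<close> keeps
    \<open>{\<eta>..1-\<eta>}\<close> nonempty.\<close>
  define \<eta> where "\<eta> = min (\<epsilon> / 8) (1 / 4)"
  define w where "w = \<epsilon> / 4"
  have \<eta>: "0 < \<eta>" "\<eta> \<le> \<epsilon> / 8" "\<eta> \<le> 1 / 4" using e by (auto simp: \<eta>_def)
  have w: "0 < w" using e by (simp add: w_def)
  obtain \<kappa> where \<kappa>: "\<kappa> > 0" "four_point r \<kappa> w \<eta> (1 - \<eta>) (Gamma r)"
    using Gamma_four_point[OF r \<eta>(1) w] unfolding four_point_def by blast
  define K where "K = corrected w (Gamma r)"
  have sub: "\<exists>m. \<forall>x'\<in>{\<eta>..1-\<eta>}. K x y + (x' - x) * m \<le> K x' y" 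
    if "x \<in> {\<eta>..1-\<eta>}" "y \<in> {\<eta>..1-\<eta>}" for x y
  \<comment> \<open>\<open>2 * w * x\<close> is the slope of the quadratic correction, whose gap
    above its tangent is \<open>w * (x' - x)\<^sup>2\<close>.\<close>
  proof (intro exI[of _ "Gderiv r x y + 2 * w * x"] ballI)
    fix x' assume x': "x' \<in> {\<eta>..1-\<eta>}"
    have "Gamma r x y + (x' - x) * Gderiv r x y \<le> Gamma r x' y"
      by (rule Gamma_subgradient[OF r(2) r2]) (use that x' \<eta> in auto)
    moreover have "0 \<le> w * (x' - x)\<^sup>2" using w by simp
    ultimately show "K x y + (x' - x) * (Gderiv r x y + 2 * w * x) \<le> K x' y"
      by (simp add: K_def corrected_def power2_eq_square algebra_simps)
  qed
  have comm: "K x y = K y x" for x y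
    using Gamma_commute[OF r2, of x y] by (simp add: K_def corrected_def add.commute)
  have sub2: "\<exists>m. \<forall>y'\<in>{\<eta>..1-\<eta>}. K x y + (y' - y) * m \<le> K x y'" 
    if "x \<in> {\<eta>..1-\<eta>}" "y \<in> {\<eta>..1-\<eta>}" for x y
    unfolding comm[of x] using sub that by blast
  show ?thesis
  \<comment> \<open>From here on \<open>\<kappa> * R \<ge> 1\<close>, so the windows leave
    increments of at most \<open>1 / R \<le> \<kappa>\<close>; the added 1 makes \<open>R\<close>
    positive. The witness involves neither \<open>k\<close> nor \<open>d\<close>.\<close>
  proof (intro exI[of _ "nat \<lceil>1 / \<kappa>\<rceil> + 1"] allI impI)
    fix R k d :: nat and f g :: "(nat \<Rightarrow> int) \<Rightarrow> real"
    assume R: "nat \<lceil>1 / \<kappa>\<rceil> + 1 \<le> R" and f: "\<forall>x. f x \<in> {0..1}" and g: "\<forall>y. g y \<in> {0..1}"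
    have R0: "0 < R" using R by simp
    have "1 / \<kappa> \<le> R" using R by linarith
    then have "1 \<le> \<kappa> * R" using \<kappa>(1) by (simp add: field_simps)
    then have Rk: "(1 - \<eta>) - \<eta> \<le> 2 * \<kappa> * R" using \<eta> by linarith
    define P where "P = power_pair d (coord r k R)"
    have finP: "finite (set_pmf P)" using R0 by (simp add: P_def finite_power_pair)
    have "jensen_pair \<eta> (1 - \<eta>) K (pair_pmf (window R) (window R))"
      by (intro jensen_pair_indep finite_window R0 sub sub2)
    then have "jensen_pair \<eta> (1 - \<eta>) K (coord r k R)"
      unfolding K_def by (intro jensen_pair_coord[OF r \<kappa>(2) _ R0 Rk])
    then have P: "jensen_pair \<eta> (1 - \<eta>) K P"
      unfolding P_def using R0 by (intro jensen_pair_power_pair) auto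
    \<comment> \<open>An affine squeeze commutes with expectation, so the means are moved by the
      same map as the values.\<close>
    define f' where "f' x = \<eta> + (1 - 2 * \<eta>) * f x" for x
    define g' where "g' x = \<eta> + (1 - 2 * \<eta>) * g x" for x
    have clamp: "\<eta> + (1 - 2 * \<eta>) * t \<in> {\<eta>..1-\<eta>}" "\<bar>(\<eta> + (1 - 2 * \<eta>) * t) - t\<bar> \<le> \<eta>" if "t \<in> {0..1}" for t
    proof -
      have "0 \<le> (1 - 2 * \<eta>) * t" "(1 - 2 * \<eta>) * t \<le> (1 - 2 * \<eta>) * 1"
        using that \<eta> by (auto intro!: mult_nonneg_nonneg mult_left_mono)
      then show "\<eta> + (1 - 2 * \<eta>) * t \<in> {\<eta>..1-\<eta>}" by auto
      have "0 \<le> \<eta> * t" "\<eta> * t \<le> \<eta> * 1" using that \<eta> by (auto intro!: mult_left_mono)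
      then show "\<bar>(\<eta> + (1 - 2 * \<eta>) * t) - t\<bar> \<le> \<eta>" by (auto simp: algebra_simps)
    qed
    have fg': "f' x \<in> {\<eta>..1-\<eta>}" "g' y \<in> {\<eta>..1-\<eta>}" for x y
      unfolding f'_def g'_def using clamp(1) f g by blast+
    define F where "F = expect P (\<lambda>p. f (fst p))"
    define G where "G = expect P (\<lambda>p. g (snd p))"
    define F' where "F' = expect P (\<lambda>p. f' (fst p))"
    define G' where "G' = expect P (\<lambda>p. g' (snd p))"
    have FG: "F \<in> {0..1}" "G \<in> {0..1}"
      unfolding F_def G_def using f g finP by (auto intro!: expect_Icc simp del: atLeastAtMost_iff)
    have FG': "F' \<in> {\<eta>..1-\<eta>}" "G' \<in> {\<eta>..1-\<eta>}"
      unfolding F'_def G'_def using fg' finP by (auto intro!: expect_Icc simp del: atLeastAtMost_iff)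
    have "F' = \<eta> + (1 - 2 * \<eta>) * F" "G' = \<eta> + (1 - 2 * \<eta>) * G"
      using finP by (simp_all add: F'_def G'_def F_def G_def f'_def g'_def expect_add)
    then have close: "\<bar>F' - F\<bar> \<le> \<eta>" "\<bar>G' - G\<bar> \<le> \<eta>"
      using clamp(2)[OF FG(1)] clamp(2)[OF FG(2)] by simp_all
    have "\<bar>Gamma r F' G' - Gamma r F G\<bar> \<le> \<bar>F' - F\<bar> + \<bar>G' - G\<bar>"
      by (rule Gamma_lipschitz[OF r2]) (use FG FG' \<eta> in auto)
    then have 1: "Gamma r F G - 2 * \<eta> \<le> Gamma r F' G'"
      using close by linarith
    have sq: "x\<^sup>2 \<le> 1" if "x \<in> {\<eta>..1-\<eta>}" for x :: real
      using that \<eta> by (auto simp: power_le_one)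
    have "K F' G' \<le> expect P (\<lambda>p. K (f' (fst p)) (g' (snd p)))"
      unfolding F'_def G'_def by (rule jensen_pairD[OF P]) (rule fg')+
    also have "\<dots> \<le> expect P (\<lambda>p. (f (fst p) * g (snd p) + 2 * \<eta>) + 2 * w)"
    proof (rule expect_mono[OF finP])
      fix p
      let ?x = "f' (fst p)" and ?y = "g' (snd p)"
      have "Gamma r ?x ?y \<le> ?x * ?y"
        by (rule Gamma_le_mult[OF r(2) r2]) (use fg'(1)[of "fst p"] fg'(2)[of "snd p"] \<eta> in auto)
      also have "?x * ?y \<le> f (fst p) * g (snd p) + 2 * \<eta>"
      proof -
        have c: "\<bar>?x - f (fst p)\<bar> \<le> \<eta>" "\<bar>?y - g (snd p)\<bar> \<le> \<eta>"
          unfolding f'_def g'_def using clamp(2) f g by blast+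
        have x: "0 \<le> ?x" "?x \<le> 1" and gy: "0 \<le> g (snd p)" "g (snd p) \<le> 1"
          using fg'(1)[of "fst p"] g \<eta> by auto
        have "?x * (?y - g (snd p)) \<le> ?x * \<eta>"
          using c x by (intro mult_left_mono) auto
        also have "\<dots> \<le> \<eta>" using x \<eta> by (simp add: mult_left_le_one_le)
        finally have 1: "?x * (?y - g (snd p)) \<le> \<eta>" .
        have "(?x - f (fst p)) * g (snd p) \<le> \<eta> * g (snd p)"
          using c gy by (intro mult_right_mono) auto
        also have "\<dots> \<le> \<eta>" using gy \<eta> by (simp add: mult_left_le)
        finally have 2: "(?x - f (fst p)) * g (snd p) \<le> \<eta>" .
        show ?thesis
          using add_mono[OF 1 2] by (simp add: algebra_simps)
      qed
      finally have "Gamma r ?x ?y \<le> f (fst p) * g (snd p) + 2 * \<eta>" .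
      moreover have "w * (?x\<^sup>2 + ?y\<^sup>2) \<le> w * 2"
        using sq[OF fg'(1)[of "fst p"]] sq[OF fg'(2)[of "snd p"]] w by (intro mult_left_mono) auto
      ultimately show "K ?x ?y \<le> (f (fst p) * g (snd p) + 2 * \<eta>) + 2 * w"
        by (simp add: K_def corrected_def)
    qed
    also have "\<dots> = expect P (\<lambda>p. f (fst p) * g (snd p)) + 2 * \<eta> + 2 * w"
      using finP by (simp add: expect_add)
    finally have "Gamma r F' G' \<le> expect P (\<lambda>p. f (fst p) * g (snd p)) + 2 * \<eta> + 2 * w"
      using w by (simp add: K_def corrected_def) (smt (verit) mult_nonneg_nonneg zero_le_power2)
    then have "Gamma r F G - \<epsilon> \<le> expect P (\<lambda>p. f (fst p) * g (snd p))"
      using 1 \<eta>(2) by (simp add: w_def)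
    then show "Gamma r (expect (power_pair d (coord r k R)) (\<lambda>p. f (fst p))) (expect (power_pair d (coord r k R)) (\<lambda>p. g (snd p))) - \<epsilon>
      \<le> expect (power_pair d (coord r k R)) (\<lambda>p. f (fst p) * g (snd p))"
      by (simp only: P_def F_def G_def)
  qed
qed

section \<open>Concentration of normalized inner products\<close>

text \<open>Centred independent summands are orthogonal, so only the diagonal terms survive.\<close>

lemma Pi_pmf_sum_second_moment:
  assumes p: "finite (set_pmf p)" and A: "finite A" and h: "expect p h = 0"
  shows "expect (Pi_pmf A dflt (\<lambda>_. p)) (\<lambda>\<omega>. (\<Sum>c\<in>A. h (\<omega> c))\<^sup>2) = real (card A) * expect p (\<lambda>x. (h x)\<^sup>2)"
  using A
proof induction
  case empty
  then show ?case by simp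
next
  case (insert x A)
  let ?P = "Pi_pmf A dflt (\<lambda>_. p)"
  let ?S = "\<lambda>\<omega>. \<Sum>c\<in>A. h (\<omega> c)"
  have fin: "finite (set_pmf ?P)" using p insert by (intro finite_set_Pi_pmf) auto
  have S: "(\<Sum>c\<in>insert x A. h (fun_upd \<omega> x y c)) = h y + (\<Sum>c\<in>A. h (\<omega> c))" for \<omega> y
    using insert by (auto intro!: sum.cong)
  have "expect (Pi_pmf (insert x A) dflt (\<lambda>_. p)) (\<lambda>\<omega>. (\<Sum>c\<in>insert x A. h (\<omega> c))\<^sup>2) =
    expect p (\<lambda>y. expect ?P (\<lambda>\<omega>. (h y + ?S \<omega>)\<^sup>2))"
    using insert p fin by (simp add: Pi_pmf_insert expect_pair case_prod_beta' S del: fun_upd_apply sum.insert)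
  also have "\<dots> = expect p (\<lambda>y. (h y)\<^sup>2 + h y * (2 * expect ?P ?S) + expect ?P (\<lambda>\<omega>. (?S \<omega>)\<^sup>2))"
  proof -
    have "expect ?P (\<lambda>\<omega>. (h y + ?S \<omega>)\<^sup>2) = expect ?P (\<lambda>\<omega>. ((h y)\<^sup>2 + (2 * h y) * ?S \<omega>) + (?S \<omega>)\<^sup>2)" for y
      by (simp add: power2_sum algebra_simps)
    then show ?thesis
      using fin by (simp add: expect_add mult_ac)
  qed
  also have "\<dots> = expect p (\<lambda>y. (h y)\<^sup>2) + expect ?P (\<lambda>\<omega>. (?S \<omega>)\<^sup>2)"
    using p h by (simp add: expect_add)
  finally show ?case using insert by (simp add: algebra_simps)
qed

lemma expect_chebyshev:
  assumes "finite (set_pmf P)" "0 < t"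
  shows "expect P (\<lambda>\<omega>. of_bool (t \<le> \<bar>S \<omega>\<bar>)) \<le> expect P (\<lambda>\<omega>. (S \<omega>)\<^sup>2) / t\<^sup>2"
proof -
  have "expect P (\<lambda>\<omega>. of_bool (t \<le> \<bar>S \<omega>\<bar>)) \<le> expect P (\<lambda>\<omega>. (S \<omega>)\<^sup>2 / t\<^sup>2)"
  proof (rule expect_mono[OF assms(1)])
    fix \<omega>
    have "t\<^sup>2 \<le> (S \<omega>)\<^sup>2" if "t \<le> \<bar>S \<omega>\<bar>" using that assms(2) by (simp add: abs_le_square_iff[symmetric])
    then show "of_bool (t \<le> \<bar>S \<omega>\<bar>) \<le> (S \<omega>)\<^sup>2 / t\<^sup>2" using assms(2) by (auto simp: of_bool_def)
  qed
  then show ?thesis by simp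
qed

lemma weak_law_Pi_pmf:
  assumes p: "finite (set_pmf p)" and t: "0 < t" "0 < \<tau>"
  shows "\<exists>d0. \<forall>d\<ge>d0. expect (Pi_pmf {..<d} dflt (\<lambda>_. p)) (\<lambda>\<omega>. of_bool (t \<le> \<bar>(\<Sum>c<d. h (\<omega> c)) / real d - expect p h\<bar>)) \<le> \<tau>"
proof -
  define m where "m = expect p h"
  define V where "V = expect p (\<lambda>x. (h x - m)\<^sup>2)"
  have V: "0 \<le> V" unfolding V_def by (rule integral_nonneg_AE) simp
  have m0: "expect p (\<lambda>x. h x - m) = 0" using p by (simp add: expect_diff m_def)
  show ?thesis
  \<comment> \<open>Chebyshev gives \<open>V / (d * t\<^sup>2)\<close>, at most
    \<open>\<tau>\<close> beyond this threshold; adding 1 keeps \<open>d\<close> positive.\<close>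
  proof (intro exI[of _ "nat \<lceil>V / (t\<^sup>2 * \<tau>)\<rceil> + 1"] allI impI)
    fix d assume d: "nat \<lceil>V / (t\<^sup>2 * \<tau>)\<rceil> + 1 \<le> d"
    then have d0: "0 < d" by simp
    have "V / (t\<^sup>2 * \<tau>) \<le> d" using d by linarith
    then have Vd: "V \<le> d * (t\<^sup>2 * \<tau>)" using t by (simp add: pos_divide_le_eq)
    let ?P = "Pi_pmf {..<d} dflt (\<lambda>_. p)"
    have fin: "finite (set_pmf ?P)" using p by (intro finite_set_Pi_pmf) auto
    have "(\<Sum>c<d. h (\<omega> c)) / real d - m = (\<Sum>c<d. h (\<omega> c) - m) / real d" for \<omega>
      using d0 by (simp add: sum_subtractf field_simps)
    then have "expect ?P (\<lambda>\<omega>. of_bool (t \<le> \<bar>(\<Sum>c<d. h (\<omega> c)) / real d - m\<bar>)) =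
      expect ?P (\<lambda>\<omega>. of_bool (t * d \<le> \<bar>\<Sum>c<d. h (\<omega> c) - m\<bar>))"
      using d0 by (simp add: abs_divide pos_le_divide_eq)
    also have "\<dots> \<le> expect ?P (\<lambda>\<omega>. (\<Sum>c<d. h (\<omega> c) - m)\<^sup>2) / (t * d)\<^sup>2"
      using d0 t by (intro expect_chebyshev fin) auto
    also have "expect ?P (\<lambda>\<omega>. (\<Sum>c<d. h (\<omega> c) - m)\<^sup>2) = d * V"
      using Pi_pmf_sum_second_moment[OF p _ m0, of "{..<d}" dflt] by (simp add: V_def)
    also have "d * V / (t * d)\<^sup>2 = V / (d * t\<^sup>2)"
      using d0 by (simp add: power2_eq_square)
    also have "\<dots> \<le> \<tau>"
      using Vd d0 t by (simp add: pos_divide_le_eq mult_ac)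
    finally show "expect ?P (\<lambda>\<omega>. of_bool (t \<le> \<bar>(\<Sum>c<d. h (\<omega> c)) / real d - expect p h\<bar>)) \<le> \<tau>"
      by (simp add: m_def)
  qed
qed

text \<open>For \<open>X = 0\<close> the first basis vector stands in for \<open>X / |X|\<close>.\<close>

definition unitvec :: "nat \<Rightarrow> (nat \<Rightarrow> int) \<Rightarrow> nat \<Rightarrow> real" where
  "unitvec d X c = (if (\<Sum>c<d. (real_of_int (X c))\<^sup>2) = 0 then of_bool (c = 0) else X c / sqrt (\<Sum>c<d. (real_of_int (X c))\<^sup>2))"

definition unitip :: "nat \<Rightarrow> (nat \<Rightarrow> int) \<Rightarrow> (nat \<Rightarrow> int) \<Rightarrow> real" where
  "unitip d X Y = (\<Sum>c<d. unitvec d X c * unitvec d Y c)"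

lemma unitip_self:
  assumes "0 < d"
  shows "unitip d X X = 1"
proof (cases "(\<Sum>c<d. (real_of_int (X c))\<^sup>2) = 0")
  case True
  then show ?thesis using assms by (simp add: unitip_def unitvec_def of_bool_conj[symmetric])
next
  case False
  have "(\<Sum>c<d. (real_of_int (X c))\<^sup>2) \<ge> 0" by (intro sum_nonneg) auto
  then have "(\<Sum>c<d. (real_of_int (X c))\<^sup>2 / (\<Sum>c<d. (real_of_int (X c))\<^sup>2)) = 1"
    using False by (simp add: sum_divide_distrib[symmetric])
  then show ?thesis using False \<open>(\<Sum>c<d. (real_of_int (X c))\<^sup>2) \<ge> 0\<close>
    by (simp add: unitip_def unitvec_def power2_eq_square[symmetric] power_divide)
qed

lemma abs_unitip_le:
  assumes "0 < d"
  shows "\<bar>unitip d X Y\<bar> \<le> 1"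
proof -
  have "\<bar>unitip d X Y\<bar> \<le> (\<Sum>c<d. \<bar>unitvec d X c * unitvec d Y c\<bar>)"
    unfolding unitip_def by (rule sum_abs)
  also have "\<dots> \<le> (\<Sum>c<d. (unitvec d X c * unitvec d X c + unitvec d Y c * unitvec d Y c) / 2)"
  proof (rule sum_mono)
    fix c show "\<bar>unitvec d X c * unitvec d Y c\<bar> \<le> (unitvec d X c * unitvec d X c + unitvec d Y c * unitvec d Y c) / 2"
      using sum_squares_bound[of "\<bar>unitvec d X c\<bar>" "\<bar>unitvec d Y c\<bar>"] by (simp add: abs_mult power2_eq_square)
  qed
  also have "\<dots> = (unitip d X X + unitip d Y Y) / 2"
    by (simp add: unitip_def sum.distrib sum_divide_distrib[symmetric])
  finally show ?thesis using assms by (simp add: unitip_self)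
qed

text \<open>The normalized inner product is a continuous function of three empirical means, those of
  the product and of the two squares, in which the factors \<open>1 / d\<close> cancel. The weak law
  for the three means and continuity at \<open>(c, v, v)\<close> give concentration at
  \<open>c / v\<close>.\<close>

lemma power_pair_concentration:
  assumes p: "finite (set_pmf p)" and c: "expect p (\<lambda>x. real_of_int (fst x * snd x)) = c"
    and v: "expect p (\<lambda>x. real_of_int (fst x)^2) = v" "expect p (\<lambda>x. real_of_int (snd x)^2) = v" "0 < v"
    and \<tau>: "0 < \<tau>"
  shows "\<exists>d0. \<forall>d\<ge>d0. expect (power_pair d p) (\<lambda>z. of_bool (\<not> \<bar>unitip d (fst z) (snd z) - c / v\<bar> \<le> \<tau>)) \<le> \<tau>"
proof -
  define G where "G = (\<lambda>(s, a, b). s / (sqrt a * sqrt b) :: real)"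
  have "isCont G (c, v, v)"
    unfolding G_def case_prod_beta' using v(3) by (intro continuous_intros) auto
  then obtain t0 where t0: "t0 > 0" "\<And>z. dist z (c, v, v) < t0 \<Longrightarrow> dist (G z) (G (c, v, v)) < \<tau>"
    unfolding continuous_at_eps_delta using \<tau> by blast
  \<comment> \<open>With \<open>t0 / 4\<close> the three errors add up to less than
    \<open>t0\<close>; \<open>v / 2\<close> keeps both squared norms positive, away from the default
    case of \<open>unitvec\<close>.\<close>
  define t where "t = min (t0 / 4) (v / 2)"
  have t: "0 < t" using t0 v by (auto simp: t_def)
  have close: "\<bar>s / (sqrt a * sqrt b) - c / v\<bar> \<le> \<tau> \<and> 0 < a \<and> 0 < b" if "\<bar>s - c\<bar> < t" "\<bar>a - v\<bar> < t" "\<bar>b - v\<bar> < t" for s a b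
  proof -
    have "dist (s, a, b) (c, v, v) \<le> \<bar>s - c\<bar> + dist (a, b) (v, v)"
      using sqrt_sum_squares_le_sum_abs[of "dist s c" "dist (a, b) (v, v)"] by (simp add: dist_Pair_Pair dist_real_def)
    also have "dist (a, b) (v, v) \<le> \<bar>a - v\<bar> + \<bar>b - v\<bar>"
      using sqrt_sum_squares_le_sum_abs[of "a - v" "b - v"] by (simp add: dist_Pair_Pair dist_real_def)
    finally have "dist (s, a, b) (c, v, v) < t0"
      using that t0(1) unfolding t_def by linarith
    from t0(2)[OF this] have "\<bar>s / (sqrt a * sqrt b) - c / v\<bar> \<le> \<tau>"
      using v(3) by (simp add: G_def dist_real_def)
    moreover have "0 < a" "0 < b" using that v(3) unfolding t_def by linarith+
    ultimately show ?thesis by simp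
  qed
  define h1 where "h1 x = real_of_int (fst x * snd x)" for x :: "int \<times> int"
  define h2 where "h2 x = real_of_int (fst x)^2" for x :: "int \<times> int"
  define h3 where "h3 x = real_of_int (snd x)^2" for x :: "int \<times> int"
  let ?P = "\<lambda>d. Pi_pmf {..<d} (0, 0) (\<lambda>_. p)"
  have \<tau>3: "0 < \<tau> / 3" using \<tau> by simp
  obtain d1 where d1: "\<And>d. d \<ge> d1 \<Longrightarrow> expect (?P d) (\<lambda>\<omega>. of_bool (t \<le> \<bar>(\<Sum>c<d. h1 (\<omega> c)) / real d - c\<bar>)) \<le> \<tau> / 3"
    using weak_law_Pi_pmf[OF p t \<tau>3, of "(0, 0)" h1] c unfolding h1_def by auto
  obtain d2 where d2: "\<And>d. d \<ge> d2 \<Longrightarrow> expect (?P d) (\<lambda>\<omega>. of_bool (t \<le> \<bar>(\<Sum>c<d. h2 (\<omega> c)) / real d - v\<bar>)) \<le> \<tau> / 3"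
    using weak_law_Pi_pmf[OF p t \<tau>3, of "(0, 0)" h2] v unfolding h2_def by auto
  obtain d3 where d3: "\<And>d. d \<ge> d3 \<Longrightarrow> expect (?P d) (\<lambda>\<omega>. of_bool (t \<le> \<bar>(\<Sum>c<d. h3 (\<omega> c)) / real d - v\<bar>)) \<le> \<tau> / 3"
    using weak_law_Pi_pmf[OF p t \<tau>3, of "(0, 0)" h3] v unfolding h3_def by auto
  show ?thesis
  proof (intro exI[of _ "max 1 (max d1 (max d2 d3))"] allI impI)
    fix d assume d: "max 1 (max d1 (max d2 d3)) \<le> d"
    then have dd: "0 < d" "d \<ge> d1" "d \<ge> d2" "d \<ge> d3" by auto
    have fin: "finite (set_pmf (?P d))" using p by (intro finite_set_Pi_pmf) auto
    let ?b1 = "\<lambda>\<omega>. t \<le> \<bar>(\<Sum>c<d. h1 (\<omega> c)) / real d - c\<bar>"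
    let ?b2 = "\<lambda>\<omega>. t \<le> \<bar>(\<Sum>c<d. h2 (\<omega> c)) / real d - v\<bar>"
    let ?b3 = "\<lambda>\<omega>. t \<le> \<bar>(\<Sum>c<d. h3 (\<omega> c)) / real d - v\<bar>"
    have "expect (power_pair d p) (\<lambda>z. of_bool (\<not> \<bar>unitip d (fst z) (snd z) - c / v\<bar> \<le> \<tau>)) =
      expect (?P d) (\<lambda>\<omega>. of_bool (\<not> \<bar>unitip d (fst \<circ> \<omega>) (snd \<circ> \<omega>) - c / v\<bar> \<le> \<tau>))"
      by (simp add: power_pair_def)
    also have "\<dots> \<le> expect (?P d) (\<lambda>\<omega>. (of_bool (?b1 \<omega>) + of_bool (?b2 \<omega>)) + of_bool (?b3 \<omega>))"
    proof (rule expect_mono[OF fin])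
      fix \<omega> :: "nat \<Rightarrow> int \<times> int"
      have "\<bar>unitip d (fst \<circ> \<omega>) (snd \<circ> \<omega>) - c / v\<bar> \<le> \<tau>" if "\<not> ?b1 \<omega>" "\<not> ?b2 \<omega>" "\<not> ?b3 \<omega>"
      proof -
        define s where "s = (\<Sum>c<d. h1 (\<omega> c))"
        define a where "a = (\<Sum>c<d. h2 (\<omega> c))"
        define b where "b = (\<Sum>c<d. h3 (\<omega> c))"
        have *: "\<bar>s / d / (sqrt (a / d) * sqrt (b / d)) - c / v\<bar> \<le> \<tau>" "0 < a / d" "0 < b / d"
          using close[of "s / d" "a / d" "b / d"] that by (auto simp: s_def a_def b_def)
        then have ab: "a > 0" "b > 0" using dd by (auto simp: zero_less_divide_iff)
        have "s / d / (sqrt (a / d) * sqrt (b / d)) = s / (sqrt a * sqrt b)"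
          using dd by (simp add: real_sqrt_divide)
        also have "s / (sqrt a * sqrt b) = (\<Sum>c<d. h1 (\<omega> c) / (sqrt a * sqrt b))"
          by (simp add: s_def sum_divide_distrib)
        also have "\<dots> = unitip d (fst \<circ> \<omega>) (snd \<circ> \<omega>)"
          using ab by (simp add: unitip_def unitvec_def h1_def h2_def h3_def a_def b_def)
        finally show ?thesis using * by simp
      qed
      then show "of_bool (\<not> \<bar>unitip d (fst \<circ> \<omega>) (snd \<circ> \<omega>) - c / v\<bar> \<le> \<tau>) \<le> (of_bool (?b1 \<omega>) + of_bool (?b2 \<omega>) :: real) + of_bool (?b3 \<omega>)"
        by (auto simp: of_bool_def)
    qed
    also have "\<dots> \<le> \<tau>"
      using d1[OF dd(2)] d2[OF dd(3)] d3[OF dd(4)] fin by (simp add: expect_add)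
    finally show "expect (power_pair d p) (\<lambda>z. of_bool (\<not> \<bar>unitip d (fst z) (snd z) - c / v\<bar> \<le> \<tau>)) \<le> \<tau>" .
  qed
qed

text \<open>Presents two independent lattice points as a power of an independent pair, so that
  \<open>power_pair_concentration\<close> with \<open>c = 0\<close> covers unrelated vertices
  too.\<close>

lemma power_pair_indep:
  assumes "finite (set_pmf p)" "finite (set_pmf q)"
  shows "power_pair d (pair_pmf p q) = pair_pmf (Pi_pmf {..<d} 0 (\<lambda>_. p)) (Pi_pmf {..<d} 0 (\<lambda>_. q))"
proof (rule pmf_eqI)
  fix z :: "(nat \<Rightarrow> int) \<times> (nat \<Rightarrow> int)"
  obtain f g where z: "z = (f, g)" by (cases z)
  let ?F = "\<lambda>\<omega> :: nat \<Rightarrow> int \<times> int. (fst \<circ> \<omega>, snd \<circ> \<omega>)"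
  have inj: "inj ?F" by (rule injI) (auto simp: fun_eq_iff prod_eq_iff)
  have "pmf (power_pair d (pair_pmf p q)) (?F (\<lambda>c. (f c, g c))) = pmf (Pi_pmf {..<d} (0, 0) (\<lambda>_. pair_pmf p q)) (\<lambda>c. (f c, g c))"
    unfolding power_pair_def by (rule pmf_map_inj'[OF inj])
  moreover have "?F (\<lambda>c. (f c, g c)) = z" by (simp add: z comp_def)
  ultimately show "pmf (power_pair d (pair_pmf p q)) z = pmf (pair_pmf (Pi_pmf {..<d} 0 (\<lambda>_. p)) (Pi_pmf {..<d} 0 (\<lambda>_. q))) z"
    by (auto simp: z pmf_pair pmf_Pi prod.distrib)
qed

lemma map_fst_power_pair: "map_pmf fst (power_pair d p) = Pi_pmf {..<d} 0 (\<lambda>_. map_pmf fst p)"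
  unfolding power_pair_def by (simp add: map_pmf_comp Pi_pmf_map[of "{..<d}" fst "(0, 0)" 0])

lemma map_snd_power_pair: "map_pmf snd (power_pair d p) = Pi_pmf {..<d} 0 (\<lambda>_. map_pmf snd p)"
  unfolding power_pair_def by (simp add: map_pmf_comp Pi_pmf_map[of "{..<d}" snd "(0, 0)" 0])

section \<open>Second moments of the smeared walk and the choice of its length\<close>

lemma sum_odd_real: "(\<Sum>j<n. 2 * real j + 1) = (real n)\<^sup>2"
  by (induction n) (simp_all add: power2_eq_square algebra_simps)

lemma expect_window_id:
  assumes "0 < R"
  shows "expect (window R) real_of_int = 0"
proof -
  have "(\<Sum>j<R. real_of_int (2 * int j + 1 - int R)) = (\<Sum>j<R. 2 * real j + 1) - (\<Sum>j<R. real R)"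
    by (subst sum_subtractf[symmetric]) simp
  also have "\<dots> = 0" unfolding sum_odd_real by (simp add: power2_eq_square)
  finally show ?thesis using assms by (simp add: expect_window)
qed

definition window_var :: "nat \<Rightarrow> real" where
  "window_var R = expect (window R) (\<lambda>u. (real_of_int u)\<^sup>2)"

lemma window_var_nonneg: "0 \<le> window_var R"
  unfolding window_var_def by (rule integral_nonneg_AE) simp

lemma expect_walk: "expect (walk k) real_of_int = 0" "expect (walk k) (\<lambda>z. (real_of_int z)\<^sup>2) = real k"
proof (induction k)
  case (Suc k)
  { case 1
    show ?case using Suc by (simp add: expect_bind expect_sign_pmf expect_add) }
  { case 2
    have "(((real_of_int z + 1)\<^sup>2 + (real_of_int z - 1)\<^sup>2) / 2) = (real_of_int z)\<^sup>2 + 1" for z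
      by (simp add: power2_eq_square algebra_simps)
    then show ?case using Suc by (simp add: expect_bind expect_sign_pmf expect_add) }
qed simp_all

lemma expect_site:
  assumes "0 < R"
  shows "expect (site k R) real_of_int = 0" "expect (site k R) (\<lambda>z. (real_of_int z)\<^sup>2) = real k + window_var R"
proof -
  show "expect (site k R) real_of_int = 0"
    using assms by (simp add: site_def expect_bind expect_add expect_walk expect_window_id)
  have "expect (window R) (\<lambda>u. (real_of_int (z + u))\<^sup>2) = (real_of_int z)\<^sup>2 + window_var R" for z
  proof -
    have "expect (window R) (\<lambda>u. (real_of_int (z + u))\<^sup>2) =
      expect (window R) (\<lambda>u. ((real_of_int z)\<^sup>2 + (2 * real_of_int z) * real_of_int u) + (real_of_int u)\<^sup>2)"
      by (simp add: power2_sum algebra_simps)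
    also have "\<dots> = (real_of_int z)\<^sup>2 + window_var R"
      using assms by (simp only: expect_add finite_window integral_mult_right_zero expect_const expect_window_id window_var_def mult_zero_right add_0_right)
    finally show ?thesis .
  qed
  then show "expect (site k R) (\<lambda>z. (real_of_int z)\<^sup>2) = real k + window_var R"
    using assms by (simp add: site_def expect_bind expect_add expect_walk)
qed

lemma expect_bits_mult:
  assumes "-1 < r" "r \<le> 0"
  shows "expect (bits r k) (\<lambda>p. real_of_int (fst p * snd p)) = k * r"
proof (induction k)
  case (Suc k)
  have "expect (sign_pair r) (\<lambda>s. real_of_int ((a + fst s) * (b + snd s))) = real_of_int (a * b) + r" for a b
    by (simp add: expect_sign_pair[OF assms] field_simps)
  then have "expect (bits r (Suc k)) (\<lambda>p. real_of_int (fst p * snd p)) = expect (bits r k) (\<lambda>p. real_of_int (fst p * snd p) + r)"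
    by (simp add: expect_bind del: of_int_mult of_int_add)
  then show ?case
    by (simp only: expect_add finite_bits Suc expect_const) (simp add: algebra_simps)
qed simp

text \<open>The centred independent windows leave the mixed moment of the walks unchanged, while
  they raise each second moment by \<open>window_var R\<close>.\<close>

lemma expect_coord_mult:
  assumes r: "-1 < r" "r \<le> 0" and R: "0 < R"
  shows "expect (coord r k R) (\<lambda>p. real_of_int (fst p * snd p)) = k * r"
proof -
  have "expect (pair_pmf (window R) (window R)) (\<lambda>u. real_of_int ((a + fst u) * (b + snd u))) = real_of_int (a * b)" for a b
  proof -
    have "expect (window R) (\<lambda>u. real_of_int ((a + t) * (b + u))) = (real_of_int a * b + real_of_int b * t)" for t
    proof -
      have "expect (window R) (\<lambda>u. real_of_int ((a + t) * (b + u))) =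
        expect (window R) (\<lambda>u. (real_of_int a * b + real_of_int b * t) + (real_of_int a + t) * real_of_int u)"
        by (simp add: algebra_simps)
      also have "\<dots> = real_of_int a * b + real_of_int b * t"
        using R by (simp only: expect_add finite_window integral_mult_right_zero expect_const expect_window_id mult_zero_right add_0_right)
      finally show ?thesis .
    qed
    then show ?thesis
      using R by (simp add: expect_pair expect_add expect_window_id)
  qed
  then show ?thesis
    using R expect_bits_mult[OF r, of k] by (simp add: coord_def expect_bind del: of_int_mult of_int_add)
qed

lemma expect_coord_square:
  assumes r: "-1 < r" "r \<le> 0" and R: "0 < R"
  shows "expect (coord r k R) (\<lambda>p. (real_of_int (fst p))\<^sup>2) = k + window_var R"
    "expect (coord r k R) (\<lambda>p. (real_of_int (snd p))\<^sup>2) = k + window_var R"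
proof -
  have "expect (map_pmf fst (coord r k R)) (\<lambda>x. (real_of_int x)\<^sup>2) = k + window_var R"
    by (simp only: map_fst_coord expect_site[OF R])
  then show "expect (coord r k R) (\<lambda>p. (real_of_int (fst p))\<^sup>2) = k + window_var R" by simp
  have "expect (map_pmf snd (coord r k R)) (\<lambda>x. (real_of_int x)\<^sup>2) = k + window_var R"
    by (simp only: map_snd_coord[OF r] expect_site[OF R])
  then show "expect (coord r k R) (\<lambda>p. (real_of_int (snd p))\<^sup>2) = k + window_var R" by simp
qed

definition state :: "nat \<Rightarrow> nat \<Rightarrow> nat \<Rightarrow> (nat \<Rightarrow> int) pmf" where
  "state k R d = Pi_pmf {..<d} 0 (\<lambda>_. site k R)"

lemma finite_state: "0 < R \<Longrightarrow> finite (set_pmf (state k R d))"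
  unfolding state_def by (intro finite_set_Pi_pmf) auto

lemma map_power_pair_coord:
  assumes "-1 < r" "r \<le> 0"
  shows "map_pmf fst (power_pair d (coord r k R)) = state k R d" "map_pmf snd (power_pair d (coord r k R)) = state k R d"
  by (simp_all add: map_fst_power_pair map_snd_power_pair map_fst_coord map_snd_coord[OF assms] state_def)

text \<open>Half of \<open>\<tau>\<close> pays for the dilution by the windows, which is at most
  \<open>window_var R / k\<close>, and half for the concentration in high dimension; hence
  \<open>d0\<close> is chosen after \<open>k\<close>.\<close>

lemma power_pair_coord_correlation:
  assumes r: "-1 < r" "r \<le> 0" and R: "0 < R" and \<tau>: "0 < \<tau>"
  shows "\<exists>k0. \<forall>k\<ge>k0. \<exists>d0. \<forall>d\<ge>d0. 
    expect (power_pair d (coord r k R)) (\<lambda>z. of_bool (\<not> \<bar>unitip d (fst z) (snd z) - r\<bar> \<le> \<tau>)) \<le> \<tau>"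
proof (rule exI[of _ "nat \<lceil>2 * window_var R / \<tau>\<rceil> + 1"], intro allI impI)
  fix k assume k: "nat \<lceil>2 * window_var R / \<tau>\<rceil> + 1 \<le> k"
  define s where "s = window_var R"
  have s: "0 \<le> s" by (simp add: s_def window_var_nonneg)
  have k0: "0 < k" using k by simp
  have "2 * s / \<tau> \<le> k" using k unfolding s_def by linarith
  then have ks: "s \<le> \<tau> / 2 * k" using \<tau> by (simp add: pos_divide_le_eq mult.commute)
  have "k * r / (k + s) - r = - (r * s / (k + s))"
    using k0 s by (simp add: field_simps)
  then have "\<bar>k * r / (k + s) - r\<bar> = \<bar>r\<bar> * s / (k + s)"
    using k0 s by (simp add: abs_mult abs_divide)
  also have "\<dots> \<le> 1 * s / k"
    using r k0 s by (intro frac_le mult_right_mono) auto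
  also have "\<dots> \<le> \<tau> / 2"
    using ks k0 by (simp add: pos_divide_le_eq)
  finally have close: "\<bar>k * r / (k + s) - r\<bar> \<le> \<tau> / 2" .
  obtain d0 where d0: "\<And>d. d \<ge> d0 \<Longrightarrow> 
    expect (power_pair d (coord r k R)) (\<lambda>z. of_bool (\<not> \<bar>unitip d (fst z) (snd z) - k * r / (k + s)\<bar> \<le> \<tau> / 2)) \<le> \<tau> / 2"
    using power_pair_concentration[of "coord r k R" "k * r" "k + s" "\<tau> / 2"] expect_coord_square[OF r R, of k]
      expect_coord_mult[OF r R, of k] R \<tau> k0 s unfolding s_def by auto
  show "\<exists>d0. \<forall>d\<ge>d0. 
    expect (power_pair d (coord r k R)) (\<lambda>z. of_bool (\<not> \<bar>unitip d (fst z) (snd z) - r\<bar> \<le> \<tau>)) \<le> \<tau>"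
  proof (intro exI[of _ d0] allI impI)
    fix d assume d: "d0 \<le> d"
    have "expect (power_pair d (coord r k R)) (\<lambda>z. of_bool (\<not> \<bar>unitip d (fst z) (snd z) - r\<bar> \<le> \<tau>)) \<le>
      expect (power_pair d (coord r k R)) (\<lambda>z. of_bool (\<not> \<bar>unitip d (fst z) (snd z) - k * r / (k + s)\<bar> \<le> \<tau> / 2))"
    proof (rule expect_mono)
      show "finite (set_pmf (power_pair d (coord r k R)))" using R by (simp add: finite_power_pair)
      fix z :: "(nat \<Rightarrow> int) \<times> (nat \<Rightarrow> int)"
      have "\<bar>u - r\<bar> \<le> \<tau>" if "\<bar>u - k * r / (k + s)\<bar> \<le> \<tau> / 2" for u
        using abs_triangle_ineq[of "u - k * r / (k + s)" "k * r / (k + s) - r"] add_mono[OF that close] by simp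
      then show "of_bool (\<not> \<bar>unitip d (fst z) (snd z) - r\<bar> \<le> \<tau>) \<le> (of_bool (\<not> \<bar>unitip d (fst z) (snd z) - k * r / (k + s)\<bar> \<le> \<tau> / 2) :: real)"
        by (auto simp: of_bool_def)
    qed
    also have "\<dots> \<le> \<tau> / 2" by (rule d0[OF d])
    finally show "expect (power_pair d (coord r k R)) (\<lambda>z. of_bool (\<not> \<bar>unitip d (fst z) (snd z) - r\<bar> \<le> \<tau>)) \<le> \<tau>"
      using \<tau> by simp
  qed
qed

lemma state_uncorrelated:
  assumes R: "0 < R" and k: "0 < k" and \<tau>: "0 < \<tau>"
  shows "\<exists>d0. \<forall>d\<ge>d0. expect (state k R d) (\<lambda>X. expect (state k R d) (\<lambda>Y. \<bar>unitip d X Y\<bar>)) \<le> \<tau>"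
proof -
  let ?p = "pair_pmf (site k R) (site k R)"
  have "expect ?p (\<lambda>x. real_of_int (fst x * snd x)) = 0"
    using R by (simp add: expect_pair expect_site)
  moreover have "expect ?p (\<lambda>x. (real_of_int (fst x))\<^sup>2) = k + window_var R" "expect ?p (\<lambda>x. (real_of_int (snd x))\<^sup>2) = k + window_var R"
    using R by (simp_all add: expect_pair expect_site)
  moreover have "0 < k + window_var R" using k window_var_nonneg[of R] by simp
  ultimately obtain d0 where d0: "\<And>d. d \<ge> d0 \<Longrightarrow> 
    expect (power_pair d ?p) (\<lambda>z. of_bool (\<not> \<bar>unitip d (fst z) (snd z) - 0 / (k + window_var R)\<bar> \<le> \<tau> / 2)) \<le> \<tau> / 2"
    using power_pair_concentration[of ?p 0 "k + window_var R" "\<tau> / 2"] R \<tau> by auto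
  show ?thesis
  proof (intro exI[of _ "max d0 1"] allI impI)
    fix d assume d: "max d0 1 \<le> d"
    have fin: "finite (set_pmf (power_pair d ?p))" using R by (simp add: finite_power_pair)
    have "expect (state k R d) (\<lambda>X. expect (state k R d) (\<lambda>Y. \<bar>unitip d X Y\<bar>)) = expect (power_pair d ?p) (\<lambda>z. \<bar>unitip d (fst z) (snd z)\<bar>)"
      using R finite_state[OF R, of k d] by (simp add: power_pair_indep state_def[symmetric] expect_pair)
    \<comment> \<open>Where concentration fails, the trivial bound
      \<open>\<bar>unitip d X Y\<bar> \<le> 1\<close> is paid for by the probability of
      failure.\<close>
    also have "\<dots> \<le> expect (power_pair d ?p) (\<lambda>z. \<tau> / 2 + of_bool (\<not> \<bar>unitip d (fst z) (snd z) - 0 / (k + window_var R)\<bar> \<le> \<tau> / 2))"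
    proof (rule expect_mono[OF fin])
      fix z show "\<bar>unitip d (fst z) (snd z)\<bar> \<le> \<tau> / 2 + of_bool (\<not> \<bar>unitip d (fst z) (snd z) - 0 / (k + window_var R)\<bar> \<le> \<tau> / 2)"
        using abs_unitip_le[of d "fst z" "snd z"] d \<tau> by (auto simp: of_bool_def)
    qed
    also have "\<dots> \<le> \<tau>"
      using d0[of d] d fin by (simp add: expect_add)
    finally show "expect (state k R d) (\<lambda>X. expect (state k R d) (\<lambda>Y. \<bar>unitip d X Y\<bar>)) \<le> \<tau>" .
  qed
qed

section \<open>The graph\<close>

text \<open>Transfers sums over abstract vertices and weighted pairs to a graph on
  \<open>{1..n}\<close>. Numbers outside the image get weight 0, which is how every large
  \<open>n\<close> is reached, and pairs with the same unordered end points are merged by adding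
  their weights. Sorting forgets the orientation of a pair, so the edge sums are stated for
  symmetric \<open>F\<close>.\<close>

lemma weighted_pairs_graph:
  fixes V :: "'a set" and \<Omega> :: "'b set" and s t :: "'b \<Rightarrow> 'a" and c :: "'b \<Rightarrow> real" and wv :: "'a \<Rightarrow> real"
  assumes V: "finite V" "card V \<le> n" and \<Omega>: "finite \<Omega>"
    and st: "\<And>\<omega>. \<omega> \<in> \<Omega> \<Longrightarrow> s \<omega> \<in> V \<and> t \<omega> \<in> V \<and> s \<omega> \<noteq> t \<omega>"
    and c: "\<And>\<omega>. \<omega> \<in> \<Omega> \<Longrightarrow> 0 \<le> c \<omega>" and wv: "\<And>v. v \<in> V \<Longrightarrow> 0 \<le> wv v"
  obtains idx E wV wE where "inj_on idx V" "idx ` V \<subseteq> {1..n}" "is_weighted_graph n E wV wE"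
    "\<And>F. (\<Sum>i=1..n. wV i * F i) = (\<Sum>v\<in>V. wv v * F (idx v))"
    "\<And>F. (\<And>i j. F i j = F j i) \<Longrightarrow> (\<Sum>(i, j)\<in>E. wE (i, j) * F i j) = (\<Sum>\<omega>\<in>\<Omega>. c \<omega> * F (idx (s \<omega>)) (idx (t \<omega>)))"
    "\<And>i j. (i, j) \<in> E \<Longrightarrow> \<exists>\<omega>\<in>\<Omega>. (i, j) = (idx (s \<omega>), idx (t \<omega>)) \<or> (i, j) = (idx (t \<omega>), idx (s \<omega>))"
    "finite E"
proof -
  obtain h where h: "bij_betw h V {1..card V}"
    using V(1) by (metis bij_betw_inv ex_bij_betw_nat_finite_1)
  then have inj: "inj_on h V" and im: "h ` V = {1..card V}" by (auto simp: bij_betw_def)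
  have rng: "h v \<in> {1..n}" if "v \<in> V" for v using im that V(2) by fastforce
  define e where "e \<omega> = (min (h (s \<omega>)) (h (t \<omega>)), max (h (s \<omega>)) (h (t \<omega>)))" for \<omega>
  define wE where "wE x = (\<Sum>\<omega>\<in>{\<omega>\<in>\<Omega>. e \<omega> = x}. c \<omega>)" for x
  define wV where "wV i = (if i \<in> h ` V then wv (inv_into V h i) else 0)" for i
  have ne: "h (s \<omega>) \<noteq> h (t \<omega>)" if "\<omega> \<in> \<Omega>" for \<omega>
    using st[OF that] inj by (meson inj_on_eq_iff)
  show ?thesis
  proof (rule that[of h "e ` \<Omega>" wV wE])
    show "inj_on h V" by (rule inj)
    show "h ` V \<subseteq> {1..n}" using rng by blast
    show "finite (e ` \<Omega>)" using \<Omega> by simp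
    show "is_weighted_graph n (e ` \<Omega>) wV wE"
      unfolding is_weighted_graph_def
    proof (intro conjI ballI)
      show "e ` \<Omega> \<subseteq> {(i, j). 1 \<le> i \<and> i < j \<and> j \<le> n}"
      proof
        fix x assume "x \<in> e ` \<Omega>"
        then obtain \<omega> where w: "\<omega> \<in> \<Omega>" "x = e \<omega>" by blast
        show "x \<in> {(i, j). 1 \<le> i \<and> i < j \<and> j \<le> n}"
          using rng[of "s \<omega>"] rng[of "t \<omega>"] st[OF w(1)] ne[OF w(1)] by (auto simp: w(2) e_def min_def max_def)
      qed
      show "0 \<le> wV i" for i
        using wv inv_into_into[of i h V] by (auto simp: wV_def)
      show "0 \<le> wE x" for x
        unfolding wE_def using c by (intro sum_nonneg) auto
    qed
    show "(\<Sum>i=1..n. wV i * F i) = (\<Sum>v\<in>V. wv v * F (h v))" for F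
    proof -
      have "(\<Sum>i=1..n. wV i * F i) = (\<Sum>i\<in>h ` V. wV i * F i)"
        using rng by (intro sum.mono_neutral_right) (auto simp: wV_def)
      also have "\<dots> = (\<Sum>v\<in>V. wv v * F (h v))"
        using inj by (simp add: sum.reindex wV_def inv_into_f_f)
      finally show ?thesis .
    qed
    show "(\<Sum>(i, j)\<in>e ` \<Omega>. wE (i, j) * F i j) = (\<Sum>\<omega>\<in>\<Omega>. c \<omega> * F (h (s \<omega>)) (h (t \<omega>)))"
      if F: "\<And>i j. F i j = F j i" for F
    proof -
      have Fe: "F (fst (e \<omega>)) (snd (e \<omega>)) = F (h (s \<omega>)) (h (t \<omega>))" for \<omega>
        using F by (auto simp: e_def min_def max_def)
      have "(\<Sum>(i, j)\<in>e ` \<Omega>. wE (i, j) * F i j) = (\<Sum>x\<in>e ` \<Omega>. \<Sum>\<omega>\<in>{\<omega>\<in>\<Omega>. e \<omega> = x}. c \<omega> * F (fst (e \<omega>)) (snd (e \<omega>)))"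
      proof (rule sum.cong[OF refl])
        fix x assume "x \<in> e ` \<Omega>"
        have "(case x of (i, j) \<Rightarrow> wE (i, j) * F i j) = wE x * F (fst x) (snd x)"
          by (cases x) simp
        also have "\<dots> = (\<Sum>\<omega>\<in>{\<omega>\<in>\<Omega>. e \<omega> = x}. c \<omega> * F (fst (e \<omega>)) (snd (e \<omega>)))"
          by (auto simp: wE_def sum_distrib_right intro!: sum.cong)
        finally show "(case x of (i, j) \<Rightarrow> wE (i, j) * F i j) = \<dots>" .
      qed
      also have "\<dots> = (\<Sum>\<omega>\<in>\<Omega>. c \<omega> * F (fst (e \<omega>)) (snd (e \<omega>)))"
        using \<Omega> by (intro sum.group) auto
      finally show ?thesis by (simp only: Fe)
    qed
    show "\<exists>\<omega>\<in>\<Omega>. (i, j) = (h (s \<omega>), h (t \<omega>)) \<or> (i, j) = (h (t \<omega>), h (s \<omega>))" if "(i, j) \<in> e ` \<Omega>" for i j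
      using that by (auto simp: e_def min_def max_def split: if_splits)
  qed
qed

lemma cut_weight_eq:
  assumes "finite E"
  shows "cut_weight E wE A = (\<Sum>(i, j)\<in>E. wE (i, j) * of_bool ((i \<in> A) \<noteq> (j \<in> A)))"
  unfolding cut_weight_def using assms
  by (intro sum.mono_neutral_cong_left) auto

section \<open>Vectors attached to the vertices\<close>

definition axis_vec :: "nat \<Rightarrow> nat \<Rightarrow> real" where
  "axis_vec j k = of_bool (k = j)"

text \<open>Coordinate 0 is the direction of \<open>v 0\<close> and the remaining \<open>d\<close>
  coordinates carry the normalized lattice point, so \<open>perp\<close> returns exactly that
  point.\<close>

definition vertex_vec :: "nat \<Rightarrow> real \<times> (nat \<Rightarrow> int) \<Rightarrow> nat \<Rightarrow> real" where
  "vertex_vec d v k = (case k of 0 \<Rightarrow> fst v | Suc c \<Rightarrow> sqrt (1 - (fst v)\<^sup>2) * unitvec d (snd v) c)"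

lemma ip_Suc: "ip (Suc d) u w = u 0 * w 0 + (\<Sum>c<d. u (Suc c) * w (Suc c))"
  unfolding ip_def by (rule sum.lessThan_Suc_shift)

lemma ip_vertex_vec:
  "ip (Suc d) (vertex_vec d v) (vertex_vec d w) = fst v * fst w +
    sqrt (1 - (fst v)\<^sup>2) * sqrt (1 - (fst w)\<^sup>2) * unitip d (snd v) (snd w)"
  by (simp add: ip_Suc vertex_vec_def unitip_def sum_distrib_left mult_ac)

lemma ip_axis_vertex_vec: "ip (Suc d) (axis_vec 0) (vertex_vec d v) = fst v"
  by (simp add: ip_Suc vertex_vec_def axis_vec_def)

lemma ip_axis_vec: "i < m \<Longrightarrow> ip m (axis_vec i) (axis_vec j) = of_bool (i = j)"
  by (simp add: ip_def axis_vec_def)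

lemma ip_perp_vertex_vec:
  assumes "\<bar>fst v\<bar> < 1" "\<bar>fst w\<bar> < 1"
  shows "ip (Suc d) (perp (Suc d) (axis_vec 0) (vertex_vec d v)) (perp (Suc d) (axis_vec 0) (vertex_vec d w)) = unitip d (snd v) (snd w)"
proof -
  have "(fst v)\<^sup>2 < 1" "(fst w)\<^sup>2 < 1" using assms by (simp_all add: abs_square_less_1)
  then show ?thesis
    by (simp add: ip_Suc perp_def ip_axis_vertex_vec) (simp add: vertex_vec_def axis_vec_def unitip_def)
qed

text \<open>The lower triangle inequality bounds \<open>bIJ - bi * bj\<close> strictly below by
  minus \<open>(1 - bi) * (1 - bj)\<close> or minus \<open>(1 + bi) * (1 + bj)\<close>, according to
  the sign of \<open>bi + bj\<close>. The product that occurs is the smaller of the two, hence at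
  most their geometric mean, and that mean is the denominator of \<open>rel_bias\<close>.\<close>

lemma strict_config:
  assumes "-1 + \<bar>bi + bj\<bar> < bIJ" "bIJ < 1 - \<bar>bi - bj\<bar>"
  shows "\<bar>bi\<bar> < 1" "\<bar>bj\<bar> < 1" "-1 < rel_bias (bi, bj, bIJ)"
    "rel_bias (bi, bj, bIJ) * (sqrt (1 - bi\<^sup>2) * sqrt (1 - bj\<^sup>2)) = bIJ - bi * bj"
proof -
  show b: "\<bar>bi\<bar> < 1" "\<bar>bj\<bar> < 1" using assms by linarith+
  have sq: "bi\<^sup>2 < 1" "bj\<^sup>2 < 1" using b by (simp_all add: abs_square_less_1)
  define S where "S = (1 - bi\<^sup>2) * (1 - bj\<^sup>2)"
  have S: "0 < S" using sq by (simp add: S_def)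
  have rb: "rel_bias (bi, bj, bIJ) = (bIJ - bi * bj) / sqrt S"
    using sq by (simp add: rel_bias_def S_def)
  show "rel_bias (bi, bj, bIJ) * (sqrt (1 - bi\<^sup>2) * sqrt (1 - bj\<^sup>2)) = bIJ - bi * bj"
  proof -
    have "sqrt (1 - bi\<^sup>2) * sqrt (1 - bj\<^sup>2) = sqrt S" by (simp add: S_def real_sqrt_mult)
    then show ?thesis unfolding rb using S by simp
  qed
  have key: "x * y \<le> sqrt ((x * x') * (y * y'))" if "0 \<le> x" "0 \<le> y" "0 \<le> x'" "0 \<le> y'" "x * y \<le> x' * y'" for x y x' y' :: real
  proof (rule real_le_rsqrt)
    have "(x * y) * (x * y) \<le> (x * y) * (x' * y')" using that by (intro mult_left_mono) auto
    then show "(x * y)\<^sup>2 \<le> (x * x') * (y * y')" by (simp add: power2_eq_square mult_ac)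
  qed
  have S': "S = ((1 - bi) * (1 + bi)) * ((1 - bj) * (1 + bj))" "S = ((1 + bi) * (1 - bi)) * ((1 + bj) * (1 - bj))"
    by (simp_all add: S_def algebra_simps power2_eq_square)
  have "- sqrt S < bIJ - bi * bj"
  proof (cases "0 \<le> bi + bj")
    case True
    have "(1 - bi) * (1 - bj) \<le> sqrt S"
      unfolding S'(1) using b True by (intro key) (auto simp: algebra_simps)
    moreover have "- ((1 - bi) * (1 - bj)) < bIJ - bi * bj" using assms True by (simp add: algebra_simps)
    ultimately show ?thesis by linarith
  next
    case False
    have "(1 + bi) * (1 + bj) \<le> sqrt S"
      unfolding S'(2) using b False by (intro key) (auto simp: algebra_simps)
    moreover have "- ((1 + bi) * (1 + bj)) < bIJ - bi * bj" using assms False by (simp add: algebra_simps)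
    ultimately show ?thesis by linarith
  qed
  then show "-1 < rel_bias (bi, bj, bIJ)"
    unfolding rb using S by (simp add: pos_less_divide_eq)
qed

text \<open>Mixing \<open>t\<close> with the constant \<open>- sgn s\<close> restores exact balance
  and moves each value by at most \<open>2 * \<delta>\<close>, hence each threshold by
  \<open>\<delta>\<close>. The linear terms change by \<open>2 * \<delta>\<close> and twice
  \<open>Gamma\<close>, 1-Lipschitz in each argument, by \<open>4 * \<delta>\<close>; this is the
  constant 6.\<close>

lemma soundness_perturb:
  assumes fin: "finite (set_pmf D)" and \<mu>: "set_pmf \<mu> \<subseteq> biases D"
    and r: "\<And>\<theta>. \<theta> \<in> set_pmf D \<Longrightarrow> (rel_bias \<theta>)\<^sup>2 < 1"
    and t: "\<And>b. b \<in> biases D \<Longrightarrow> t b \<in> {-1..1}" and bal: "\<bar>\<Sum>b\<in>biases D. pmf \<mu> b * t b\<bar> \<le> \<delta>"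
  shows "soundness_t D t \<le> soundness D \<mu> + 6 * \<delta>"
proof -
  have finB: "finite (biases D)" using fin by (simp add: biases_def)
  have \<mu>1: "(\<Sum>b\<in>biases D. pmf \<mu> b) = 1" using finB \<mu> by (rule sum_pmf_eq_1)
  define s where "s = (\<Sum>b\<in>biases D. pmf \<mu> b * t b)"
  \<comment> \<open>The mixing weight solves \<open>(1 - l) * s = l * sgn s\<close>, which cancels
    the imbalance.\<close>
  define l where "l = \<bar>s\<bar> / (1 + \<bar>s\<bar>)"
  have l: "0 \<le> l" "l \<le> \<delta>" "l < 1"
  proof -
    have "\<bar>s\<bar> / (1 + \<bar>s\<bar>) \<le> \<bar>s\<bar>" by (simp add: pos_divide_le_eq algebra_simps)
    then show "l \<le> \<delta>" using bal by (simp add: l_def s_def)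
  qed (simp_all add: l_def)
  define t' where "t' b = (1 - l) * t b + l * (- sgn s)" for b
  have tt: "t' b \<in> {-1..1}" "\<bar>t' b - t b\<bar> \<le> 2 * \<delta>" if "b \<in> biases D" for b
  proof -
    have tb: "\<bar>t b\<bar> \<le> 1" using t[OF that] by auto
    have "\<bar>t' b\<bar> \<le> (1 - l) * 1 + l * 1"
      unfolding t'_def using l tb
      by (intro order_trans[OF abs_triangle_ineq] add_mono) (auto simp: abs_mult sgn_if intro!: mult_left_le)
    then show "t' b \<in> {-1..1}" by auto
    have "t' b - t b = l * (- sgn s - t b)" by (simp add: t'_def algebra_simps)
    then have "\<bar>t' b - t b\<bar> = l * \<bar>- sgn s - t b\<bar>" using l by (simp add: abs_mult)
    also have "\<dots> \<le> \<delta> * 2" using l tb by (intro mult_mono) (auto simp: sgn_if)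
    finally show "\<bar>t' b - t b\<bar> \<le> 2 * \<delta>" by simp
  qed
  have "(\<Sum>b\<in>biases D. pmf \<mu> b * t' b) = (1 - l) * s + l * (- sgn s) * (\<Sum>b\<in>biases D. pmf \<mu> b)"
  proof -
    have "pmf \<mu> b * t' b = (1 - l) * (pmf \<mu> b * t b) + l * (- sgn s) * pmf \<mu> b" for b
      by (simp add: t'_def algebra_simps)
    then show ?thesis
      by (simp only: sum.distrib sum_distrib_left[symmetric] s_def[symmetric])
  qed
  also have "\<dots> = (s - sgn s * \<bar>s\<bar>) / (1 + \<bar>s\<bar>)"
  proof -
    have "1 - l = 1 / (1 + \<bar>s\<bar>)" by (simp add: l_def field_simps)
    then show ?thesis unfolding \<mu>1 by (simp add: l_def diff_divide_distrib mult_ac)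
  qed
  also have "\<dots> = 0" by (simp add: sgn_mult_abs)
  finally have bal': "(\<Sum>b\<in>biases D. pmf \<mu> b * t' b) = 0" .
  let ?G = "\<lambda>t \<theta>. case \<theta> of (bi, bj, bIJ) \<Rightarrow>
     ((1 - t bi) / 2 + (1 - t bj) / 2 - 2 * Gamma (rel_bias \<theta>) ((1 - t bi) / 2) ((1 - t bj) / 2))"
  \<comment> \<open>\<open>soundness\<close> is a \<open>Sup\<close> of reals, which dominates its
    members only once the set is known to be bounded.\<close>
  have bdd: "bdd_above {soundness_t D t | t. (\<forall>b\<in>biases D. t b \<in> {-1..1}) \<and> (\<Sum>b\<in>biases D. pmf \<mu> b * t b) = 0}"
  proof (rule bdd_aboveI[of _ 2], safe)
    fix t :: "real \<Rightarrow> real" assume t: "\<forall>b\<in>biases D. t b \<in> {-1..1}"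
    have "expect D (?G t) \<le> expect D (\<lambda>_. 2)"
    proof (rule expect_mono[OF fin])
      fix \<theta> assume \<theta>: "\<theta> \<in> set_pmf D"
      obtain bi bj bIJ where th: "\<theta> = (bi, bj, bIJ)" by (cases \<theta>)
      have "bi \<in> biases D" "bj \<in> biases D" using \<theta> by (force simp: biases_def th)+
      then have "t bi \<in> {-1..1}" "t bj \<in> {-1..1}" using t by blast+
      moreover define p q where "p = (1 - t bi) / 2" and "q = (1 - t bj) / 2"
      ultimately have "p \<le> 1" "q \<le> 1" by auto
      then have "p + q - 2 * Gamma (rel_bias \<theta>) p q \<le> 2"
        using Gamma_nonneg[of "rel_bias \<theta>" p q] by linarith
      then show "?G t \<theta> \<le> 2" by (simp add: th p_def q_def)
    qed
    then show "soundness_t D t \<le> 2" by (simp add: soundness_t_def)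
  qed
  have "soundness_t D t \<le> expect D (\<lambda>\<theta>. ?G t' \<theta> + 6 * \<delta>)"
    unfolding soundness_t_def
  proof (rule expect_mono[OF fin])
    fix \<theta> assume \<theta>: "\<theta> \<in> set_pmf D"
    obtain bi bj bIJ where th: "\<theta> = (bi, bj, bIJ)" by (cases \<theta>)
    have B: "bi \<in> biases D" "bj \<in> biases D" using \<theta> by (force simp: biases_def th)+
    define p where "p = (1 - t bi) / 2"
    define q where "q = (1 - t bj) / 2"
    define p' where "p' = (1 - t' bi) / 2"
    define q' where "q' = (1 - t' bj) / 2"
    have I: "p \<in> {0..1}" "q \<in> {0..1}" "p' \<in> {0..1}" "q' \<in> {0..1}"
      using t[OF B(1)] t[OF B(2)] tt(1)[OF B(1)] tt(1)[OF B(2)] by (auto simp: p_def q_def p'_def q'_def)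
    have d: "\<bar>p' - p\<bar> \<le> \<delta>" "\<bar>q' - q\<bar> \<le> \<delta>"
    proof -
      have "p' - p = (t bi - t' bi) / 2" "q' - q = (t bj - t' bj) / 2"
        by (simp_all add: p_def q_def p'_def q'_def field_simps)
      then show "\<bar>p' - p\<bar> \<le> \<delta>" "\<bar>q' - q\<bar> \<le> \<delta>"
        using tt(2)[OF B(1)] tt(2)[OF B(2)] by (simp_all add: abs_minus_commute)
    qed
    have "\<bar>Gamma (rel_bias \<theta>) p' q' - Gamma (rel_bias \<theta>) p q\<bar> \<le> \<bar>p' - p\<bar> + \<bar>q' - q\<bar>"
      by (rule Gamma_lipschitz[OF r[OF \<theta>] I(1,3,2,4)])
    then have "p + q - 2 * Gamma (rel_bias \<theta>) p q \<le> p' + q' - 2 * Gamma (rel_bias \<theta>) p' q' + 6 * \<delta>"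
      using d by linarith
    then show "?G t \<theta> \<le> ?G t' \<theta> + 6 * \<delta>"
      by (simp add: th p_def q_def p'_def q'_def)
  qed
  also have "\<dots> = soundness_t D t' + 6 * \<delta>"
    using fin by (simp add: expect_add soundness_t_def)
  also have "soundness_t D t' \<le> soundness D \<mu>"
    unfolding soundness_def by (rule cSup_upper[OF _ bdd]) (use tt bal' in blast)
  finally show ?thesis by simp
qed

section \<open>Assembly of the graph and choice of the parameters\<close>

lemma finite_uniform_threshold:
  assumes "finite S" "\<And>x. x \<in> S \<Longrightarrow> \<exists>n0::nat. \<forall>n\<ge>n0. P x n"
  shows "\<exists>n0. \<forall>n\<ge>n0. \<forall>x\<in>S. P x n"
  using eventually_ball_finite[of S "\<lambda>n x. P x n" sequentially] assms
  by (simp add: eventually_sequentially)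

text \<open>Here \<open>R\<close>, \<open>k\<close> and \<open>d\<close> are frozen and the analysis
  enters through \<open>conc\<close>, \<open>unc\<close> and \<open>borell\<close>; the rest is
  finite accounting. Discarding pairs costs completeness but can only lower a cut.\<close>

lemma blueprint_graph:
  fixes D :: "config pmf" and \<mu> :: "real pmf" and R k d n :: nat
  assumes bp: "is_blueprint D \<mu>"
    and strict: "\<And>bi bj bIJ. (bi, bj, bIJ) \<in> set_pmf D \<Longrightarrow> -1 + \<bar>bi + bj\<bar> + \<tau> \<le> bIJ \<and> bIJ \<le> 1 - \<bar>bi - bj\<bar> - \<tau>"
    and neg: "\<And>\<theta>. \<theta> \<in> set_pmf D \<Longrightarrow> rel_bias \<theta> \<le> 0"
    and \<tau>: "0 < \<tau>" "\<tau> < 1" and R: "0 < R" and d: "0 < d"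
    and conc: "\<And>\<theta>. \<theta> \<in> set_pmf D \<Longrightarrow> expect (power_pair d (coord (rel_bias \<theta>) k R))
       (\<lambda>z. of_bool (\<not> \<bar>unitip d (fst z) (snd z) - rel_bias \<theta>\<bar> \<le> \<tau>)) \<le> \<tau>"
    and unc: "expect (state k R d) (\<lambda>X. expect (state k R d) (\<lambda>Y. \<bar>unitip d X Y\<bar>)) \<le> \<tau>"
    and borell: "\<And>\<theta> f g. \<theta> \<in> set_pmf D \<Longrightarrow> \<forall>x. f x \<in> {0..1} \<Longrightarrow> \<forall>y. g y \<in> {0..1} \<Longrightarrow> 
      Gamma (rel_bias \<theta>) (expect (power_pair d (coord (rel_bias \<theta>) k R)) (\<lambda>p. f (fst p)))
        (expect (power_pair d (coord (rel_bias \<theta>) k R)) (\<lambda>p. g (snd p))) - \<epsilon>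
      \<le> expect (power_pair d (coord (rel_bias \<theta>) k R)) (\<lambda>p. f (fst p) * g (snd p))"
    and n: "card (biases D \<times> set_pmf (state k R d)) \<le> n"
  shows "\<exists>E wV wE. is_weighted_graph n E wV wE \<and>
      (\<exists>m v. uncorr_bisection_solution m n wV \<tau> v \<and> triangle_on_edges m E v \<and>
         (\<Sum>(i, j)\<in>E. wE (i, j) * (1 - ip m (v i) (v j)) / 2) \<ge> completeness D - 2 * \<tau>) \<and>
      (\<forall>\<delta>\<ge>0. \<forall>A\<subseteq>{1..n}.
         \<bar>(\<Sum>i\<in>A. wV i) - (\<Sum>i\<in>{1..n} - A. wV i)\<bar> \<le> \<delta> * (\<Sum>i\<in>{1..n}. wV i) \<longrightarrow>
         cut_weight E wE A \<le> soundness D \<mu> + 6 * \<delta> + 2 * \<epsilon>)"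
proof -
  have fin: "finite (set_pmf D)" and cfg: "\<And>\<theta>. \<theta> \<in> set_pmf D \<Longrightarrow> is_config \<theta>"
    and \<mu>: "set_pmf \<mu> \<subseteq> biases D" and \<mu>0: "(\<Sum>b\<in>biases D. pmf \<mu> b * b) = 0"
    using bp by (auto simp: is_blueprint_def)
  have finB: "finite (biases D)" using fin by (simp add: biases_def)
  have \<mu>1: "(\<Sum>b\<in>biases D. pmf \<mu> b) = 1" using finB \<mu> by (rule sum_pmf_eq_1)
  have strict': "-1 + \<bar>bi + bj\<bar> < bIJ" "bIJ < 1 - \<bar>bi - bj\<bar>" if "(bi, bj, bIJ) \<in> set_pmf D" for bi bj bIJ
    using strict[OF that] \<tau> by linarith+
  have r1: "-1 < rel_bias \<theta>" if "\<theta> \<in> set_pmf D" for \<theta>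
    using that strict_config(3)[OF strict'] by (cases \<theta>) auto
  have B1: "\<bar>b\<bar> < 1" if "b \<in> biases D" for b
    using that strict_config(1,2)[OF strict'] by (force simp: biases_def)
  define Q where "Q = state k R d"
  define P where "P \<theta> = power_pair d (coord (rel_bias \<theta>) k R)" for \<theta>
  have finQ: "finite (set_pmf Q)" using R by (simp add: Q_def finite_state)
  have finP: "finite (set_pmf (P \<theta>))" for \<theta> using R by (simp add: P_def finite_power_pair)
  have mapP: "map_pmf fst (P \<theta>) = Q" "map_pmf snd (P \<theta>) = Q" if "\<theta> \<in> set_pmf D" for \<theta>
    unfolding P_def Q_def using map_power_pair_coord[OF r1[OF that] neg[OF that]] by auto
  have expP: "expect (P \<theta>) (\<lambda>z. f (fst z)) = expect Q f" "expect (P \<theta>) (\<lambda>z. f (snd z)) = expect Q f"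
    if "\<theta> \<in> set_pmf D" for \<theta> f
    using arg_cong[OF mapP(1)[OF that], of "\<lambda>q. expect q f"] arg_cong[OF mapP(2)[OF that], of "\<lambda>q. expect q f"] by simp_all
  define close where "close \<theta> z \<longleftrightarrow> \<bar>unitip d (fst z) (snd z) - rel_bias \<theta>\<bar> \<le> \<tau>" for \<theta> z
  define V where "V = biases D \<times> set_pmf Q"
  define \<Omega> where "\<Omega> = Sigma (set_pmf D) (\<lambda>\<theta>. {z \<in> set_pmf (P \<theta>). close \<theta> z})"
  define src where "src = (\<lambda>(\<theta> :: config, z :: (nat \<Rightarrow> int) \<times> (nat \<Rightarrow> int)). (fst \<theta>, fst z))"
  define tgt where "tgt = (\<lambda>(\<theta> :: config, z :: (nat \<Rightarrow> int) \<times> (nat \<Rightarrow> int)). (fst (snd \<theta>), snd z))"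
  define c where "c = (\<lambda>(\<theta>, z). pmf D \<theta> * pmf (P \<theta>) z)"
  define wv where "wv = (\<lambda>(b, X). pmf \<mu> b * pmf Q X)"
  have finV: "finite V" using finB finQ by (simp add: V_def)
  have fin\<Omega>: "finite \<Omega>" unfolding \<Omega>_def using fin finP by (intro finite_SigmaI) auto
  have srctgt: "src \<omega> \<in> V \<and> tgt \<omega> \<in> V \<and> src \<omega> \<noteq> tgt \<omega>" if "\<omega> \<in> \<Omega>" for \<omega>
  proof -
    obtain \<theta> z where w: "\<omega> = (\<theta>, z)" by (cases \<omega>)
    have \<theta>: "\<theta> \<in> set_pmf D" and z: "z \<in> set_pmf (P \<theta>)" "close \<theta> z" using that by (auto simp: \<Omega>_def w)
    have "fst z \<in> set_pmf Q" "snd z \<in> set_pmf Q"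
      using z(1) mapP[OF \<theta>] by (metis imageI pmf.set_map)+
    \<comment> \<open>A common lattice point would have normalized inner product 1, farther than
      \<open>\<tau> < 1\<close> from the nonpositive \<open>rel_bias \<theta>\<close>. This excludes
      loops even when the two biases coincide.\<close>
    moreover have "fst z \<noteq> snd z"
    proof
      assume "fst z = snd z"
      then have "\<bar>1 - rel_bias \<theta>\<bar> \<le> \<tau>" using z(2) unitip_self[OF d, of "snd z"] by (simp add: close_def)
      then show False using neg[OF \<theta>] \<tau> by linarith
    qed
    ultimately show ?thesis using \<theta> by (auto simp: w src_def tgt_def V_def biases_def)
  qed
  have Vsum: "(\<Sum>v\<in>V. wv v * F v) = (\<Sum>b\<in>biases D. pmf \<mu> b * expect Q (\<lambda>X. F (b, X)))" for F
  proof -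
    have "(\<Sum>v\<in>V. wv v * F v) = (\<Sum>b\<in>biases D. \<Sum>X\<in>set_pmf Q. pmf \<mu> b * pmf Q X * F (b, X))"
      unfolding V_def wv_def sum.cartesian_product by (simp add: case_prod_beta')
    then show ?thesis by (simp add: expect_sum[OF finQ] sum_distrib_left mult_ac)
  qed
  have \<Omega>sum: "(\<Sum>\<omega>\<in>\<Omega>. c \<omega> * F \<omega>) = (\<Sum>\<theta>\<in>set_pmf D. pmf D \<theta> * expect (P \<theta>) (\<lambda>z. of_bool (close \<theta> z) * F (\<theta>, z)))" for F
  proof -
    have "(\<Sum>\<omega>\<in>\<Omega>. c \<omega> * F \<omega>) = (\<Sum>\<theta>\<in>set_pmf D. \<Sum>z\<in>{z \<in> set_pmf (P \<theta>). close \<theta> z}. pmf D \<theta> * pmf (P \<theta>) z * F (\<theta>, z))"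
      unfolding \<Omega>_def c_def using fin finP by (subst sum.Sigma) (auto simp: case_prod_beta')
    also have "\<dots> = (\<Sum>\<theta>\<in>set_pmf D. \<Sum>z\<in>set_pmf (P \<theta>). pmf D \<theta> * pmf (P \<theta>) z * (of_bool (close \<theta> z) * F (\<theta>, z)))"
      using finP by (intro sum.cong refl sum.mono_neutral_cong_left) auto
    finally show ?thesis by (simp add: expect_sum[OF finP] sum_distrib_left mult_ac)
  qed
  obtain idx E wV wE where idx: "inj_on idx V" "idx ` V \<subseteq> {1..n}" and graph: "is_weighted_graph n E wV wE"
    and wV: "\<And>F. (\<Sum>i=1..n. wV i * F i) = (\<Sum>v\<in>V. wv v * F (idx v))"
    and wE: "\<And>F. (\<And>i j. F i j = F j i) \<Longrightarrow> (\<Sum>(i, j)\<in>E. wE (i, j) * F i j) = (\<Sum>\<omega>\<in>\<Omega>. c \<omega> * F (idx (src \<omega>)) (idx (tgt \<omega>)))"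
    and edge: "\<And>i j. (i, j) \<in> E \<Longrightarrow> \<exists>\<omega>\<in>\<Omega>. (i, j) = (idx (src \<omega>), idx (tgt \<omega>)) \<or> (i, j) = (idx (tgt \<omega>), idx (src \<omega>))"
    and finE: "finite E"
    by (rule weighted_pairs_graph[OF finV n[folded Q_def V_def] fin\<Omega>, of src tgt c wv])
       (use srctgt in \<open>auto simp: c_def wv_def\<close>)
  \<comment> \<open>Padding vertices need a unit vector whose inner product with \<open>v 0\<close>
    is neither 1 nor -1; the next axis, present because \<open>d > 0\<close>, is orthogonal to
    it.\<close>
  define vec where "vec i = (if i = 0 then axis_vec 0 else if i \<in> idx ` V then vertex_vec d (inv_into V idx i) else axis_vec 1)" for i
  have vec0: "vec 0 = axis_vec 0" by (simp add: vec_def)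
  have vecV: "vec (idx v) = vertex_vec d v" if "v \<in> V" for v
  proof -
    have "idx v \<noteq> 0" using idx(2) that by fastforce
    then show ?thesis using that idx(1) by (simp add: vec_def inv_into_f_f)
  qed
  have veci: "(\<exists>v\<in>V. vec i = vertex_vec d v) \<or> vec i = axis_vec 1" if "i \<in> {1..n}" for i
  proof (cases "i \<in> idx ` V")
    case True
    then show ?thesis using vecV by blast
  next
    case False
    then show ?thesis using that by (simp add: vec_def)
  qed
  have wVsum: "(\<Sum>i=1..n. wV i) = 1"
    using wV[of "\<lambda>_. 1"] Vsum[of "\<lambda>_. 1"] \<mu>1 by simp
  \<comment> \<open>The normalized inner product enters with the factor \<open>q \<le> 1\<close>, so
    a deviation \<open>\<tau>\<close> there costs at most \<open>\<tau>\<close> in the full inner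
    product, which is the slack in \<open>strict\<close>.\<close>
  have close_ip: "\<bar>ip (Suc d) (vertex_vec d (src (\<theta>, z))) (vertex_vec d (tgt (\<theta>, z))) - snd (snd \<theta>)\<bar> \<le> \<tau>"
    if "\<theta> \<in> set_pmf D" "close \<theta> z" for \<theta> z
  proof -
    obtain bi bj bIJ where th: "\<theta> = (bi, bj, bIJ)" by (cases \<theta>)
    define q where "q = sqrt (1 - bi\<^sup>2) * sqrt (1 - bj\<^sup>2)"
    have q: "rel_bias \<theta> * q = bIJ - bi * bj"
      unfolding th q_def by (rule strict_config(4)[OF strict']) (use that th in auto)
    have q1: "0 \<le> q" "q \<le> 1"
    proof -
      have "bi\<^sup>2 \<le> 1" "bj\<^sup>2 \<le> 1" using strict_config(1,2)[OF strict', of bi bj bIJ] that th by (auto simp: abs_square_le_1)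
      then show "0 \<le> q" "q \<le> 1" unfolding q_def by (auto intro!: mult_le_one)
    qed
    have "ip (Suc d) (vertex_vec d (src (\<theta>, z))) (vertex_vec d (tgt (\<theta>, z))) - bIJ = q * (unitip d (fst z) (snd z) - rel_bias \<theta>)"
      using q by (simp add: ip_vertex_vec src_def tgt_def th q_def algebra_simps)
    also have "\<bar>\<dots>\<bar> \<le> 1 * \<tau>"
      unfolding abs_mult using q1 that by (intro mult_mono) (auto simp: close_def)
    finally show ?thesis by (simp add: th)
  qed
  have uncorr: "uncorr_bisection_solution (Suc d) n wV \<tau> vec"
    unfolding uncorr_bisection_solution_def
  proof (intro conjI ballI)
    show "ip (Suc d) (vec i) (vec i) = 1" if "i \<in> {0..n}" for i
    proof (cases "i = 0")
      case True
      then show ?thesis by (simp add: vec0 ip_axis_vec)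
    next
      case False
      then consider v where "v \<in> V" "vec i = vertex_vec d v" | "vec i = axis_vec 1"
        using veci[of i] \<open>i \<in> {0..n}\<close> by auto
      then show ?thesis
      proof cases
        case 1
        then have "(fst v)\<^sup>2 \<le> 1" using B1 by (auto simp: V_def abs_square_le_1 less_imp_le)
        then show ?thesis by (simp add: 1 ip_vertex_vec unitip_self[OF d] power2_eq_square[symmetric])
      qed (use d in \<open>simp add: ip_axis_vec\<close>)
    qed
    show "\<bar>ip (Suc d) (vec 0) (vec i)\<bar> \<noteq> 1" if "i \<in> {1..n}" for i
      using veci[OF that] B1 unfolding vec0 by (force simp: ip_axis_vec ip_axis_vertex_vec V_def)
    have "(\<Sum>i=1..n. wV i * ip (Suc d) (vec 0) (vec i)) = (\<Sum>v\<in>V. wv v * fst v)"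
      unfolding wV by (intro sum.cong) (auto simp: vecV vec0 ip_axis_vertex_vec)
    also have "\<dots> = 0" unfolding Vsum using \<mu>0 by simp
    finally show "(\<Sum>i=1..n. wV i * ip (Suc d) (vec 0) (vec i)) = 0" .
    define U where "U i j = \<bar>ip (Suc d) (perp (Suc d) (vec 0) (vec i)) (perp (Suc d) (vec 0) (vec j))\<bar>" for i j
    have U: "U (idx v) (idx w) = \<bar>unitip d (snd v) (snd w)\<bar>" if "v \<in> V" "w \<in> V" for v w
      unfolding U_def using that B1 by (simp add: vec0 vecV ip_perp_vertex_vec V_def mem_Times_iff)
    have "(\<Sum>i=1..n. \<Sum>j=1..n. wV i * wV j * U i j) = (\<Sum>i=1..n. wV i * (\<Sum>j=1..n. wV j * U i j))"
      by (simp add: sum_distrib_left mult_ac)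
    also have "\<dots> = (\<Sum>v\<in>V. wv v * (\<Sum>w\<in>V. wv w * U (idx v) (idx w)))"
      unfolding wV ..
    also have "\<dots> = (\<Sum>v\<in>V. wv v * (\<Sum>w\<in>V. wv w * \<bar>unitip d (snd v) (snd w)\<bar>))"
      using U by simp
    also have "\<dots> = expect Q (\<lambda>X. expect Q (\<lambda>Y. \<bar>unitip d X Y\<bar>))"
      by (simp add: Vsum sum_distrib_right[symmetric] \<mu>1)
    also have "\<dots> \<le> \<tau>" using unc by (simp add: Q_def)
    finally show "(1 / (\<Sum>i=1..n. wV i)\<^sup>2) * (\<Sum>i=1..n. \<Sum>j=1..n.
          wV i * wV j * \<bar>ip (Suc d) (perp (Suc d) (vec 0) (vec i)) (perp (Suc d) (vec 0) (vec j))\<bar>) \<le> \<tau>"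
      unfolding wVsum U_def by simp
  qed
  have tri: "triangle_on_edges (Suc d) E vec"
    unfolding triangle_on_edges_def
  proof safe
    fix i j assume "(i, j) \<in> E"
    then obtain \<omega> where w: "\<omega> \<in> \<Omega>" "(i, j) = (idx (src \<omega>), idx (tgt \<omega>)) \<or> (i, j) = (idx (tgt \<omega>), idx (src \<omega>))"
      using edge by blast
    obtain \<theta> z where wz: "\<omega> = (\<theta>, z)" by (cases \<omega>)
    obtain bi bj bIJ where th: "\<theta> = (bi, bj, bIJ)" by (cases \<theta>)
    define I where "I = ip (Suc d) (vertex_vec d (src \<omega>)) (vertex_vec d (tgt \<omega>))"
    have \<theta>: "\<theta> \<in> set_pmf D" "close \<theta> z" using w(1) by (auto simp: \<Omega>_def wz)
    then have cl: "\<bar>I - bIJ\<bar> \<le> \<tau>" using close_ip[OF \<theta>] by (simp add: I_def wz th)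
    have "ip (Suc d) (vertex_vec d (tgt \<omega>)) (vertex_vec d (src \<omega>)) = I"
      by (simp add: I_def ip_def mult.commute)
    moreover have "fst (src \<omega>) = bi" "fst (tgt \<omega>) = bj" by (simp_all add: src_def tgt_def wz th)
    moreover have "-1 + \<bar>bi + bj\<bar> \<le> I" "I \<le> 1 - \<bar>bi - bj\<bar>"
      using strict[OF \<theta>(1)[unfolded th]] cl by linarith+
    ultimately show "-1 + \<bar>ip (Suc d) (vec 0) (vec i) + ip (Suc d) (vec 0) (vec j)\<bar> \<le> ip (Suc d) (vec i) (vec j)"
      "ip (Suc d) (vec i) (vec j) \<le> 1 - \<bar>ip (Suc d) (vec 0) (vec i) - ip (Suc d) (vec 0) (vec j)\<bar>"
      using w(2) srctgt[OF w(1)]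
      by (auto simp: vec0 vecV ip_axis_vertex_vec I_def[symmetric] add.commute abs_minus_commute)
  qed
  have compl: "completeness D - 2 * \<tau> \<le> (\<Sum>(i, j)\<in>E. wE (i, j) * (1 - ip (Suc d) (vec i) (vec j)) / 2)"
  proof -
    have "completeness D - 2 * \<tau> = expect D (\<lambda>\<theta>. (1 - snd (snd \<theta>)) / 2 - 2 * \<tau>)"
      using fin by (simp add: completeness_def case_prod_beta' expect_diff)
    also have "\<dots> = (\<Sum>\<theta>\<in>set_pmf D. pmf D \<theta> * ((1 - snd (snd \<theta>)) / 2 - 2 * \<tau>))"
      by (rule expect_sum[OF fin])
    also have "\<dots> \<le> (\<Sum>\<theta>\<in>set_pmf D. pmf D \<theta> * expect (P \<theta>) (\<lambda>z. of_bool (close \<theta> z) *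
      ((1 - ip (Suc d) (vertex_vec d (src (\<theta>, z))) (vertex_vec d (tgt (\<theta>, z)))) / 2)))"
    proof (intro sum_mono mult_left_mono pmf_nonneg)
      fix \<theta> assume \<theta>: "\<theta> \<in> set_pmf D"
      define q where "q = (1 - snd (snd \<theta>)) / 2"
      have q: "q \<le> 1" using cfg[OF \<theta>] by (auto simp: q_def is_config_def split: prod.splits)
      \<comment> \<open>The loss is \<open>\<tau> / 2\<close> from deviating inner products plus the
        discarded mass, at most \<open>\<tau>\<close>, on which no more than
        \<open>q \<le> 1\<close> is forgone.\<close>
      have "q - 2 * \<tau> \<le> (q - \<tau> / 2) - expect (P \<theta>) (\<lambda>z. of_bool (\<not> close \<theta> z))"
        using conc[OF \<theta>] \<tau> unfolding P_def close_def by linarith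
      also have "\<dots> = expect (P \<theta>) (\<lambda>z. (q - \<tau> / 2) - of_bool (\<not> close \<theta> z))"
        using finP by (simp add: expect_diff)
      also have "\<dots> \<le> expect (P \<theta>) (\<lambda>z. of_bool (close \<theta> z) *
        ((1 - ip (Suc d) (vertex_vec d (src (\<theta>, z))) (vertex_vec d (tgt (\<theta>, z)))) / 2))"
      proof (rule expect_mono[OF finP])
        fix z
        show "(q - \<tau> / 2) - of_bool (\<not> close \<theta> z) \<le> of_bool (close \<theta> z) *
          ((1 - ip (Suc d) (vertex_vec d (src (\<theta>, z))) (vertex_vec d (tgt (\<theta>, z)))) / 2)"
          using close_ip[OF \<theta>, of z] q \<tau> by (cases "close \<theta> z") (auto simp: q_def abs_le_iff field_simps)
      qed
      finally show "(1 - snd (snd \<theta>)) / 2 - 2 * \<tau> \<le> expect (P \<theta>) (\<lambda>z. of_bool (close \<theta> z) *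
        ((1 - ip (Suc d) (vertex_vec d (src (\<theta>, z))) (vertex_vec d (tgt (\<theta>, z)))) / 2))"
        by (simp add: q_def)
    qed
    also have "\<dots> = (\<Sum>\<omega>\<in>\<Omega>. c \<omega> * ((1 - ip (Suc d) (vertex_vec d (src \<omega>)) (vertex_vec d (tgt \<omega>))) / 2))"
      unfolding \<Omega>sum ..
    also have "\<dots> = (\<Sum>\<omega>\<in>\<Omega>. c \<omega> * ((1 - ip (Suc d) (vec (idx (src \<omega>))) (vec (idx (tgt \<omega>)))) / 2))"
      using srctgt by (simp add: vecV)
    also have "\<dots> = (\<Sum>(i, j)\<in>E. wE (i, j) * ((1 - ip (Suc d) (vec i) (vec j)) / 2))"
      by (rule wE[symmetric]) (simp add: ip_def mult.commute)
    finally show ?thesis by simp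
  qed
  have sound: "cut_weight E wE A \<le> soundness D \<mu> + 6 * \<delta> + 2 * \<epsilon>"
    if A: "A \<subseteq> {1..n}" and bal: "\<bar>(\<Sum>i\<in>A. wV i) - (\<Sum>i\<in>{1..n} - A. wV i)\<bar> \<le> \<delta> * (\<Sum>i\<in>{1..n}. wV i)" for A \<delta>
  proof -
    define f where "f b X = (of_bool (idx (b, X) \<in> A) :: real)" for b X
    define q where "q b = expect Q (f b)" for b
    \<comment> \<open>Makes \<open>(1 - t b) / 2\<close> the density of \<open>A\<close> among the
      vertices of bias \<open>b\<close>; the imbalance of \<open>A\<close> becomes, up to sign, the
      \<open>\<mu>\<close>-mean of \<open>t\<close>.\<close>
    define t where "t b = 1 - 2 * q b" for b
    have f01: "f b X \<in> {0..1}" for b X by (simp add: f_def)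
    have q01: "q b \<in> {0..1}" for b unfolding q_def using finQ f01 by (intro expect_Icc)
    have qt: "(1 - t b) / 2 = q b" for b by (simp add: t_def)
    have "(\<Sum>i\<in>A. wV i) - (\<Sum>i\<in>{1..n} - A. wV i) = (\<Sum>i=1..n. wV i * (2 * of_bool (i \<in> A) - 1))"
    proof -
      have "(\<Sum>i=1..n. wV i * (2 * of_bool (i \<in> A) - 1)) =
        (\<Sum>i\<in>{1..n} - A. wV i * (2 * of_bool (i \<in> A) - 1)) + (\<Sum>i\<in>A. wV i * (2 * of_bool (i \<in> A) - 1))"
        using A by (intro sum.subset_diff) auto
      then show ?thesis by (simp add: sum_negf)
    qed
    also have "\<dots> = (\<Sum>b\<in>biases D. pmf \<mu> b * expect Q (\<lambda>X. 2 * f b X - 1))"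
      unfolding wV Vsum f_def ..
    also have "\<dots> = (\<Sum>b\<in>biases D. - (pmf \<mu> b * t b))"
      using finQ by (simp add: expect_diff t_def q_def algebra_simps)
    finally have "\<bar>\<Sum>b\<in>biases D. pmf \<mu> b * t b\<bar> \<le> \<delta>"
      using bal wVsum by (simp add: sum_negf)
    then have pert: "soundness_t D t \<le> soundness D \<mu> + 6 * \<delta>"
      by (intro soundness_perturb[OF fin \<mu>])
         (use r1 neg q01 in \<open>fastforce simp: power2_less_1_iff t_def\<close>)+
    have "cut_weight E wE A = (\<Sum>(i, j)\<in>E. wE (i, j) * of_bool ((i \<in> A) \<noteq> (j \<in> A)))"
      by (rule cut_weight_eq[OF finE])
    also have "\<dots> = (\<Sum>\<omega>\<in>\<Omega>. c \<omega> * of_bool ((idx (src \<omega>) \<in> A) \<noteq> (idx (tgt \<omega>) \<in> A)))"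
      by (rule wE) auto
    also have "\<dots> = (\<Sum>\<theta>\<in>set_pmf D. pmf D \<theta> * expect (P \<theta>) (\<lambda>z. of_bool (close \<theta> z) *
       of_bool ((idx (src (\<theta>, z)) \<in> A) \<noteq> (idx (tgt (\<theta>, z)) \<in> A))))"
      unfolding \<Omega>sum ..
    also have "\<dots> \<le> (\<Sum>\<theta>\<in>set_pmf D. pmf D \<theta> * ((case \<theta> of (bi, bj, bIJ) \<Rightarrow>
     ((1 - t bi) / 2 + (1 - t bj) / 2 - 2 * Gamma (rel_bias \<theta>) ((1 - t bi) / 2) ((1 - t bj) / 2))) + 2 * \<epsilon>))"
    proof (intro sum_mono mult_left_mono pmf_nonneg)
      fix \<theta> assume \<theta>: "\<theta> \<in> set_pmf D"
      define bi bj where "bi = fst \<theta>" and "bj = fst (snd \<theta>)"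
      \<comment> \<open>For indicator values, \<open>f + g - 2 * f * g\<close> is 1 exactly when the
        pair is separated; dropping the factor \<open>close\<close> only increases the left
        side.\<close>
      have "expect (P \<theta>) (\<lambda>z. of_bool (close \<theta> z) * of_bool ((idx (src (\<theta>, z)) \<in> A) \<noteq> (idx (tgt (\<theta>, z)) \<in> A))) \<le>
        expect (P \<theta>) (\<lambda>z. (f bi (fst z) + f bj (snd z)) - 2 * (f bi (fst z) * f bj (snd z)))"
        by (rule expect_mono[OF finP]) (auto simp: f_def bi_def bj_def src_def tgt_def)
      also have "\<dots> = q bi + q bj - 2 * expect (P \<theta>) (\<lambda>z. f bi (fst z) * f bj (snd z))"
        using finP by (simp add: expect_diff expect_add expP[OF \<theta>] q_def)
      also have "\<dots> \<le> q bi + q bj - 2 * (Gamma (rel_bias \<theta>) (q bi) (q bj) - \<epsilon>)"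
        using borell[OF \<theta>, of "f bi" "f bj"] f01 by (simp add: P_def[symmetric] expP[OF \<theta>] q_def)
      finally show "expect (P \<theta>) (\<lambda>z. of_bool (close \<theta> z) * of_bool ((idx (src (\<theta>, z)) \<in> A) \<noteq> (idx (tgt (\<theta>, z)) \<in> A))) \<le>
        (case \<theta> of (bi, bj, bIJ) \<Rightarrow>
     ((1 - t bi) / 2 + (1 - t bj) / 2 - 2 * Gamma (rel_bias \<theta>) ((1 - t bi) / 2) ((1 - t bj) / 2))) + 2 * \<epsilon>"
        by (simp add: qt bi_def bj_def case_prod_beta')
    qed
    also have "\<dots> = soundness_t D t + 2 * \<epsilon>"
      unfolding soundness_t_def using fin by (simp add: expect_sum[symmetric] expect_add)
    finally show ?thesis using pert by simp
  qed
  show ?thesis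
    using graph uncorr tri compl sound by blast
qed

theorem theorem3p7:
  fixes D :: "config pmf" and \<mu> :: "real pmf"
  assumes "positive_blueprint D \<mu>"
    and "\<forall>(bi, bj, bIJ)\<in>set_pmf D. -1 + \<bar>bi + bj\<bar> < bIJ \<and> bIJ < 1 - \<bar>bi - bj\<bar>"
  shows "\<exists>C>0. \<exists>\<epsilon>0>0. \<forall>\<epsilon>. 0 < \<epsilon> \<and> \<epsilon> < \<epsilon>0 \<longrightarrow>
    (\<exists>N::nat. \<forall>n\<ge>N. \<exists>E wV wE. is_weighted_graph n E wV wE \<and>
      (\<exists>m v. uncorr_bisection_solution m n wV (C * \<epsilon>) v \<and> triangle_on_edges m E v \<and>
         (\<Sum>(i, j)\<in>E. wE (i, j) * (1 - ip m (v i) (v j)) / 2) \<ge> completeness D - C * \<epsilon>) \<and>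
      (\<forall>\<delta>\<ge>0. \<forall>A\<subseteq>{1..n}.
         \<bar>(\<Sum>i\<in>A. wV i) - (\<Sum>i\<in>{1..n} - A. wV i)\<bar> \<le> \<delta> * (\<Sum>i\<in>{1..n}. wV i) \<longrightarrow>
         cut_weight E wE A \<le> soundness D \<mu> + C * \<delta> + C * \<epsilon>))"
proof -
  have bp: "is_blueprint D \<mu>" and neg: "\<And>\<theta>. \<theta> \<in> set_pmf D \<Longrightarrow> rel_bias \<theta> \<le> 0"
    using assms(1) by (auto simp: positive_blueprint_def positive_config_def)
  have fin: "finite (set_pmf D)" using bp by (simp add: is_blueprint_def)
  have strict: "-1 + \<bar>bi + bj\<bar> < bIJ" "bIJ < 1 - \<bar>bi - bj\<bar>" if "(bi, bj, bIJ) \<in> set_pmf D" for bi bj bIJ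
    using assms(2) that by blast+
  have r1: "-1 < rel_bias \<theta>" if "\<theta> \<in> set_pmf D" for \<theta>
    using that strict_config(3)[OF strict] by (cases \<theta>) auto
  \<comment> \<open>The smaller slack of the two triangle inequalities; finiteness of the support
    makes its minimum positive.\<close>
  define gap where "gap = (\<lambda>(bi, bj, bIJ). min (bIJ + 1 - \<bar>bi + bj\<bar>) (1 - \<bar>bi - bj\<bar> - bIJ) :: real)"
  define \<tau>0 where "\<tau>0 = Min (gap ` set_pmf D)"
  have \<tau>0: "0 < \<tau>0"
  proof -
    have "0 < gap \<theta>" if "\<theta> \<in> set_pmf D" for \<theta>
    proof -
      obtain bi bj bIJ where "\<theta> = (bi, bj, bIJ)" by (cases \<theta>)
      then show ?thesis using strict[of bi bj bIJ] that by (simp add: gap_def)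
    qed
    then show ?thesis
      unfolding \<tau>0_def using fin by (subst Min_gr_iff) (auto simp: set_pmf_not_empty)
  qed
  have gap: "\<tau>0 \<le> bIJ + 1 - \<bar>bi + bj\<bar>" "\<tau>0 \<le> 1 - \<bar>bi - bj\<bar> - bIJ" if "(bi, bj, bIJ) \<in> set_pmf D" for bi bj bIJ
  proof -
    have "\<tau>0 \<le> gap (bi, bj, bIJ)" unfolding \<tau>0_def using fin that by (intro Min_le) auto
    then show "\<tau>0 \<le> bIJ + 1 - \<bar>bi + bj\<bar>" "\<tau>0 \<le> 1 - \<bar>bi - bj\<bar> - bIJ" by (simp_all add: gap_def)
  qed
  have main: "\<exists>N::nat. \<forall>n\<ge>N. \<exists>E wV wE. is_weighted_graph n E wV wE \<and>
      (\<exists>m v. uncorr_bisection_solution m n wV (6 * \<epsilon>) v \<and> triangle_on_edges m E v \<and>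
         (\<Sum>(i, j)\<in>E. wE (i, j) * (1 - ip m (v i) (v j)) / 2) \<ge> completeness D - 6 * \<epsilon>) \<and>
      (\<forall>\<delta>\<ge>0. \<forall>A\<subseteq>{1..n}.
         \<bar>(\<Sum>i\<in>A. wV i) - (\<Sum>i\<in>{1..n} - A. wV i)\<bar> \<le> \<delta> * (\<Sum>i\<in>{1..n}. wV i) \<longrightarrow>
         cut_weight E wE A \<le> soundness D \<mu> + 6 * \<delta> + 6 * \<epsilon>)" if \<epsilon>: "0 < \<epsilon>" for \<epsilon>
  proof -
    \<comment> \<open>\<open>\<tau>0\<close> keeps retained edges within the triangle inequalities,
      \<open>1 / 2\<close> keeps \<open>\<tau>\<close> below 1 to exclude loops, and
      \<open>\<epsilon>\<close> gives the required rate.\<close>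
    define \<tau> where "\<tau> = min \<epsilon> (min \<tau>0 (1 / 2))"
    have \<tau>: "0 < \<tau>" "\<tau> < 1" "\<tau> \<le> \<epsilon>" "\<tau> \<le> \<tau>0" using \<epsilon> \<tau>0 by (auto simp: \<tau>_def)
    have "\<exists>R0. \<forall>R\<ge>R0. \<forall>\<theta>\<in>set_pmf D. \<forall>k d f g. (\<forall>x. f x \<in> {0..1}) \<longrightarrow> (\<forall>y. g y \<in> {0..1}) \<longrightarrow>
      Gamma (rel_bias \<theta>) (expect (power_pair d (coord (rel_bias \<theta>) k R)) (\<lambda>p. f (fst p)))
        (expect (power_pair d (coord (rel_bias \<theta>) k R)) (\<lambda>p. g (snd p))) - \<epsilon>
      \<le> expect (power_pair d (coord (rel_bias \<theta>) k R)) (\<lambda>p. f (fst p) * g (snd p))"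
      by (intro finite_uniform_threshold fin discrete_Borell r1 neg \<epsilon>)
    then obtain R0 where R0: "\<forall>R\<ge>R0. \<forall>\<theta>\<in>set_pmf D. \<forall>k d f g. (\<forall>x. f x \<in> {0..1}) \<longrightarrow> (\<forall>y. g y \<in> {0..1}) \<longrightarrow>
      Gamma (rel_bias \<theta>) (expect (power_pair d (coord (rel_bias \<theta>) k R)) (\<lambda>p. f (fst p)))
        (expect (power_pair d (coord (rel_bias \<theta>) k R)) (\<lambda>p. g (snd p))) - \<epsilon>
      \<le> expect (power_pair d (coord (rel_bias \<theta>) k R)) (\<lambda>p. f (fst p) * g (snd p))"
      by (rule exE)
    define R where "R = Suc R0"
    have R: "0 < R" "R0 \<le> R" by (simp_all add: R_def)
    have "\<exists>k0. \<forall>k\<ge>k0. \<forall>\<theta>\<in>set_pmf D. \<exists>d0. \<forall>d\<ge>d0.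
      expect (power_pair d (coord (rel_bias \<theta>) k R)) (\<lambda>z. of_bool (\<not> \<bar>unitip d (fst z) (snd z) - rel_bias \<theta>\<bar> \<le> \<tau>)) \<le> \<tau>"
      by (intro finite_uniform_threshold fin power_pair_coord_correlation r1 neg R(1) \<tau>(1))
    then obtain k0 where k0: "\<forall>k\<ge>k0. \<forall>\<theta>\<in>set_pmf D. \<exists>d0. \<forall>d\<ge>d0.
      expect (power_pair d (coord (rel_bias \<theta>) k R)) (\<lambda>z. of_bool (\<not> \<bar>unitip d (fst z) (snd z) - rel_bias \<theta>\<bar> \<le> \<tau>)) \<le> \<tau>"
      by (rule exE)
    define k where "k = Suc k0"
    have k: "0 < k" "k0 \<le> k" by (simp_all add: k_def)
    have "\<exists>d1. \<forall>d\<ge>d1. \<forall>\<theta>\<in>set_pmf D.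
      expect (power_pair d (coord (rel_bias \<theta>) k R)) (\<lambda>z. of_bool (\<not> \<bar>unitip d (fst z) (snd z) - rel_bias \<theta>\<bar> \<le> \<tau>)) \<le> \<tau>"
      by (rule finite_uniform_threshold[OF fin]) (rule k0[rule_format, OF k(2)])
    then obtain d1 where d1: "\<forall>d\<ge>d1. \<forall>\<theta>\<in>set_pmf D.
      expect (power_pair d (coord (rel_bias \<theta>) k R)) (\<lambda>z. of_bool (\<not> \<bar>unitip d (fst z) (snd z) - rel_bias \<theta>\<bar> \<le> \<tau>)) \<le> \<tau>"
      by (rule exE)
    obtain d2 where d2: "\<And>d. d \<ge> d2 \<Longrightarrow> expect (state k R d) (\<lambda>X. expect (state k R d) (\<lambda>Y. \<bar>unitip d X Y\<bar>)) \<le> \<tau>"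
      using state_uncorrelated[OF R(1) k(1) \<tau>(1)] by blast
    define d where "d = Suc (max d1 d2)"
    have d: "0 < d" "d1 \<le> d" "d2 \<le> d" by (simp_all add: d_def)
    have str: "-1 + \<bar>bi + bj\<bar> + \<tau> \<le> bIJ \<and> bIJ \<le> 1 - \<bar>bi - bj\<bar> - \<tau>" if "(bi, bj, bIJ) \<in> set_pmf D" for bi bj bIJ
      using gap[OF that] \<tau>(4) by linarith
    have borell: "Gamma (rel_bias \<theta>) (expect (power_pair d (coord (rel_bias \<theta>) k R)) (\<lambda>p. f (fst p)))
        (expect (power_pair d (coord (rel_bias \<theta>) k R)) (\<lambda>p. g (snd p))) - \<epsilon>
      \<le> expect (power_pair d (coord (rel_bias \<theta>) k R)) (\<lambda>p. f (fst p) * g (snd p))"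
      if "\<theta> \<in> set_pmf D" "\<forall>x. f x \<in> {0..1}" "\<forall>y. g y \<in> {0..1}" for \<theta> f g
      using R0 R(2) that by blast
    show ?thesis
    \<comment> \<open>Any \<open>n\<close> with room for the abstract vertices works; the surplus
      vertices have weight 0.\<close>
    proof (rule exI[of _ "card (biases D \<times> set_pmf (state k R d))"], intro allI impI)
      fix n assume n: "card (biases D \<times> set_pmf (state k R d)) \<le> n"
      have "\<exists>E wV wE. is_weighted_graph n E wV wE \<and>
        (\<exists>m v. uncorr_bisection_solution m n wV \<tau> v \<and> triangle_on_edges m E v \<and>
           (\<Sum>(i, j)\<in>E. wE (i, j) * (1 - ip m (v i) (v j)) / 2) \<ge> completeness D - 2 * \<tau>) \<and>
        (\<forall>\<delta>\<ge>0. \<forall>A\<subseteq>{1..n}.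
           \<bar>(\<Sum>i\<in>A. wV i) - (\<Sum>i\<in>{1..n} - A. wV i)\<bar> \<le> \<delta> * (\<Sum>i\<in>{1..n}. wV i) \<longrightarrow>
           cut_weight E wE A \<le> soundness D \<mu> + 6 * \<delta> + 2 * \<epsilon>)"
        by (rule blueprint_graph[OF bp _ _ \<tau>(1,2) R(1) d(1) _ d2[OF d(3)] _ n])
           (rule str neg d1[rule_format, OF d(2)] borell; assumption)+
      then obtain E wV wE m v where G: "is_weighted_graph n E wV wE" "uncorr_bisection_solution m n wV \<tau> v" "triangle_on_edges m E v"
         "(\<Sum>(i, j)\<in>E. wE (i, j) * (1 - ip m (v i) (v j)) / 2) \<ge> completeness D - 2 * \<tau>"
        and S: "\<forall>\<delta>\<ge>0. \<forall>A\<subseteq>{1..n}.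
         \<bar>(\<Sum>i\<in>A. wV i) - (\<Sum>i\<in>{1..n} - A. wV i)\<bar> \<le> \<delta> * (\<Sum>i\<in>{1..n}. wV i) \<longrightarrow>
         cut_weight E wE A \<le> soundness D \<mu> + 6 * \<delta> + 2 * \<epsilon>"
        by (elim exE conjE) (rule that)
      have "uncorr_bisection_solution m n wV (6 * \<epsilon>) v"
        using G(2) \<tau>(3) \<epsilon> by (auto simp: uncorr_bisection_solution_def)
      moreover have "(\<Sum>(i, j)\<in>E. wE (i, j) * (1 - ip m (v i) (v j)) / 2) \<ge> completeness D - 6 * \<epsilon>"
        using G(4) \<tau>(3) \<epsilon> by linarith
      moreover have "cut_weight E wE A \<le> soundness D \<mu> + 6 * \<delta> + 6 * \<epsilon>" if "\<delta> \<ge> 0" "A \<subseteq> {1..n}" 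
        "\<bar>(\<Sum>i\<in>A. wV i) - (\<Sum>i\<in>{1..n} - A. wV i)\<bar> \<le> \<delta> * (\<Sum>i\<in>{1..n}. wV i)" for \<delta> A
        using S[rule_format, OF that] \<epsilon> by linarith
      ultimately show "\<exists>E wV wE. is_weighted_graph n E wV wE \<and>
        (\<exists>m v. uncorr_bisection_solution m n wV (6 * \<epsilon>) v \<and> triangle_on_edges m E v \<and>
           (\<Sum>(i, j)\<in>E. wE (i, j) * (1 - ip m (v i) (v j)) / 2) \<ge> completeness D - 6 * \<epsilon>) \<and>
        (\<forall>\<delta>\<ge>0. \<forall>A\<subseteq>{1..n}.
           \<bar>(\<Sum>i\<in>A. wV i) - (\<Sum>i\<in>{1..n} - A. wV i)\<bar> \<le> \<delta> * (\<Sum>i\<in>{1..n}. wV i) \<longrightarrow>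
           cut_weight E wE A \<le> soundness D \<mu> + 6 * \<delta> + 6 * \<epsilon>)"
        using G(1,3) by blast
    qed
  qed
  \<comment> \<open>The value 6 is forced by the loss in \<open>\<delta>\<close> above and also
    dominates the factors 2 of the other errors. Since \<open>main\<close> holds for every positive
    \<open>\<epsilon>\<close>, the bound 1 for \<open>\<epsilon>0\<close> is an arbitrary
    choice.\<close>
  show ?thesis
    by (rule exI[of _ 6], intro conjI exI[of _ 1]) (use main in auto)
qed

end
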